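(* Let $f$ be a real vector field on $\mathbb{R}^d$, let $\mathcal{S}_h^{[2]}$ be a time-symmetric 2nd-order method for $x'=f(x)$, and let $n\ge 2$ be an integer. Let $\alpha_1,\dots,\alpha_s\in\mathbb{C}$ satisfy $\alpha_{s+1-j}=\alpha_j$ for $j=1,\dots,s$ and $\sum_{j=1}^s\alpha_j=1$, and suppose that the left-right palindromic composition $$\mathcal{S}_h^{[2n]}=\mathcal{S}^{[2]}_{\alpha_s h}\circ\mathcal{S}^{[2]}_{\alpha_{s-1}h}\circ\cdots\circ\mathcal{S}^{[2]}_{\alpha_2 h}\circ\mathcal{S}^{[2]}_{\alpha_1 h}=\mathcal{S}^{[2]}_{\alpha_1 h}\circ\mathcal{S}^{[2]}_{\alpha_2 h}\circ\cdots\circ\mathcal{S}^{[2]}_{\alpha_2 h}\circ\mathcal{S}^{[2]}_{\alpha_1 h}$$ is of order $2n$. Then the method obtained by taking its real part, $$\phi_h^{[2n]}=\tfrac12\left(\mathcal{S}_h^{[2n]}+\overline{\mathcal{S}}_h^{[2n]}\right),$$ is of the same order $2n$ and is pseudo-symmetric of order $q=4n+1$. If in addition $f$ is a (real) Hamiltonian vector field and $\mathcal{S}_h^{[2]}$ is a symplectic integrator, then $\phi_h^{[2n]}$ is pseudo-symplectic of order $p=4n+1$.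
   Context: Consider the initial value problem $x'=f(x)$, $x(t_0)=x_0\in\mathbb{R}^d$, with exact flow $\varphi_t$. An integrator (one-step map) $\psi_h$ is of order $r$ if $\psi_h(x)=\varphi_h(x)+\mathcal{O}(h^{r+1})$ as $h\to0$; it is consistent if it is of order at least 1. A time-symmetric 2nd-order method $\mathcal{S}_h^{[2]}$ satisfies $\mathcal{S}_h^{[2]}(x)=\varphi_h(x)+\mathcal{O}(h^3)$ and $\mathcal{S}_h^{[2]}\circ\mathcal{S}_{-h}^{[2]}=\mathrm{id}$. The adjoint of an integrator $\psi_h$ is $\psi_h^*:=\psi_{-h}^{-1}$. Lie-series convention: with $F=\sum_i f_i(x)\,\partial/\partial x_i$ one has $g(\varphi_h(x))=\exp(hF)[g](x)$ as an expansion in powers of $h$ for smooth $g$, and $g(\mathcal{S}_h^{[2]}(x))=\Phi^{[2]}(h)[g](x)$ with $\Phi^{[2]}(h)=\exp(hF+h^3Y_3+h^5Y_5+\cdots)$, where the $Y_{2k+1}$ are differential operators (vector fields) depending on the method. Since $f$ is real, the basic method $\mathcal{S}_h^{[2]}$ is real, i.e. it maps real points to real points for real $h$ and the $Y_{2k+1}$ are real. The map $f$ and the basic method are assumed regular enough (e.g. real analytic) that $\mathcal{S}_{\alpha h}^{[2]}$ makes sense for complex $\alpha$ and small real $h$, with the series $\Phi^{[2]}(\alpha h)$. $\overline{\mathcal{S}}_h^{[2n]}$ denotes the complex conjugate method, i.e. the composition with each coefficient $\alpha_j$ replaced by $\bar\alpha_j$; so for real $x$ and real $h$, $\phi_h^{[2n]}(x)=\Re(\mathcal{S}_h^{[2n]}(x))$.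 Definitions. Let $\psi_h$ be a smooth and consistent integrator. (1) $\psi_h$ is pseudo-symmetric of (pseudo-symmetry) order $q$ if for all sufficiently small $h$, $\psi_h^*=\psi_h+\mathcal{O}(h^{q+1})$, where the constant in the $\mathcal{O}$-term depends on bounds of derivatives of $\psi_h$. (2) $\psi_h$ is pseudo-symplectic of (pseudo-symplecticity) order $p$ if for all sufficiently small $h$, when it is applied to a Hamiltonian system, $(\psi_h')^TJ\,\psi_h'=J+\mathcal{O}(h^{p+1})$, where $\psi_h'$ is the Jacobian matrix with respect to $x$, $J$ is the canonical symplectic matrix, and the constant in the $\mathcal{O}$-term depends on bounds of derivatives of $\psi_h$. *)

theory Defs
  imports "HOL-Analysis.Analysis"
begin

text \<open>
  A one-step map on \<open>\<real>\<^sup>d\<close> is a function \<open>\<psi> h x\<close> of the (signed, real) step size and the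
  state. It is a total function, but all notions below only look at its germ along \<open>h = 0\<close>:
  "for all sufficiently small \<open>h\<close>" and the constants in \<open>O\<close>-terms are always understood uniformly
  for \<open>x\<close> in an arbitrary compact set. Thus implicit methods, which are only defined for
  small step sizes, are covered.
\<close>

definition vec_of_real :: "real^'d \<Rightarrow> complex^'d" where
  "vec_of_real x = (\<chi> i. complex_of_real (x $ i))"

definition vec_Re :: "complex^'d \<Rightarrow> real^'d" where
  "vec_Re z = (\<chi> i. Re (z $ i))"

definition small_step :: "(real \<Rightarrow> real^'d \<Rightarrow> bool) \<Rightarrow> bool" where
  "small_step P \<longleftrightarrow> (\<forall>K. compact K \<longrightarrow> (\<forall>\<^sub>F h in nhds 0. \<forall>x\<in>K. P h x))"

definition bigO_step_on ::
    "(real^'d) set \<Rightarrow> nat \<Rightarrow> (real \<Rightarrow> real^'d \<Rightarrow> 'b::real_normed_vector) \<Rightarrow> bool" where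
  "bigO_step_on K k E \<longleftrightarrow> (\<exists>C. \<forall>\<^sub>F h in at 0. \<forall>x\<in>K. norm (E h x) \<le> C * \<bar>h\<bar> ^ k)"

definition bigO_step :: "nat \<Rightarrow> (real \<Rightarrow> real^'d \<Rightarrow> 'b::real_normed_vector) \<Rightarrow> bool" where
  "bigO_step k E \<longleftrightarrow> (\<forall>K. compact K \<longrightarrow> bigO_step_on K k E)"


subsection \<open>Smoothness and analyticity\<close>

text \<open>In finite dimension and on an open set \<open>U\<close>, \<open>Ck_on k g U\<close> is the usual class \<open>C\<^sup>k\<close>:
  continuity of all iterated directional derivatives of differentiable maps.\<close>

primrec Ck_on :: "nat \<Rightarrow> ('a::real_normed_vector \<Rightarrow> 'b::real_normed_vector) \<Rightarrow> 'a set \<Rightarrow> bool" where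
  "Ck_on 0 g U \<longleftrightarrow> continuous_on U g"
| "Ck_on (Suc k) g U \<longleftrightarrow>
     g differentiable_on U \<and> (\<forall>v. Ck_on k (\<lambda>x. frechet_derivative g (at x) v) U)"

definition smooth_on :: "('a::real_normed_vector \<Rightarrow> 'b::real_normed_vector) \<Rightarrow> 'a set \<Rightarrow> bool" where
  "smooth_on g U \<longleftrightarrow> open U \<and> (\<forall>k. Ck_on k g U)"

definition smooth_method :: "(real \<Rightarrow> real^'d \<Rightarrow> real^'d) \<Rightarrow> bool" where
  "smooth_method \<psi> \<longleftrightarrow> (\<exists>U. {0} \<times> UNIV \<subseteq> U \<and> smooth_on (\<lambda>(h, x). \<psi> h x) U)"

text \<open>Holomorphy in several variables: on an open set, the total derivative exists and is
  complex linear.\<close>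

definition holomorphic_method_on ::
    "(complex \<Rightarrow> complex^'d \<Rightarrow> complex^'d) \<Rightarrow> (complex \<times> (complex^'d)) set \<Rightarrow> bool" where
  "holomorphic_method_on S D \<longleftrightarrow> open D \<and>
     (\<forall>p\<in>D. \<exists>S'. ((\<lambda>(h, z). S h z) has_derivative S') (at p) \<and>
        (\<forall>c k w. S' (c * k, c *s w) = c *s S' (k, w)))"

text \<open>\<open>SC\<close> extends the real analytic method \<open>S\<close> to complex step sizes and states. Outside the
  domain \<open>D\<close> of the extension the values of \<open>SC\<close> are irrelevant.\<close>

definition analytic_extension ::
    "(real \<Rightarrow> real^'d \<Rightarrow> real^'d) \<Rightarrow> (complex \<Rightarrow> complex^'d \<Rightarrow> complex^'d) \<Rightarrow> bool" where
  "analytic_extension S SC \<longleftrightarrow>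
     (\<exists>D. holomorphic_method_on SC D \<and> (\<forall>x. (0, vec_of_real x) \<in> D) \<and>
        (\<forall>h x. (complex_of_real h, vec_of_real x) \<in> D \<longrightarrow>
           SC (complex_of_real h) (vec_of_real x) = vec_of_real (S h x)))"


subsection \<open>Flow, order and symmetry\<close>

definition exact_flow :: "(real^'d \<Rightarrow> real^'d) \<Rightarrow> (real \<Rightarrow> real^'d \<Rightarrow> real^'d) \<Rightarrow> bool" where
  "exact_flow f \<phi> \<longleftrightarrow> (\<forall>x. \<phi> 0 x = x) \<and>
     small_step (\<lambda>t x. ((\<lambda>s. \<phi> s x) has_vector_derivative f (\<phi> t x)) (at t))"

text \<open>The codomain is kept general because the composition methods below take complex values
  at real points; they are compared with \<open>vec_of_real (\<phi> h x)\<close>.\<close>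

definition has_order ::
    "(real \<Rightarrow> real^'d \<Rightarrow> 'b::real_normed_vector) \<Rightarrow> nat \<Rightarrow> (real \<Rightarrow> real^'d \<Rightarrow> 'b) \<Rightarrow> bool" where
  "has_order \<phi> r \<psi> \<longleftrightarrow> bigO_step (r + 1) (\<lambda>h x. \<psi> h x - \<phi> h x)"

definition consistent ::
    "(real \<Rightarrow> real^'d \<Rightarrow> real^'d) \<Rightarrow> (real \<Rightarrow> real^'d \<Rightarrow> real^'d) \<Rightarrow> bool" where
  "consistent \<phi> \<psi> \<longleftrightarrow> has_order \<phi> 1 \<psi>"

definition time_symmetric :: "(real \<Rightarrow> real^'d \<Rightarrow> real^'d) \<Rightarrow> bool" where
  "time_symmetric S \<longleftrightarrow> small_step (\<lambda>h x. S h (S (- h) x) = x)"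

text \<open>The adjoint \<open>\<psi>\<^sub>-\<^sub>h\<inverse>\<close>, where \<open>\<psi>\<^sub>-\<^sub>h\<close> (invertible only near the identity) is restricted
  to a set \<open>U\<close> of states. The definition of pseudo-symmetry demands for every bounded open
  neighbourhood \<open>U\<close> of a compact set \<open>K\<close> that this restriction is injective and that the inverse
  is defined on \<open>K\<close> for small \<open>h\<close>, so \<open>inv_into\<close> is the genuine inverse there.\<close>

definition adjoint_on ::
    "(real^'d) set \<Rightarrow> (real \<Rightarrow> real^'d \<Rightarrow> real^'d) \<Rightarrow> real \<Rightarrow> real^'d \<Rightarrow> real^'d" where
  "adjoint_on U \<psi> h = inv_into U (\<psi> (- h))"

definition pseudo_symmetric ::
    "(real \<Rightarrow> real^'d \<Rightarrow> real^'d) \<Rightarrow> nat \<Rightarrow> (real \<Rightarrow> real^'d \<Rightarrow> real^'d) \<Rightarrow> bool" where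
  "pseudo_symmetric \<phi> q \<psi> \<longleftrightarrow> smooth_method \<psi> \<and> consistent \<phi> \<psi> \<and>
     (\<forall>K U. compact K \<and> open U \<and> bounded U \<and> K \<subseteq> U \<longrightarrow>
        (\<forall>\<^sub>F h in nhds 0. inj_on (\<psi> (- h)) U \<and> K \<subseteq> \<psi> (- h) ` U) \<and>
        bigO_step_on K (q + 1) (\<lambda>h x. adjoint_on U \<psi> h x - \<psi> h x))"


subsection \<open>Hamiltonian structure\<close>

text \<open>A bijection \<open>b\<close> from the coordinates of \<open>\<real>\<^sup>d\<close> to \<open>'m + 'm\<close> (so \<open>d = 2m\<close>) labels them as
  positions \<open>Inl i\<close> and momenta \<open>Inr i\<close>. With respect to this labelling,
  \<open>symplectic_J b\<close> is the block matrix with rows \<open>(0, I)\<close> and \<open>(-I, 0)\<close>.\<close>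

fun canonical_form :: "'m + 'm \<Rightarrow> 'm + 'm \<Rightarrow> real" where
  "canonical_form (Inl i) (Inr j) = (if i = j then 1 else 0)"
| "canonical_form (Inr i) (Inl j) = (if i = j then - 1 else 0)"
| "canonical_form _ _ = 0"

definition symplectic_J :: "('d \<Rightarrow> 'm + 'm) \<Rightarrow> real^'d^'d" where
  "symplectic_J b = (\<chi> i j. canonical_form (b i) (b j))"

definition hamiltonian_field :: "('d \<Rightarrow> 'm + 'm) \<Rightarrow> (real^'d \<Rightarrow> real^'d) \<Rightarrow> bool" where
  "hamiltonian_field b f \<longleftrightarrow>
     (\<exists>H gradH. \<forall>x. (GDERIV H x :> gradH x) \<and> f x = symplectic_J b *v gradH x)"

definition state_jacobian :: "(real \<Rightarrow> real^'d \<Rightarrow> real^'d) \<Rightarrow> real \<Rightarrow> real^'d \<Rightarrow> real^'d^'d" where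
  "state_jacobian \<psi> h x = matrix (frechet_derivative (\<psi> h) (at x))"

definition symplectic_method ::
    "('d \<Rightarrow> 'm + 'm) \<Rightarrow> (real \<Rightarrow> real^'d \<Rightarrow> real^'d) \<Rightarrow> bool" where
  "symplectic_method b S \<longleftrightarrow> small_step (\<lambda>h x.
     transpose (state_jacobian S h x) ** symplectic_J b ** state_jacobian S h x = symplectic_J b)"

definition pseudo_symplectic ::
    "('d \<Rightarrow> 'm + 'm) \<Rightarrow> (real \<Rightarrow> real^'d \<Rightarrow> real^'d) \<Rightarrow> nat \<Rightarrow> (real \<Rightarrow> real^'d \<Rightarrow> real^'d) \<Rightarrow> bool"
  where
  "pseudo_symplectic b \<phi> p \<psi> \<longleftrightarrow> smooth_method \<psi> \<and> consistent \<phi> \<psi> \<and>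
     bigO_step (p + 1) (\<lambda>h x.
       transpose (state_jacobian \<psi> h x) ** symplectic_J b ** state_jacobian \<psi> h x
         - symplectic_J b)"


subsection \<open>Composition with complex coefficients\<close>

text \<open>\<open>composition S \<alpha> s h\<close> is \<open>S (\<alpha> s * h) \<circ> \<dots> \<circ> S (\<alpha> 1 * h)\<close>; only \<open>\<alpha> 1, \<dots>, \<alpha> s\<close> are used.\<close>

primrec composition ::
    "(complex \<Rightarrow> complex^'d \<Rightarrow> complex^'d) \<Rightarrow> (nat \<Rightarrow> complex) \<Rightarrow> nat \<Rightarrow>
     complex \<Rightarrow> complex^'d \<Rightarrow> complex^'d" where
  "composition S \<alpha> 0 h = id"
| "composition S \<alpha> (Suc k) h = S (\<alpha> (Suc k) * h) \<circ> composition S \<alpha> k h"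

definition composition_method ::
    "(complex \<Rightarrow> complex^'d \<Rightarrow> complex^'d) \<Rightarrow> (nat \<Rightarrow> complex) \<Rightarrow> nat \<Rightarrow>
     real \<Rightarrow> real^'d \<Rightarrow> complex^'d" where
  "composition_method S \<alpha> s h x = composition S \<alpha> s (complex_of_real h) (vec_of_real x)"

definition conjugate_mean ::
    "(complex \<Rightarrow> complex^'d \<Rightarrow> complex^'d) \<Rightarrow> (nat \<Rightarrow> complex) \<Rightarrow> nat \<Rightarrow>
     real \<Rightarrow> real^'d \<Rightarrow> complex^'d" where
  "conjugate_mean S \<alpha> s h x =
     (1 / 2) *\<^sub>R (composition_method S \<alpha> s h x + composition_method S (\<lambda>j. cnj (\<alpha> j)) s h x)"

text \<open>For a real basic method, \<open>conjugate_mean\<close> has real values for small \<open>h\<close>; the following is the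
  same method with values in \<open>\<real>\<^sup>d\<close>.\<close>

definition real_part_method ::
    "(complex \<Rightarrow> complex^'d \<Rightarrow> complex^'d) \<Rightarrow> (nat \<Rightarrow> complex) \<Rightarrow> nat \<Rightarrow>
     real \<Rightarrow> real^'d \<Rightarrow> real^'d" where
  "real_part_method S \<alpha> s h x = vec_Re (conjugate_mean S \<alpha> s h x)"

end

theory Submission
  imports Defs "HOL-Complex_Analysis.Complex_Analysis"
begin

text \<open>
  Extend the method to a holomorphic map of complex step sizes and states near the points \<open>(0, x)\<close>
  with \<open>x\<close> real. By the identity theorem, time symmetry, compatibility with complex conjugation
  and symplecticity of the basic method persist for the extension, and therefore for the palindromic
  composition \<open>\<Phi>\<close> and its conjugate \<open>\<Psi>\<close>. Write \<open>\<Phi> = M + N\<close> and \<open>\<Psi> = M - N\<close>, where \<open>M\<close> extends the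
  real part and \<open>N = O(h\<^bsup>2n+1\<^esup>)\<close>. Symmetry gives \<open>z = \<Phi>\<^sub>h(w + d) = \<Psi>\<^sub>h(w - d)\<close> for \<open>w = M\<^sub>-\<^sub>h(z)\<close> and
  \<open>d = N\<^sub>-\<^sub>h(z)\<close>; averaging the two identities, the terms linear in \<open>N\<close> cancel and
  \<open>M\<^sub>h(M\<^sub>-\<^sub>h(z)) = z + O(h\<^bsup>4n+2\<^esup>)\<close>. In the same way, averaging \<open>\<omega>(\<Phi>'u, \<Phi>'v) = \<omega>(u, v)\<close> and
  \<open>\<omega>(\<Psi>'u, \<Psi>'v) = \<omega>(u, v)\<close> gives \<open>\<omega>(M'u, M'v) = \<omega>(u, v) - \<omega>(N'u, N'v)\<close>, whose last term is
  \<open>O(h\<^bsup>4n+2\<^esup>)\<close>.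
\<close>

text \<open>The order hypothesis bounds \<open>defect\<close> only for real \<open>h\<close> and
  real states, yet the symmetry argument evaluates it at \<open>w + d\<close> and
  \<open>w - d\<close>, which are complex even for real data. The obstacle is to carry an order
  bound from real points to a complex neighbourhood without losing a power of \<open>h\<close>;
  \<open>holomorphic_order\<close> does this. Another loss threatens when a bound
  \<open>O(h^m)\<close> is differentiated in the state: Cauchy estimates along directions
  \<open>(0, v)\<close> keep \<open>h\<close> fixed and so keep the power. The error of the averaged
  identity has two parts, a second difference of \<open>mean\<close> over \<open>d\<close>, and a
  difference over \<open>d\<close> of \<open>defect\<close>, already of size \<open>h^m\<close>. As
  \<open>d\<close> is \<open>O(h^m)\<close>, both are \<open>O(h^(2m))\<close>, and
  \<open>m = 2n + 1\<close> gives \<open>h^(4n+2)\<close>. Everything is local at points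
  \<open>(0, x)\<close>, and several variables are reduced to one by restriction to complex lines.
  The adjoint is a genuine inverse on a prescribed bounded set, so its existence needs its own
  argument, from closeness to the identity.\<close>

unbundle no fps_syntax

subsection \<open>Complex differentiability in several variables\<close>

text \<open>Complex scalars are added on top of the real structure, so that the real
  \<open>has_derivative\<close> stays the notion of derivative and complex linearity becomes a
  separate condition on it. The instances below cover the space of pairs of a step size and a
  state.\<close>

class complex_normed_space = real_normed_vector +
  fixes scaleC :: "complex \<Rightarrow> 'a \<Rightarrow> 'a" (infixr \<open>*\<^sub>C\<close> 75)
  assumes scaleC_add_right: "c *\<^sub>C (x + y) = c *\<^sub>C x + c *\<^sub>C y"
    and scaleC_add_left: "(c + d) *\<^sub>C x = c *\<^sub>C x + d *\<^sub>C x"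
    and scaleC_scaleC [simp]: "c *\<^sub>C d *\<^sub>C x = (c * d) *\<^sub>C x"
    and scaleC_of_real [simp]: "complex_of_real r *\<^sub>C x = r *\<^sub>R x"
    and norm_scaleC: "norm (c *\<^sub>C x) = cmod c * norm x"

instantiation complex :: complex_normed_space
begin
definition "c *\<^sub>C (z::complex) = c * z"
instance
  by standard (simp_all add: scaleC_complex_def algebra_simps scaleR_conv_of_real norm_mult)
end

instantiation prod :: (complex_normed_space, complex_normed_space) complex_normed_space
begin
definition "c *\<^sub>C p = (c *\<^sub>C fst p, c *\<^sub>C snd p)"
instance
proof
  fix c :: complex and p :: "'a \<times> 'b"
  have "sqrt ((cmod c * norm (fst p))\<^sup>2 + (cmod c * norm (snd p))\<^sup>2)
      = sqrt ((cmod c)\<^sup>2 * ((norm (fst p))\<^sup>2 + (norm (snd p))\<^sup>2))"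
    by (simp add: power_mult_distrib algebra_simps)
  then show "norm (c *\<^sub>C p) = cmod c * norm p"
    by (simp add: scaleC_prod_def norm_prod_def norm_scaleC real_sqrt_mult)
qed (simp_all add: scaleC_prod_def scaleC_add_right scaleC_add_left scaleR_prod_def)
end

instantiation vec :: (complex_normed_space, finite) complex_normed_space
begin
definition "c *\<^sub>C x = (\<chi> i. c *\<^sub>C (x $ i))"
instance
  by standard
    (simp_all add: scaleC_vec_def vec_eq_iff scaleC_add_right scaleC_add_left norm_vec_def
      norm_scaleC L2_set_right_distrib)
end

lemma scaleC_Pair [simp]: "c *\<^sub>C (x, y) = (c *\<^sub>C x, c *\<^sub>C y)"
  by (simp add: scaleC_prod_def)

lemma fst_scaleC [simp]: "fst (c *\<^sub>C p) = c *\<^sub>C fst p"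
  and snd_scaleC [simp]: "snd (c *\<^sub>C p) = c *\<^sub>C snd p"
  by (simp_all add: scaleC_prod_def)

lemma vec_scaleC_nth [simp]: "(c *\<^sub>C x) $ i = c *\<^sub>C (x $ i)"
  by (simp add: scaleC_vec_def)

lemma bounded_bilinear_scaleC: "bounded_bilinear scaleC"
proof
  fix r :: real and c :: complex and x y :: 'a
  show "(r *\<^sub>R c) *\<^sub>C x = r *\<^sub>R c *\<^sub>C x"
    by (metis scaleC_of_real scaleC_scaleC scaleR_conv_of_real)
  show "c *\<^sub>C r *\<^sub>R x = r *\<^sub>R c *\<^sub>C x"
    by (metis scaleC_of_real scaleC_scaleC mult.commute)
  show "\<exists>K. \<forall>(c::complex) (x::'a). norm (c *\<^sub>C x) \<le> norm c * norm x * K"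
    by (intro exI[of _ 1]) (simp add: norm_scaleC)
qed (simp_all add: scaleC_add_right scaleC_add_left)

interpretation scaleC: bounded_bilinear "scaleC :: complex \<Rightarrow> 'a \<Rightarrow> 'a::complex_normed_space"
  by (rule bounded_bilinear_scaleC)

lemma scaleC_one [simp]: "1 *\<^sub>C x = x"
  using scaleC_of_real[of 1 x] by simp

lemma scaleC_minus_one: "(- 1) *\<^sub>C x = - x"
  using scaleC_of_real[of "-1" x] by simp

text \<open>A condition at a single point; it is the one that \<open>holomorphic_method_on\<close>
  imposes at every point of its domain.\<close>

definition cdifferentiable ::
    "('a::complex_normed_space \<Rightarrow> 'b::complex_normed_space) \<Rightarrow> 'a \<Rightarrow> bool" where
  "cdifferentiable f p \<longleftrightarrow> (\<exists>f'. (f has_derivative f') (at p) \<and> (\<forall>c v. f' (c *\<^sub>C v) = c *\<^sub>C f' v))"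

text \<open>The direction precedes the point so that \<open>deriv_along f v\<close> is itself a map
  on the domain, to which the holomorphy results can be applied again.\<close>

abbreviation deriv_along :: "('a::real_normed_vector \<Rightarrow> 'b::real_normed_vector) \<Rightarrow> 'a \<Rightarrow> 'a \<Rightarrow> 'b"
  where "deriv_along f v p \<equiv> frechet_derivative f (at p) v"

lemma cdifferentiableI:
  "(f has_derivative f') (at p) \<Longrightarrow> (\<And>c v. f' (c *\<^sub>C v) = c *\<^sub>C f' v) \<Longrightarrow> cdifferentiable f p"
  by (auto simp: cdifferentiable_def)

lemma cdifferentiable_has_derivative:
  assumes "cdifferentiable f p"
  shows "(f has_derivative (\<lambda>v. deriv_along f v p)) (at p)"
  using assms unfolding cdifferentiable_def
  by (auto simp: frechet_derivative_works[symmetric] differentiableI)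

lemma deriv_along_eq: "(f has_derivative f') (at p) \<Longrightarrow> deriv_along f v p = f' v"
  by (metis frechet_derivative_at)

lemma deriv_along_scaleC:
  "cdifferentiable f p \<Longrightarrow> deriv_along f (c *\<^sub>C v) p = c *\<^sub>C deriv_along f v p"
  unfolding cdifferentiable_def by (auto simp: deriv_along_eq)

lemma cdifferentiable_isCont: "cdifferentiable f p \<Longrightarrow> isCont f p"
  using cdifferentiable_has_derivative has_derivative_continuous by blast

lemma cdifferentiable_cong:
  assumes "cdifferentiable f p" and "\<forall>\<^sub>F q in nhds p. f q = g q"
  shows "cdifferentiable g p"
proof -
  obtain f' where f': "(f has_derivative f') (at p)" "\<And>c v. f' (c *\<^sub>C v) = c *\<^sub>C f' v"
    using assms(1) by (auto simp: cdifferentiable_def)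
  have "\<forall>\<^sub>F q in at p. f q = g q" "f p = g p"
    using assms(2) by (auto simp: eventually_at_filter dest: eventually_nhds_x_imp_x elim: eventually_mono)
  then have "(g has_derivative f') (at p)"
    using has_derivative_transform_eventually[OF f'(1)] by auto
  then show ?thesis
    using f'(2) by (rule cdifferentiableI)
qed

lemma cdifferentiable_linear:
  assumes "bounded_linear L" and "\<And>c v. L (c *\<^sub>C v) = c *\<^sub>C L v"
  shows "cdifferentiable L p"
  by (rule cdifferentiableI[OF bounded_linear_imp_has_derivative[OF assms(1)] assms(2)])

lemma cdifferentiable_const: "cdifferentiable (\<lambda>_. a) p"
  by (rule cdifferentiableI[OF has_derivative_const]) (simp add: scaleC.zero_right)

lemma cdifferentiable_compose:
  assumes "cdifferentiable g p" and "cdifferentiable f (g p)"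
  shows "cdifferentiable (\<lambda>x. f (g x)) p"
proof -
  obtain f' g' where *: "(g has_derivative g') (at p)" "(f has_derivative f') (at (g p))"
    "\<And>c v. f' (c *\<^sub>C v) = c *\<^sub>C f' v" "\<And>c v. g' (c *\<^sub>C v) = c *\<^sub>C g' v"
    using assms unfolding cdifferentiable_def by blast
  show ?thesis
    by (rule cdifferentiableI[OF has_derivative_compose[OF *(1,2)]]) (simp add: *(3,4))
qed

lemma cdifferentiable_add:
  "cdifferentiable f p \<Longrightarrow> cdifferentiable g p \<Longrightarrow> cdifferentiable (\<lambda>x. f x + g x) p"
  by (rule cdifferentiableI[OF has_derivative_add[OF cdifferentiable_has_derivative
          cdifferentiable_has_derivative]])
    (simp_all add: deriv_along_scaleC scaleC_add_right)

lemma cdifferentiable_scaleC: "cdifferentiable f p \<Longrightarrow> cdifferentiable (\<lambda>x. c *\<^sub>C f x) p"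
  by (rule cdifferentiable_compose[where f = "scaleC c"])
    (simp_all add: cdifferentiable_linear scaleC.bounded_linear_right mult.commute)

lemma cdifferentiable_minus: "cdifferentiable f p \<Longrightarrow> cdifferentiable (\<lambda>x. - f x) p"
  using cdifferentiable_scaleC[of f p "-1"] by (simp add: scaleC_minus_one)

lemma cdifferentiable_diff:
  "cdifferentiable f p \<Longrightarrow> cdifferentiable g p \<Longrightarrow> cdifferentiable (\<lambda>x. f x - g x) p"
  using cdifferentiable_add[OF _ cdifferentiable_minus] by fastforce

lemma cdifferentiable_sum:
  "(\<And>i. i \<in> A \<Longrightarrow> cdifferentiable (f i) p) \<Longrightarrow> cdifferentiable (\<lambda>x. \<Sum>i\<in>A. f i x) p"
  by (induction A rule: infinite_finite_induct) (auto intro: cdifferentiable_add cdifferentiable_const)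

lemma cdifferentiable_mult:
  fixes f g :: "'a::complex_normed_space \<Rightarrow> complex"
  assumes "cdifferentiable f p" "cdifferentiable g p"
  shows "cdifferentiable (\<lambda>x. f x * g x) p"
proof -
  obtain f' g' where *: "(f has_derivative f') (at p)" "(g has_derivative g') (at p)"
    "\<And>c v. f' (c *\<^sub>C v) = c *\<^sub>C f' v" "\<And>c v. g' (c *\<^sub>C v) = c *\<^sub>C g' v"
    using assms unfolding cdifferentiable_def by blast
  show ?thesis
    by (rule cdifferentiableI[OF has_derivative_mult[OF *(1,2)]])
      (simp add: *(3,4) scaleC_complex_def algebra_simps)
qed

lemma cdifferentiable_Pair:
  "cdifferentiable f p \<Longrightarrow> cdifferentiable g p \<Longrightarrow> cdifferentiable (\<lambda>x. (f x, g x)) p"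
  by (rule cdifferentiableI[OF has_derivative_Pair[OF cdifferentiable_has_derivative
          cdifferentiable_has_derivative]])
    (simp_all add: deriv_along_scaleC)

lemma cdifferentiable_id: "cdifferentiable (\<lambda>x. x) p"
  and cdifferentiable_fst: "cdifferentiable fst q"
  and cdifferentiable_snd: "cdifferentiable snd q"
  and cdifferentiable_nth: "cdifferentiable (\<lambda>x. x $ i) r"
  by (simp_all add: cdifferentiable_linear bounded_linear_ident bounded_linear_fst
      bounded_linear_snd bounded_linear_vec_nth)

text \<open>The vector is the finite sum of its components placed on the axes, and each embedding
  \<open>axis i\<close> is bounded and complex linear.\<close>

lemma cdifferentiable_vec:
  fixes f :: "'a::complex_normed_space \<Rightarrow> 'b::complex_normed_space^'n"
  assumes "\<And>i. cdifferentiable (\<lambda>x. f x $ i) p"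
  shows "cdifferentiable f p"
proof -
  have axis: "bounded_linear (axis i :: 'b \<Rightarrow> 'b^'n)" for i
    by (rule bounded_linear_intro[where K = 1])
      (simp_all add: axis_def vec_eq_iff norm_vec_def L2_set_def if_distrib[of norm]
        if_distrib[of "\<lambda>x. x\<^sup>2"] cong: if_cong)
  have "cdifferentiable (\<lambda>x. axis i (f x $ i)) p" for i
    by (intro cdifferentiable_compose[OF assms] cdifferentiable_linear[OF axis])
      (auto simp: axis_def vec_eq_iff scaleC.zero_right)
  then have "cdifferentiable (\<lambda>x. \<Sum>i\<in>UNIV. axis i (f x $ i)) p"
    by (rule cdifferentiable_sum)
  moreover have "(\<Sum>i\<in>UNIV. axis i (f x $ i)) = f x" for x
    by (simp add: vec_eq_iff axis_def)
  ultimately show ?thesis by simp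
qed

lemma deriv_along_nth:
  assumes "cdifferentiable f p"
  shows "deriv_along (\<lambda>x. f x $ i) v p = deriv_along f v p $ i"
  by (rule deriv_along_eq)
    (rule bounded_linear.has_derivative[OF bounded_linear_vec_nth cdifferentiable_has_derivative[OF assms]])

text \<open>Complex linearity turns the derivative along \<open>t *\<^sub>C v\<close> into
  multiplication by a number, which is the one-variable complex derivative. The estimates and the
  identity theorem enter through this restriction to lines.\<close>

lemma line_has_field_derivative:
  fixes f :: "'a::complex_normed_space \<Rightarrow> complex"
  assumes "cdifferentiable f (p + t *\<^sub>C v)"
  shows "((\<lambda>t. f (p + t *\<^sub>C v)) has_field_derivative deriv_along f v (p + t *\<^sub>C v)) (at t)"
proof -
  have "((\<lambda>t. p + t *\<^sub>C v) has_derivative (\<lambda>t. t *\<^sub>C v)) (at t)"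
    by (auto intro!: derivative_eq_intros bounded_linear_imp_has_derivative scaleC.bounded_linear_left)
  from has_derivative_compose[OF this cdifferentiable_has_derivative[OF assms]]
  show ?thesis
    by (simp add: deriv_along_scaleC[OF assms] scaleC_complex_def has_field_derivative_def mult_commute_abs)
qed

lemma line_holomorphic_on:
  fixes f :: "'a::complex_normed_space \<Rightarrow> complex"
  assumes "\<And>t. t \<in> A \<Longrightarrow> cdifferentiable f (p + t *\<^sub>C v)"
  shows "(\<lambda>t. f (p + t *\<^sub>C v)) holomorphic_on A"
  using line_has_field_derivative[OF assms]
  by (meson field_differentiable_at_within field_differentiable_def holomorphic_on_def)

subsection \<open>Schwarz and Cauchy estimates on complex lines\<close>

text \<open>The Schwarz lemma on a disc of radius \<open>r\<close> with bound \<open>M\<close>. The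
  quotient is controlled on the whole disc, so the division can be iterated with the same
  radius.\<close>

lemma Schwarz_divide:
  fixes f :: "complex \<Rightarrow> complex"
  assumes hol: "f holomorphic_on ball 0 r" and "r > 0" and "f 0 = 0"
    and bound: "\<And>t. norm t < r \<Longrightarrow> norm (f t) \<le> M"
  obtains g where "g holomorphic_on ball 0 r" "\<And>t. norm t < r \<Longrightarrow> f t = t * g t"
    "g 0 = deriv f 0" "\<And>t. norm t < r \<Longrightarrow> norm (g t) \<le> M / r"
proof -
  obtain g where g: "g holomorphic_on ball 0 r" "\<And>t. norm t < r \<Longrightarrow> f t = t * g t"
    "g 0 = deriv f 0"
    using Schwarz3[OF hol \<open>f 0 = 0\<close>] by metis
  have "M \<ge> 0"
    using bound[of 0] \<open>r > 0\<close> \<open>f 0 = 0\<close> by simp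
  have *: "norm (f (of_real r * t)) \<le> M * norm t" if "norm t < 1" for t
  proof (rule field_le_epsilon)
    fix e :: real assume "e > 0"
    \<comment> \<open>The Schwarz lemma asks for a strict bound by 1 on the unit disc. Dividing by
      \<open>M + e\<close> gives strictness and avoids division by zero when \<open>M = 0\<close>;
      \<open>e\<close> is arbitrary.\<close>
    define F where "F = (\<lambda>t. f (of_real r * t) / of_real (M + e))"
    have "norm (F t) \<le> norm t"
    proof (rule Schwarz_Lemma(1))
      have "((\<lambda>t. of_real r * t) ` ball 0 1) \<subseteq> ball (0::complex) r"
        using \<open>r > 0\<close> by (auto simp: norm_mult)
      then have "(f \<circ> (\<lambda>t. of_real r * t)) holomorphic_on ball 0 1"
        by (intro holomorphic_on_compose_gen[OF _ hol] holomorphic_intros)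
      then show "F holomorphic_on ball 0 1"
        unfolding F_def o_def using \<open>M \<ge> 0\<close> \<open>e > 0\<close>
        by (intro holomorphic_intros) (auto simp flip: of_real_add)
      show "F 0 = 0" by (simp add: F_def \<open>f 0 = 0\<close>)
      show "norm (F z) < 1" if "norm z < 1" for z
      proof -
        have "norm (of_real r * z) < r" using that \<open>r > 0\<close> by (simp add: norm_mult)
        from bound[OF this] show ?thesis
          using \<open>M \<ge> 0\<close> \<open>e > 0\<close>
          by (simp add: F_def norm_divide divide_less_eq abs_of_pos flip: of_real_add)
      qed
    qed fact
    moreover have "norm (f (of_real r * t)) = norm (F t) * (M + e)"
      using \<open>M \<ge> 0\<close> \<open>e > 0\<close> by (simp add: F_def norm_divide flip: of_real_add)
    ultimately have "norm (f (of_real r * t)) \<le> norm t * (M + e)"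
      using \<open>M \<ge> 0\<close> \<open>e > 0\<close> by (simp add: mult_right_mono)
    also have "\<dots> \<le> M * norm t + e"
      using \<open>e > 0\<close> that mult_right_mono[of "norm t" 1 e] by (simp add: algebra_simps)
    finally show "norm (f (of_real r * t)) \<le> M * norm t + e" .
  qed
  have gt: "norm (g t) \<le> M / r" if "norm t < r" "t \<noteq> 0" for t
  proof -
    have "norm (t / of_real r) < 1"
      using that \<open>r > 0\<close> by (simp add: norm_divide)
    from *[OF this] have "norm (f t) \<le> M * (norm t / r)"
      using \<open>r > 0\<close> by (simp add: norm_divide)
    then show ?thesis
      using g(2)[OF that(1)] that \<open>r > 0\<close> by (simp add: norm_mult field_simps)
  qed
  \<comment> \<open>The quotient \<open>f t / t\<close> gives no information at 0; there the bound
    is a limit from nearby points.\<close>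
  have "norm (g 0) \<le> M / r"
  proof (rule tendsto_upperbound)
    have "isCont g 0"
      using g(1) \<open>r > 0\<close> by (intro continuous_on_interior[OF holomorphic_on_imp_continuous_on]) auto
    then show "((\<lambda>t. norm (g t)) \<longlongrightarrow> norm (g 0)) (at 0)"
      unfolding isCont_def by (rule tendsto_norm)
    show "\<forall>\<^sub>F t in at 0. norm (g t) \<le> M / r"
      unfolding eventually_at using gt \<open>r > 0\<close> by (intro exI[of _ r]) auto
  qed simp
  with gt g that show ?thesis by metis
qed

text \<open>Real points accumulate at 0, so \<open>f 0 = 0\<close> by continuity, and after division
  by \<open>t\<close> the quotient satisfies the same hypotheses with one power less and
  \<open>M / r\<close> in place of \<open>M\<close>. The resulting constant is made of
  \<open>M\<close> and \<open>r\<close> alone, which later gives uniformity in the state.\<close>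

lemma Schwarz_order:
  fixes f :: "complex \<Rightarrow> complex"
  assumes "f holomorphic_on ball 0 r" and "r > 0"
    and "\<And>t. norm t < r \<Longrightarrow> norm (f t) \<le> M"
    and "\<forall>\<^sub>F t :: real in at 0. norm (f (of_real t)) \<le> C * \<bar>t\<bar> ^ m"
    and "norm t < r"
  shows "norm (f t) \<le> M * (norm t / r) ^ m"
  using assms
proof (induction m arbitrary: f M t)
  case (Suc m)
  have lim: "((\<lambda>t::real. f (of_real t)) \<longlongrightarrow> f 0) (at 0)"
  proof -
    have "isCont f 0"
      using Suc.prems(1,2) by (intro continuous_on_interior[OF holomorphic_on_imp_continuous_on]) auto
    moreover have "isCont (\<lambda>t::real. complex_of_real t) 0"
      by (intro continuous_intros)
    ultimately have "isCont (\<lambda>t::real. f (of_real t)) 0"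
      using isCont_o2[of 0 "\<lambda>t::real. complex_of_real t" f] by simp
    then show ?thesis by (simp add: isCont_def)
  qed
  have "((\<lambda>t::real. C * \<bar>t\<bar> ^ Suc m) \<longlongrightarrow> C * \<bar>0\<bar> ^ Suc m) (at 0)"
    by (intro tendsto_intros)
  then have "((\<lambda>t::real. C * \<bar>t\<bar> ^ Suc m) \<longlongrightarrow> 0) (at 0)"
    by simp
  then have "((\<lambda>t::real. f (of_real t)) \<longlongrightarrow> 0) (at 0)"
    by (rule Lim_null_comparison[OF Suc.prems(4)])
  with lim have "f 0 = 0"
    by (metis LIM_unique)
  then obtain g where g: "g holomorphic_on ball 0 r" "\<And>t. norm t < r \<Longrightarrow> f t = t * g t"
    "\<And>t. norm t < r \<Longrightarrow> norm (g t) \<le> M / r"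
    using Schwarz_divide[of f r M] Suc.prems by metis
  have "\<forall>\<^sub>F t :: real in at 0. \<bar>t\<bar> < r"
    unfolding eventually_at using \<open>r > 0\<close> by (intro exI[of _ r]) auto
  moreover have "\<forall>\<^sub>F t :: real in at 0. t \<noteq> 0"
    by (simp add: eventually_at_filter)
  ultimately have "\<forall>\<^sub>F t :: real in at 0. norm (g (of_real t)) \<le> C * \<bar>t\<bar> ^ m"
    using Suc.prems(4)
  proof eventually_elim
    case (elim t)
    then have "\<bar>t\<bar> * norm (g (of_real t)) \<le> \<bar>t\<bar> * (C * \<bar>t\<bar> ^ m)"
      using g(2)[of "of_real t"] by (simp add: norm_mult algebra_simps)
    then show ?case using elim by simp
  qed
  from Suc.IH[OF g(1) \<open>r > 0\<close> g(3) this \<open>norm t < r\<close>]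
  have "norm (g t) \<le> M / r * (norm t / r) ^ m" .
  then have "norm t * norm (g t) \<le> norm t * (M / r * (norm t / r) ^ m)"
    by (rule mult_left_mono) simp
  then show ?case
    using g(2)[OF \<open>norm t < r\<close>] by (simp add: norm_mult mult_ac)
qed auto

text \<open>Two divisions by \<open>t\<close>; the value of the first quotient at 0 is
  \<open>deriv f 0\<close>, which permits the second.\<close>

lemma Schwarz_second_order:
  fixes f :: "complex \<Rightarrow> complex"
  assumes "f holomorphic_on ball 0 r" and "r > 0" and "f 0 = 0" and "deriv f 0 = 0"
    and "\<And>t. norm t < r \<Longrightarrow> norm (f t) \<le> M" and t: "norm t < r"
  shows "norm (f t) \<le> M * (norm t / r)\<^sup>2"
proof -
  obtain g where g: "g holomorphic_on ball 0 r" "\<And>t. norm t < r \<Longrightarrow> f t = t * g t"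
    "g 0 = deriv f 0" "\<And>t. norm t < r \<Longrightarrow> norm (g t) \<le> M / r"
    using Schwarz_divide[OF assms(1,2,3,5)] by metis
  obtain k where k: "\<And>t. norm t < r \<Longrightarrow> g t = t * k t"
    "\<And>t. norm t < r \<Longrightarrow> norm (k t) \<le> M / r / r"
    using Schwarz_divide[OF g(1) \<open>r > 0\<close> _ g(4)] g(3) \<open>deriv f 0 = 0\<close> by metis
  have "norm (f t) = (norm t)\<^sup>2 * norm (k t)"
    using g(2)[OF t] k(1)[OF t] by (simp add: norm_mult power2_eq_square)
  also have "\<dots> \<le> (norm t)\<^sup>2 * (M / r / r)"
    by (rule mult_left_mono[OF k(2)[OF t]]) simp
  finally show ?thesis
    by (simp add: power2_eq_square mult_ac)
qed

lemma deriv_along_bound: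
  fixes f :: "'a::complex_normed_space \<Rightarrow> complex"
  assumes "r > 0" and "\<And>t. norm t < r \<Longrightarrow> cdifferentiable f (p + t *\<^sub>C v)"
    and "\<And>t. norm t < r \<Longrightarrow> norm (f (p + t *\<^sub>C v)) \<le> M"
  shows "norm (deriv_along f v p) \<le> 2 * M / r"
proof -
  define g where "g = (\<lambda>t. f (p + t *\<^sub>C v))"
  have hol: "g holomorphic_on ball 0 r"
    unfolding g_def by (rule line_holomorphic_on) (simp add: assms(2))
  have "(g has_field_derivative deriv_along f v p) (at 0)"
    using line_has_field_derivative[of f p 0 v] assms(1) assms(2)[of 0] by (simp add: g_def scaleC.zero_left)
  then have "deriv g 0 = deriv_along f v p"
    by (rule DERIV_imp_deriv)
  \<comment> \<open>Control is given on the open disc only; the circle of radius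
    \<open>r / 2\<close> is where the factor 2 comes from.\<close>
  moreover have "norm ((deriv ^^ 1) g 0) \<le> fact 1 * M / (r / 2) ^ 1"
  proof (rule Cauchy_inequality)
    show "g holomorphic_on ball 0 (r / 2)"
      using hol \<open>r > 0\<close> by (elim holomorphic_on_subset) auto
    show "continuous_on (cball 0 (r / 2)) g"
      using hol \<open>r > 0\<close>
      by (intro holomorphic_on_imp_continuous_on) (elim holomorphic_on_subset, auto)
    show "norm (g x) \<le> M" if "norm (0 - x) = r / 2" for x
      using assms(3)[of x] that \<open>r > 0\<close> by (simp add: g_def)
  qed (use \<open>r > 0\<close> in simp)
  ultimately show ?thesis by (simp add: mult.commute)
qed

text \<open>The difference with \<open>t v\<close> in place of \<open>v\<close> vanishes at
  \<open>t = 0\<close>, so one factor \<open>t\<close> splits off. The radius \<open>r\<close>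
  counts multiples of \<open>v\<close>: for small \<open>v\<close> it is proportional to
  \<open>1 / norm v\<close>, which makes the bound linear in \<open>norm v\<close>.\<close>

lemma norm_difference_le:
  fixes f :: "'a::complex_normed_space \<Rightarrow> complex"
  assumes "r > 1" and cd: "\<And>t. norm t < r \<Longrightarrow> cdifferentiable f (p + t *\<^sub>C v)"
    and bd: "\<And>t. norm t < r \<Longrightarrow> norm (f (p + t *\<^sub>C v)) \<le> M"
  shows "norm (f (p + v) - f (p - v)) \<le> 2 * M / r"
proof -
  define u where "u = (\<lambda>t. f (p + t *\<^sub>C v) - f (p + (- t) *\<^sub>C v))"
  have "(\<lambda>t. f (p + t *\<^sub>C v)) holomorphic_on ball 0 r"
    by (rule line_holomorphic_on) (simp add: cd)
  moreover have "(\<lambda>t. f (p + t *\<^sub>C (- v))) holomorphic_on ball 0 r"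
    by (rule line_holomorphic_on) (use cd[of "- t" for t] in \<open>simp add: scaleC.minus_left scaleC.minus_right\<close>)
  ultimately have "u holomorphic_on ball 0 r"
    unfolding u_def by (auto intro!: holomorphic_intros simp: scaleC.minus_left scaleC.minus_right)
  moreover have "norm (u t) \<le> 2 * M" if "norm t < r" for t
    using bd[of t] bd[of "- t"] that norm_triangle_ineq4[of "f (p + t *\<^sub>C v)" "f (p + (- t) *\<^sub>C v)"]
    by (simp add: u_def)
  moreover have "u 0 = 0"
    by (simp add: u_def)
  ultimately obtain g where "\<And>t. norm t < r \<Longrightarrow> u t = t * g t" "\<And>t. norm t < r \<Longrightarrow> norm (g t) \<le> 2 * M / r"
    using Schwarz_divide[of u r "2 * M"] \<open>r > 1\<close> by (metis less_trans zero_less_one)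
  from this[of 1] show ?thesis
    using \<open>r > 1\<close> by (simp add: u_def scaleC_minus_one)
qed

text \<open>The second difference is even in \<open>t\<close>, so its derivative at 0 vanishes along
  with its value and two factors \<open>t\<close> split off; \<open>4 * M\<close> bounds the three
  terms with their weights.\<close>

lemma norm_second_difference_le:
  fixes f :: "'a::complex_normed_space \<Rightarrow> complex"
  assumes "r > 1" and cd: "\<And>t. norm t < r \<Longrightarrow> cdifferentiable f (p + t *\<^sub>C v)"
    and bd: "\<And>t. norm t < r \<Longrightarrow> norm (f (p + t *\<^sub>C v)) \<le> M"
  shows "norm (f (p + v) + f (p - v) - 2 * f p) \<le> 4 * M / r\<^sup>2"
proof -
  define u where "u = (\<lambda>t. f (p + t *\<^sub>C v) + f (p + t *\<^sub>C (- v)) - 2 * f p)"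
  have cd': "cdifferentiable f (p + t *\<^sub>C (- v))" if "norm t < r" for t
    using cd[of "- t"] that by (simp add: scaleC.minus_left scaleC.minus_right)
  have bd': "norm (f (p + t *\<^sub>C (- v))) \<le> M" if "norm t < r" for t
    using bd[of "- t"] that by (simp add: scaleC.minus_left scaleC.minus_right)
  have cd0: "cdifferentiable f p"
    using cd[of 0] \<open>r > 1\<close> by (simp add: scaleC.zero_left)
  have "(\<lambda>t. f (p + t *\<^sub>C v)) holomorphic_on ball 0 r" "(\<lambda>t. f (p + t *\<^sub>C (- v))) holomorphic_on ball 0 r"
    by (intro line_holomorphic_on; simp add: cd cd' del: scaleC.minus_right)+
  then have "u holomorphic_on ball 0 r"
    unfolding u_def by (intro holomorphic_intros)
  moreover have "u 0 = 0"
    by (simp add: u_def scaleC.zero_left)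
  moreover have "(u has_field_derivative deriv_along f v p + deriv_along f (- v) p - 0) (at 0)"
    unfolding u_def
    using line_has_field_derivative[of f p 0 v] line_has_field_derivative[of f p 0 "- v"] cd0
    by (intro DERIV_diff DERIV_add DERIV_const) (simp_all add: scaleC.zero_left)
  then have "deriv u 0 = 0"
    using deriv_along_scaleC[OF cd0, of "-1" v] by (simp add: scaleC_minus_one DERIV_imp_deriv)
  moreover have "norm (u t) \<le> 4 * M" if "norm t < r" for t
  proof -
    have "norm (u t) \<le> norm (f (p + t *\<^sub>C v)) + norm (f (p + t *\<^sub>C (- v))) + norm (2 * f p)"
      unfolding u_def by (metis (no_types, lifting) norm_triangle_ineq norm_triangle_ineq4 add_right_mono order_trans)
    then show ?thesis
      using bd[OF that] bd'[OF that] bd[of 0] \<open>r > 1\<close> by (simp add: scaleC.zero_left norm_mult)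
  qed
  ultimately have "norm (u 1) \<le> 4 * M * (norm (1::complex) / r)\<^sup>2"
    using \<open>r > 1\<close> by (intro Schwarz_second_order) auto
  then show ?thesis
    using \<open>r > 1\<close> by (simp add: u_def power_divide)
qed

subsection \<open>Germs of holomorphic maps\<close>

text \<open>Expressed through the filter \<open>nhds p\<close>, holomorphy combines with other local
  identities by \<open>eventually_elim\<close>, and no domains have to be named.\<close>

definition holomorphic_at :: "('a::complex_normed_space \<Rightarrow> 'b::complex_normed_space) \<Rightarrow> 'a \<Rightarrow> bool" where
  "holomorphic_at f p \<longleftrightarrow> (\<forall>\<^sub>F q in nhds p. cdifferentiable f q)"

lemma holomorphic_at_bounded:
  assumes "holomorphic_at f p"
  obtains r M where "r > 0" "M > 0" "\<And>q. dist p q < r \<Longrightarrow> cdifferentiable f q"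
    "\<And>q. dist p q < r \<Longrightarrow> norm (f q) \<le> M"
proof -
  have "isCont f p"
    using assms cdifferentiable_isCont eventually_nhds_x_imp_x unfolding holomorphic_at_def by metis
  then have "((\<lambda>q. norm (f q)) \<longlongrightarrow> norm (f p)) (nhds p)"
    by (metis tendsto_norm isCont_def tendsto_at_iff_tendsto_nhds)
  then have "\<forall>\<^sub>F q in nhds p. norm (f q) < norm (f p) + 1"
    by (rule order_tendstoD) simp
  with assms have "\<forall>\<^sub>F q in nhds p. cdifferentiable f q \<and> norm (f q) < norm (f p) + 1"
    unfolding holomorphic_at_def by eventually_elim simp
  then obtain r where "r > 0" "\<And>q. dist q p < r \<Longrightarrow> cdifferentiable f q \<and> norm (f q) < norm (f p) + 1"
    by (auto simp: eventually_nhds_metric)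
  then show ?thesis
    by (intro that[of r "norm (f p) + 1"]) (auto simp: dist_commute less_imp_le add_nonneg_pos)
qed

lemma deriv_along_diff:
  assumes "cdifferentiable f p" "cdifferentiable g p"
  shows "deriv_along (\<lambda>x. f x - g x) v p = deriv_along f v p - deriv_along g v p"
  by (rule deriv_along_eq[OF has_derivative_diff[OF assms[THEN cdifferentiable_has_derivative]]])

lemma deriv_along_add:
  assumes "cdifferentiable f p" "cdifferentiable g p"
  shows "deriv_along (\<lambda>x. f x + g x) v p = deriv_along f v p + deriv_along g v p"
  by (rule deriv_along_eq[OF has_derivative_add[OF assms[THEN cdifferentiable_has_derivative]]])

text \<open>The difference quotients in direction \<open>v\<close> converge uniformly by the second-order Schwarz
  estimate, and so do their derivatives by the Cauchy estimate.\<close>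

lemma holomorphic_at_deriv_along_scalar:
  fixes f :: "'a::complex_normed_space \<Rightarrow> complex"
  assumes "holomorphic_at f p"
  shows "cdifferentiable (deriv_along f v) p"
proof -
  obtain R M where "R > 0" "M > 0" and cd: "\<And>q. dist p q < R \<Longrightarrow> cdifferentiable f q"
    and bd: "\<And>q. dist p q < R \<Longrightarrow> norm (f q) \<le> M"
    using holomorphic_at_bounded[OF assms] by metis
  \<comment> \<open>Nested balls of radius \<open>r\<close>, \<open>2 * r\<close> and
    \<open>3 * r = R\<close>: the limit is studied on the first, the quotients \<open>T n\<close> on
    the second, and translates by \<open>t v\<close> with \<open>norm t < d\<close> stay in the
    third.\<close>
  define r where "r = R / 3"
  define d where "d = r / (norm v + 1)"
  \<comment> \<open>The offset 2 keeps \<open>e n\<close> nonzero and strictly below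
    \<open>d\<close>, also for \<open>n = 0\<close>.\<close>
  define e where "e = (\<lambda>n::nat. complex_of_real (d / real (n + 2)))"
  \<comment> \<open>This equals \<open>4 * M * norm (e n) / d^2\<close>, the quadratic Schwarz bound
    of the Taylor remainder divided by \<open>norm (e n)\<close>.\<close>
  define a where "a = (\<lambda>n::nat. 4 * M / d * (1 / real (n + 2)))"
  define T where "T = (\<lambda>n q. inverse (e n) *\<^sub>C (f (q + e n *\<^sub>C v) - f q))"
  have "r > 0" using \<open>R > 0\<close> by (simp add: r_def)
  have "norm v + 1 > 0" by (simp add: add_nonneg_pos)
  then have "d > 0" using \<open>r > 0\<close> by (simp add: d_def)
  have e: "e n \<noteq> 0" "norm (e n) = d / real (n + 2)" "norm (e n) < d" for n
    using \<open>d > 0\<close> by (simp_all add: e_def norm_divide field_simps add_pos_nonneg del: of_real_divide)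
  have a0: "a \<longlonglongrightarrow> 0"
    unfolding a_def by real_asymp
  have apos: "a n \<ge> 0" for n
    using \<open>M > 0\<close> \<open>d > 0\<close> by (simp add: a_def)
  have tv: "norm (t *\<^sub>C v) < r" if "norm t < d" for t
  proof -
    have "norm (t *\<^sub>C v) \<le> norm t * (norm v + 1)"
      by (simp add: norm_scaleC mult_left_mono)
    also have "\<dots> < d * (norm v + 1)"
      using that \<open>norm v + 1 > 0\<close> by (rule mult_strict_right_mono)
    also have "\<dots> = r"
      using \<open>norm v + 1 > 0\<close> by (simp add: d_def)
    finally show ?thesis .
  qed
  have near: "dist p (q + t *\<^sub>C v) < R" if "dist p q < 2 * r" "norm t < d" for q t
  proof -
    have "dist p (q + t *\<^sub>C v) \<le> dist p q + norm (t *\<^sub>C v)"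
      using dist_triangle[of p "q + t *\<^sub>C v" q] by (simp add: dist_norm)
    then show ?thesis using that tv[of t] by (simp add: r_def)
  qed
  have T_lim: "norm (T n q - deriv_along f v q) \<le> a n" if q: "dist p q < 2 * r" for n q
  proof -
    \<comment> \<open>The first-order Taylor remainder on the line: its value and derivative at 0
      vanish, and \<open>u (e n) / e n\<close> is the error of the difference quotient.\<close>
    define u where "u = (\<lambda>t. f (q + t *\<^sub>C v) - f q - t * deriv_along f v q)"
    have D: "norm (deriv_along f v q) \<le> 2 * M / d"
      by (rule deriv_along_bound) (use \<open>d > 0\<close> near[OF q] cd bd in auto)
    have "(\<lambda>t. f (q + t *\<^sub>C v)) holomorphic_on ball 0 d"
      by (rule line_holomorphic_on) (use near[OF q] cd in auto)
    then have "u holomorphic_on ball 0 d"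
      unfolding u_def by (intro holomorphic_intros)
    moreover have "u 0 = 0"
      by (simp add: u_def scaleC.zero_left)
    moreover have "(u has_field_derivative deriv_along f v q - 0 - 1 * deriv_along f v q) (at 0)"
      unfolding u_def using line_has_field_derivative[of f q 0 v] near[OF q, of 0] cd \<open>d > 0\<close>
      by (intro DERIV_diff DERIV_cmult_right DERIV_const DERIV_ident) (simp_all add: scaleC.zero_left)
    then have "deriv u 0 = 0"
      by (simp add: DERIV_imp_deriv)
    moreover have "norm (u t) \<le> 4 * M" if "norm t < d" for t
    proof -
      have "norm (u t) \<le> norm (f (q + t *\<^sub>C v)) + norm (f q) + norm t * norm (deriv_along f v q)"
        unfolding u_def norm_mult[symmetric]
        by (metis (no_types, lifting) norm_triangle_ineq4 add_right_mono order_trans)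
      moreover have "norm t * norm (deriv_along f v q) \<le> d * (2 * M / d)"
        using that D \<open>d > 0\<close> by (intro mult_mono) auto
      moreover have "norm (f q) \<le> M" "norm (f (q + t *\<^sub>C v)) \<le> M"
        using near[OF q, of t] near[OF q, of 0] that bd \<open>d > 0\<close> by (simp_all add: scaleC.zero_left)
      ultimately show ?thesis
        using \<open>d > 0\<close> by simp
    qed
    ultimately have "norm (u (e n)) \<le> 4 * M * (norm (e n) / d)\<^sup>2"
      using \<open>d > 0\<close> e(3) by (intro Schwarz_second_order) auto
    moreover have "T n q - deriv_along f v q = inverse (e n) * u (e n)"
      using e(1)[of n] by (simp add: T_def u_def scaleC_complex_def algebra_simps)
    ultimately have "norm (T n q - deriv_along f v q) \<le> inverse (norm (e n)) * (4 * M * (norm (e n) / d)\<^sup>2)"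
      by (simp add: norm_mult norm_inverse mult_left_mono)
    also have "\<dots> = 4 * M * norm (e n) / d\<^sup>2"
      using e(1)[of n] by (simp add: power2_eq_square field_simps)
    also have "\<dots> = a n"
      using \<open>d > 0\<close> unfolding e(2) by (simp add: a_def power2_eq_square)
    finally show ?thesis .
  qed
  have T_cd: "cdifferentiable (T n) q" if q: "dist p q < 2 * r" for n q
    unfolding T_def using near[OF q e(3)[of n]] near[OF q, of 0] \<open>d > 0\<close> cd
    by (intro cdifferentiable_scaleC cdifferentiable_diff
        cdifferentiable_compose[where f = f and g = "\<lambda>q. q + e n *\<^sub>C v"] cdifferentiable_add
        cdifferentiable_id cdifferentiable_const) (auto simp: scaleC.zero_left)
  \<comment> \<open>\<open>T n - T m\<close> is at most \<open>a n + a m\<close> on the larger ball,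
    so Cauchy's inequality bounds its derivative on the smaller one.\<close>
  have T_Cauchy: "norm (deriv_along (T n) w q - deriv_along (T m) w q) \<le> 2 / r * (a n + a m) * norm w"
    if q: "dist p q < r" for n m w q
  proof (cases "w = 0")
    case True
    then show ?thesis
      using deriv_along_scaleC[of "T n" q 0 w] deriv_along_scaleC[of "T m" q 0 w] T_cd[of q] q \<open>r > 0\<close>
      by (simp add: scaleC.zero_left)
  next
    case False
    have near': "dist p (q + t *\<^sub>C w) < 2 * r" if "norm t < r / norm w" for t
    proof -
      have "norm (t *\<^sub>C w) < r" using that False by (simp add: norm_scaleC field_simps)
      then show ?thesis
        using q dist_triangle[of p "q + t *\<^sub>C w" q] by (simp add: dist_norm)
    qed
    have "norm (deriv_along (\<lambda>q. T n q - T m q) w q) \<le> 2 * (a n + a m) / (r / norm w)"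
    proof (rule deriv_along_bound)
      fix t :: complex assume t: "norm t < r / norm w"
      show "cdifferentiable (\<lambda>q. T n q - T m q) (q + t *\<^sub>C w)"
        by (intro cdifferentiable_diff T_cd near' t)
      show "norm (T n (q + t *\<^sub>C w) - T m (q + t *\<^sub>C w)) \<le> a n + a m"
        using T_lim[OF near'[OF t], of n] T_lim[OF near'[OF t], of m]
        by norm
    qed (use False \<open>r > 0\<close> in simp)
    then show ?thesis
      using T_cd[of q] q \<open>r > 0\<close> by (simp add: deriv_along_diff field_simps)
  qed
  have "\<exists>L. (\<lambda>n. deriv_along (T n) w q) \<longlonglongrightarrow> L" if q: "dist p q < r" for w q
  proof -
    \<comment> \<open>Scaled so that the bound of \<open>T_Cauchy\<close> is the average of
      \<open>b n\<close> and \<open>b m\<close>.\<close>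
    define b where "b = (\<lambda>n. 4 / r * norm w * a n)"
    have "b \<longlonglongrightarrow> 4 / r * norm w * 0"
      unfolding b_def by (intro tendsto_intros a0)
    then have small: "\<forall>\<^sub>F n in sequentially. b n < \<epsilon>" if "\<epsilon> > 0" for \<epsilon>
      using order_tendstoD(2) that by fastforce
    have "2 / r * (a n + a m) * norm w = (b n + b m) / 2" for n m
      by (simp add: b_def algebra_simps add_divide_distrib)
    then have Cauchy_b: "norm (deriv_along (T n) w q - deriv_along (T m) w q) \<le> (b n + b m) / 2" for n m
      using T_Cauchy[OF q, of n w m] by (simp only:)
    have "Cauchy (\<lambda>n. deriv_along (T n) w q)"
    proof (rule CauchyI)
      fix \<epsilon> :: real assume "\<epsilon> > 0"
      from small[OF this] obtain N where N: "\<And>n. n \<ge> N \<Longrightarrow> b n < \<epsilon>"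
        unfolding eventually_sequentially by blast
      show "\<exists>N. \<forall>m\<ge>N. \<forall>n\<ge>N. norm (deriv_along (T m) w q - deriv_along (T n) w q) < \<epsilon>"
      proof (intro exI[of _ N] allI impI)
        fix m n assume "m \<ge> N" "n \<ge> N"
        then show "norm (deriv_along (T m) w q - deriv_along (T n) w q) < \<epsilon>"
          using Cauchy_b[of m n] N[of m] N[of n] by simp
      qed
    qed
    then show ?thesis
      by (simp add: Cauchy_convergent_iff convergent_def)
  qed
  then obtain L where L: "\<And>q w. dist p q < r \<Longrightarrow> (\<lambda>n. deriv_along (T n) w q) \<longlonglongrightarrow> L q w"
    by metis
  have T_L: "norm (deriv_along (T n) w q - L q w) \<le> 2 / r * a n * norm w" if q: "dist p q < r" for n w q
  proof (rule tendsto_le)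
    show "(\<lambda>m. 2 / r * (a n + a m) * norm w) \<longlonglongrightarrow> 2 / r * a n * norm w"
      by (rule tendsto_eq_intros a0 refl | simp)+
    show "(\<lambda>m. norm (deriv_along (T n) w q - deriv_along (T m) w q)) \<longlonglongrightarrow> norm (deriv_along (T n) w q - L q w)"
      by (intro tendsto_intros L q)
  qed (use T_Cauchy[OF q] in auto)
  \<comment> \<open>Uniform convergence of the derivatives, with convergence of \<open>T n\<close>
    at \<open>p\<close>, makes the limit differentiable; the limit turns out to be
    \<open>deriv_along f v\<close>.\<close>
  have "\<exists>g. \<forall>q\<in>ball p r. (\<lambda>n. T n q) \<longlonglongrightarrow> g q \<and> (g has_derivative L q) (at q within ball p r)"
  proof (rule has_derivative_sequence)
    show "(T n has_derivative (\<lambda>w. deriv_along (T n) w q)) (at q within ball p r)" if "q \<in> ball p r" for n q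
      using cdifferentiable_has_derivative[OF T_cd[of q n]] that \<open>r > 0\<close>
      by (auto intro: has_derivative_at_withinI)
    show "\<forall>\<^sub>F n in sequentially. \<forall>q\<in>ball p r. \<forall>w. norm (deriv_along (T n) w q - L q w) \<le> \<epsilon> * norm w"
      if "\<epsilon> > 0" for \<epsilon>
    proof -
      have "(\<lambda>n. 2 / r * a n) \<longlonglongrightarrow> 2 / r * 0"
        by (intro tendsto_intros a0)
      then have "\<forall>\<^sub>F n in sequentially. 2 / r * a n < \<epsilon>"
        using order_tendstoD(2) that by fastforce
      then show ?thesis
      proof eventually_elim
        case (elim n)
        show ?case
        proof (intro ballI allI)
          fix q w assume "q \<in> ball p r"
          then have "norm (deriv_along (T n) w q - L q w) \<le> 2 / r * a n * norm w"
            by (intro T_L) simp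
          also have "\<dots> \<le> \<epsilon> * norm w"
            using elim by (intro mult_right_mono) auto
          finally show "norm (deriv_along (T n) w q - L q w) \<le> \<epsilon> * norm w" .
        qed
      qed
    qed
    show "(\<lambda>n. T n p) \<longlonglongrightarrow> deriv_along f v p"
      using T_lim[of p] \<open>r > 0\<close>
      by (intro LIM_zero_cancel[OF Lim_null_comparison[OF _ a0]]) auto
  qed (use \<open>r > 0\<close> in auto)
  then obtain g where g: "\<And>q. q \<in> ball p r \<Longrightarrow> (\<lambda>n. T n q) \<longlonglongrightarrow> g q"
    "\<And>q. q \<in> ball p r \<Longrightarrow> (g has_derivative L q) (at q within ball p r)"
    by blast
  have "g q = deriv_along f v q" if "q \<in> ball p r" for q
  proof (rule LIMSEQ_unique[OF g(1)[OF that]])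
    show "(\<lambda>n. T n q) \<longlonglongrightarrow> deriv_along f v q"
      using T_lim[of q] \<open>r > 0\<close> that
      by (intro LIM_zero_cancel[OF Lim_null_comparison[OF _ a0]]) auto
  qed
  then have "(deriv_along f v has_derivative L p) (at p)"
    using has_derivative_transform_within_open[OF _ open_ball, of g "L p" p UNIV p r] g(2)[of p] \<open>r > 0\<close>
    by (simp add: at_within_open[of p "ball p r"])
  \<comment> \<open>A pointwise limit of complex linear maps is complex linear.\<close>
  moreover have "L p (c *\<^sub>C w) = c *\<^sub>C L p w" for c w
  proof (rule LIMSEQ_unique[OF L])
    show "(\<lambda>n. deriv_along (T n) (c *\<^sub>C w) p) \<longlonglongrightarrow> c *\<^sub>C L p w"
      using L[of p w] T_cd[of p] \<open>r > 0\<close>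
      by (simp add: deriv_along_scaleC scaleC.tendsto)
  qed (use \<open>r > 0\<close> in simp)
  ultimately show ?thesis
    by (rule cdifferentiableI)
qed

lemma holomorphic_at_eventually: "holomorphic_at f p \<Longrightarrow> \<forall>\<^sub>F q in nhds p. holomorphic_at f q"
  unfolding holomorphic_at_def by (simp add: eventually_eventually)

lemma holomorphic_at_nth: "holomorphic_at f p \<Longrightarrow> holomorphic_at (\<lambda>x. f x $ i) p"
  unfolding holomorphic_at_def
  by (erule eventually_mono) (rule cdifferentiable_compose[OF _ cdifferentiable_nth])

lemma holomorphic_at_cdifferentiable: "holomorphic_at f p \<Longrightarrow> cdifferentiable f p"
  unfolding holomorphic_at_def by (rule eventually_nhds_x_imp_x)

lemma holomorphic_at_deriv_along:
  fixes f :: "'a::complex_normed_space \<Rightarrow> complex^'n"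
  assumes "holomorphic_at f p"
  shows "holomorphic_at (deriv_along f v) p"
  unfolding holomorphic_at_def
  using holomorphic_at_eventually[OF assms]
proof eventually_elim
  case (elim q)
  have "\<forall>\<^sub>F x in nhds q. deriv_along (\<lambda>x. f x $ i) v x = deriv_along f v x $ i" for i
    using elim unfolding holomorphic_at_def by eventually_elim (rule deriv_along_nth)
  then have "cdifferentiable (\<lambda>x. deriv_along f v x $ i) q" for i
    by (rule cdifferentiable_cong[OF holomorphic_at_deriv_along_scalar[OF holomorphic_at_nth[OF elim]]])
  then show ?case
    by (rule cdifferentiable_vec)
qed

subsection \<open>Real points and the identity theorem\<close>

text \<open>An isometric embedding, so that radii of real and complex neighbourhoods can be compared
  without constants.\<close>

definition complexify :: "real \<times> (real^'d) \<Rightarrow> complex \<times> (complex^'d)" where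
  "complexify r = (complex_of_real (fst r), vec_of_real (snd r))"

lemma vec_of_real_nth [simp]: "vec_of_real x $ i = of_real (x $ i)"
  and vec_Re_nth [simp]: "vec_Re z $ i = Re (z $ i)"
  by (simp_all add: vec_of_real_def vec_Re_def)

lemma complexify_Pair [simp]: "complexify (h, x) = (of_real h, vec_of_real x)"
  by (simp add: complexify_def)

lemma norm_vec_of_real [simp]: "norm (vec_of_real x) = norm x"
  by (simp add: norm_vec_def)

lemma bounded_linear_vec_of_real: "bounded_linear vec_of_real"
  by (rule bounded_linear_intro[where K = 1]) (simp_all add: vec_eq_iff complex_eq_iff)

lemma norm_vec_Re_le: "norm (vec_Re z) \<le> norm z"
  unfolding norm_vec_def by (rule L2_set_mono) (auto simp: abs_Re_le_cmod)

lemma bounded_linear_vec_Re: "bounded_linear vec_Re"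
  by (rule bounded_linear_intro[where K = 1]) (simp_all add: vec_eq_iff norm_vec_Re_le)

lemma vec_Re_vec_of_real [simp]: "vec_Re (vec_of_real x) = x"
  by (simp add: vec_eq_iff)

lemma bounded_linear_complexify: "bounded_linear complexify"
  unfolding complexify_def
  by (intro bounded_linear_Pair bounded_linear_compose[OF bounded_linear_of_real bounded_linear_fst]
      bounded_linear_compose[OF bounded_linear_vec_of_real bounded_linear_snd])

lemma norm_complexify [simp]: "norm (complexify r) = norm r"
  by (simp add: complexify_def norm_prod_def)

lemma dist_complexify [simp]: "dist (complexify r) (complexify s) = dist r s"
  using linear_diff[OF bounded_linear.linear[OF bounded_linear_complexify], of r s]
  by (metis dist_norm norm_complexify)

text \<open>A property of germs at \<open>f p\<close> is pulled back to \<open>p\<close>.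
  Composition, restriction to real points and the reflection of \<open>h\<close> to
  \<open>- h\<close> all use this rule.\<close>

lemma eventually_isCont:
  assumes "\<forall>\<^sub>F q in nhds (f p). P q" and "isCont f p"
  shows "\<forall>\<^sub>F x in nhds p. P (f x)"
  using assms unfolding isCont_def tendsto_at_iff_tendsto_nhds
  by (rule eventually_compose_filterlim)

lemmas eventually_complexify =
  eventually_isCont[OF _ linear_continuous_at[OF bounded_linear_complexify]]

text \<open>Through a complex point \<open>a + \<i> b\<close> runs the complex line \<open>t \<mapsto> a + t b\<close>, which is real for
  real \<open>t\<close>; so the identity theorem in one variable suffices.\<close>

lemma holomorphic_identity_scalar:
  fixes f :: "complex \<times> (complex^'d) \<Rightarrow> complex"
  assumes "holomorphic_at f (complexify r)" and "\<forall>\<^sub>F s in nhds r. f (complexify s) = 0"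
  shows "\<forall>\<^sub>F q in nhds (complexify r). f q = 0"
proof -
  obtain R where "R > 0" and R: "\<And>q. dist q (complexify r) < R \<Longrightarrow> cdifferentiable f q"
    using assms(1) unfolding holomorphic_at_def eventually_nhds_metric by blast
  obtain \<delta> where "\<delta> > 0" and \<delta>: "\<And>s. dist s r < \<delta> \<Longrightarrow> f (complexify s) = 0"
    using assms(2) unfolding eventually_nhds_metric by blast
  have "f q = 0" if q: "dist q (complexify r) < min R \<delta>" for q
  proof -
    \<comment> \<open>Real and imaginary parts of \<open>q\<close>: the line through
      \<open>a\<close> with direction \<open>b\<close> meets \<open>q\<close> at
      \<open>t = \<i>\<close>, and \<open>a\<close> is no farther from the centre than
      \<open>q\<close>.\<close>
    define a :: "real \<times> (real^'d)" where "a = (Re (fst q), vec_Re (snd q))"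
    define b :: "real \<times> (real^'d)" where "b = (Im (fst q), \<chi> i. Im (snd q $ i))"
    \<comment> \<open>The parameters for which the line is inside the ball. This set is open and
      convex, hence connected, and contains 0 and \<open>\<i>\<close>, so vanishing at its real
      points propagates to \<open>q\<close>.\<close>
    define T where "T = {t. complexify a + t *\<^sub>C complexify b \<in> ball (complexify r) (min R \<delta>)}"
    have lin: "complexify a + of_real t *\<^sub>C complexify b = complexify (a + t *\<^sub>R b)" for t
      by (simp add: bounded_linear.linear[OF bounded_linear_complexify] linear_add linear_scale)
    have "complexify a + \<i> *\<^sub>C complexify b = q"
      by (cases q) (simp add: a_def b_def complexify_def vec_eq_iff scaleC_complex_def complex_eq_iff)
    moreover have "dist r a \<le> dist q (complexify r)"
    proof -
      have "a - r = (Re (fst (q - complexify r)), vec_Re (snd (q - complexify r)))"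
        by (simp add: a_def complexify_def prod_eq_iff vec_eq_iff)
      then have "norm (a - r) \<le> norm (q - complexify r)"
        by (simp only: norm_Pair norm_prod_def[of "q - complexify r"])
          (intro real_sqrt_le_mono add_mono power_mono, auto simp: abs_Re_le_cmod norm_vec_Re_le
            simp del: fst_diff snd_diff)
      then show ?thesis by (simp add: dist_norm norm_minus_commute)
    qed
    then have "complexify a \<in> ball (complexify r) (min R \<delta>)"
      using q by simp
    ultimately have T: "0 \<in> T" "\<i> \<in> T"
      using q by (simp_all add: T_def scaleC.zero_left dist_commute)
    have "open T"
    proof -
      have "T = (\<lambda>t. complexify a + t *\<^sub>C complexify b) -` ball (complexify r) (min R \<delta>)"
        by (auto simp: T_def)
      then show ?thesis
        by (simp only:) (intro open_vimage open_ball continuous_intros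
            linear_continuous_on scaleC.bounded_linear_left)
    qed
    have "convex T"
    proof -
      have "T = (\<lambda>t. t *\<^sub>C complexify b) -` ball (complexify r - complexify a) (min R \<delta>)"
        by (auto simp: T_def dist_norm algebra_simps)
      then show ?thesis
        by (simp only:) (intro convex_linear_vimage convex_ball
            bounded_linear.linear scaleC.bounded_linear_left)
    qed
    have "f (complexify a + \<i> *\<^sub>C complexify b) = 0"
    proof (rule analytic_continuation[where f = "\<lambda>t. f (complexify a + t *\<^sub>C complexify b)"
            and S = T and U = "complex_of_real ` {t. complex_of_real t \<in> T}" and \<xi> = 0 and w = \<i>])
      show "(\<lambda>t. f (complexify a + t *\<^sub>C complexify b)) holomorphic_on T"
        by (rule line_holomorphic_on) (auto simp: T_def dist_commute intro!: R)
      show "0 islimpt complex_of_real ` {t. complex_of_real t \<in> T}"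
        unfolding islimpt_approachable
      proof (intro allI impI)
        fix e :: real assume "e > 0"
        obtain d where "d > 0" "ball 0 d \<subseteq> T"
          using \<open>open T\<close> T(1) open_contains_ball by blast
        then have "complex_of_real (min e d / 2) \<in> T"
          using \<open>e > 0\<close> by (intro subsetD[of "ball 0 d" T]) (auto simp: norm_of_real simp del: of_real_divide)
        then show "\<exists>x'\<in>complex_of_real ` {t. complex_of_real t \<in> T}. x' \<noteq> 0 \<and> dist x' 0 < e"
          using \<open>e > 0\<close> \<open>d > 0\<close>
          by (intro bexI[of _ "complex_of_real (min e d / 2)"])
            (auto simp: norm_of_real simp del: of_real_divide intro: imageI)
      qed
      show "f (complexify a + t *\<^sub>C complexify b) = 0" if "t \<in> complex_of_real ` {t. complex_of_real t \<in> T}" for t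
      proof -
        from that obtain u where "t = complex_of_real u" "complex_of_real u \<in> T" by auto
        then show ?thesis
          using \<delta>[of "a + u *\<^sub>R b"] by (simp add: T_def lin dist_commute del: scaleC_of_real)
      qed
    qed (use T \<open>open T\<close> \<open>convex T\<close> convex_connected in auto)
    then show ?thesis
      using \<open>complexify a + \<i> *\<^sub>C complexify b = q\<close> by simp
  qed
  then show ?thesis
    unfolding eventually_nhds_metric using \<open>R > 0\<close> \<open>\<delta> > 0\<close> by (intro exI[of _ "min R \<delta>"]) auto
qed

lemma holomorphic_identity:
  fixes f :: "complex \<times> (complex^'d) \<Rightarrow> complex^'n"
  assumes "holomorphic_at f (complexify r)" and "\<forall>\<^sub>F s in nhds r. f (complexify s) = 0"
  shows "\<forall>\<^sub>F q in nhds (complexify r). f q = 0"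
proof -
  have "\<forall>\<^sub>F q in nhds (complexify r). f q $ i = 0" for i
  proof (rule holomorphic_identity_scalar[OF holomorphic_at_nth[OF assms(1)]])
    show "\<forall>\<^sub>F s in nhds r. f (complexify s) $ i = 0"
      using assms(2) by eventually_elim simp
  qed
  then have "\<forall>\<^sub>F q in nhds (complexify r). \<forall>i. f q $ i = 0"
    by (rule eventually_all_finite)
  then show ?thesis by (simp add: vec_eq_iff)
qed

text \<open>Induction on \<open>m\<close>: the derivative in \<open>h\<close> has order \<open>m - 1\<close> at real states, and the value at
  \<open>h = 0\<close> vanishes at complex states by the identity theorem.\<close>

lemma holomorphic_order_scalar:
  fixes f :: "complex \<times> (complex^'d) \<Rightarrow> complex"
  assumes "holomorphic_at f (complexify (0, x))"
    and "\<forall>\<^sub>F r in nhds (0, x). fst r \<noteq> 0 \<longrightarrow> norm (f (complexify r)) \<le> C * \<bar>fst r\<bar> ^ m"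
  shows "\<exists>C'. \<forall>\<^sub>F q in nhds (complexify (0, x)). norm (f q) \<le> C' * norm (fst q) ^ m"
  using assms
proof (induction m arbitrary: f C)
  case 0
  obtain r M where "r > 0" "\<And>q. dist (complexify (0, x)) q < r \<Longrightarrow> norm (f q) \<le> M"
    using holomorphic_at_bounded[OF 0(1)] by metis
  then show ?case
    by (intro exI[of _ M]) (auto simp: eventually_nhds_metric dist_commute)
next
  case (Suc m)
  let ?p = "complexify (0, x)"
  let ?e = "(1, 0) :: complex \<times> (complex^'d)"
  obtain R M where "R > 0" "M > 0" and cd: "\<And>q. dist ?p q < R \<Longrightarrow> cdifferentiable f q"
    and bd: "\<And>q. dist ?p q < R \<Longrightarrow> norm (f q) \<le> M"
    using holomorphic_at_bounded[OF Suc.prems(1)] by metis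
  obtain \<delta> where "\<delta> > 0" and \<delta>: "\<And>r. dist r (0, x) < \<delta> \<Longrightarrow> fst r \<noteq> 0
      \<Longrightarrow> norm (f (complexify r)) \<le> C * \<bar>fst r\<bar> ^ Suc m"
    using Suc.prems(2) unfolding eventually_nhds_metric by blast
  define \<rho> where "\<rho> = min R \<delta> / 2"
  have "\<rho> > 0" using \<open>R > 0\<close> \<open>\<delta> > 0\<close> by (simp add: \<rho>_def)
  have distp: "dist ?p (h, z) \<le> norm h + dist (vec_of_real x) z" for h z
    using sqrt_sum_squares_le_sum[of "norm h" "dist (vec_of_real x) z"] by (simp add: dist_Pair_Pair)
  \<comment> \<open>For a fixed real state, the one-variable Schwarz estimate passes from real to
    complex \<open>h\<close>. The constant involves only \<open>M\<close> and \<open>\<rho>\<close>,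
    hence is uniform in \<open>y\<close>.\<close>
  have bound: "norm (f (h, vec_of_real y)) \<le> M * (norm h / \<rho>) ^ Suc m"
    if y: "dist y x < \<rho>" and h: "norm h < \<rho>" for h y
  proof -
    let ?F = "\<lambda>t. f ((0, vec_of_real y) + t *\<^sub>C ?e)"
    have pt: "(0, vec_of_real y) + t *\<^sub>C ?e = (t, vec_of_real y)" for t
      by (simp add: scaleC_complex_def scaleC.zero_right)
    have vx: "dist (vec_of_real x) (vec_of_real y) = dist y x"
      using dist_complexify[of "(0, x)" "(0, y)"] by (simp add: dist_Pair_Pair dist_commute)
    have near: "dist ?p (t, vec_of_real y) < R" if "norm t < \<rho>" for t
      using distp[of t "vec_of_real y"] y that by (simp add: \<rho>_def vx)
    have "norm (?F h) \<le> M * (norm h / \<rho>) ^ Suc m"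
    proof (rule Schwarz_order)
      show "?F holomorphic_on ball 0 \<rho>"
        by (rule line_holomorphic_on) (simp only: pt, use near cd in auto)
      show "norm (?F t) \<le> M" if "norm t < \<rho>" for t
        unfolding pt using near bd that by blast
      show "\<forall>\<^sub>F t::real in at 0. norm (?F (of_real t)) \<le> C * \<bar>t\<bar> ^ Suc m"
        unfolding pt eventually_at
      proof (intro exI[of _ \<rho>] conjI ballI impI)
        fix t :: real assume t: "t \<noteq> 0 \<and> dist t 0 < \<rho>"
        have "dist (t, y) (0, x) \<le> \<bar>t\<bar> + dist y x"
          using sqrt_sum_squares_le_sum[of "\<bar>t\<bar>" "dist y x"] by (simp add: dist_Pair_Pair)
        then have "dist (t, y) (0, x) < \<delta>"
          using t y by (simp add: \<rho>_def)
        from \<delta>[OF this] t show "norm (f (complex_of_real t, vec_of_real y)) \<le> C * \<bar>t\<bar> ^ Suc m"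
          by simp
      qed fact
    qed (use h \<open>\<rho> > 0\<close> in auto)
    then show ?thesis unfolding pt .
  qed
  \<comment> \<open>Half of \<open>\<rho>\<close> leaves room for the Cauchy disc of radius
    \<open>\<bar>h\<bar>\<close> about \<open>h\<close>, which reaches up to
    \<open>2 * \<bar>h\<bar>\<close>.\<close>
  have box: "\<forall>\<^sub>F r in nhds (0, x). \<bar>fst r\<bar> < \<rho> / 2 \<and> dist (snd r) x < \<rho>"
    unfolding eventually_nhds_metric
  proof (intro exI[of _ "\<rho> / 2"] conjI allI impI)
    fix r :: "real \<times> (real^'d)" assume r: "dist r (0, x) < \<rho> / 2"
    show "\<bar>fst r\<bar> < \<rho> / 2" "dist (snd r) x < \<rho>"
      using r dist_fst_le[of r "(0, x)"] dist_snd_le[of r "(0, x)"] \<open>\<rho> > 0\<close> by auto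
  qed (use \<open>\<rho> > 0\<close> in simp)
  \<comment> \<open>At real states this is \<open>bound\<close> with \<open>h = 0\<close>, where the
    exponent \<open>Suc m\<close> makes the right side vanish.\<close>
  have "\<forall>\<^sub>F q in nhds ?p. f (0, snd q) = 0"
  proof (rule holomorphic_identity_scalar)
    have "isCont (\<lambda>q :: complex \<times> (complex^'d). (0 :: complex, snd q)) ?p"
      by (intro continuous_intros)
    then have "\<forall>\<^sub>F q in nhds ?p. cdifferentiable f (0, snd q)"
      by (rule eventually_isCont[rotated]) (use Suc.prems(1) in \<open>simp add: holomorphic_at_def\<close>)
    then show "holomorphic_at (\<lambda>q. f (0, snd q)) ?p"
      unfolding holomorphic_at_def
      by eventually_elim (rule cdifferentiable_compose[OF cdifferentiable_Pair[OF
              cdifferentiable_const cdifferentiable_snd]])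
    show "\<forall>\<^sub>F r in nhds (0, x). f (0, snd (complexify r)) = 0"
      using box by eventually_elim (use bound[of _ 0] \<open>\<rho> > 0\<close> in \<open>auto simp: complexify_def\<close>)
  qed
  moreover have "\<exists>C'. \<forall>\<^sub>F q in nhds ?p. norm (deriv_along f ?e q) \<le> C' * norm (fst q) ^ m"
  proof (rule Suc.IH)
    show "holomorphic_at (deriv_along f ?e) ?p"
      unfolding holomorphic_at_def using holomorphic_at_eventually[OF Suc.prems(1)]
      by eventually_elim (rule holomorphic_at_deriv_along_scalar)
    show "\<forall>\<^sub>F r in nhds (0, x). fst r \<noteq> 0
      \<longrightarrow> norm (deriv_along f ?e (complexify r)) \<le> 2 * M * (2 / \<rho>) ^ Suc m * \<bar>fst r\<bar> ^ m"
      using box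
    proof (eventually_elim, intro impI)
      fix r :: "real \<times> (real^'d)"
      assume elim: "\<bar>fst r\<bar> < \<rho> / 2 \<and> dist (snd r) x < \<rho>" "fst r \<noteq> 0"
      obtain h y where r: "r = (h, y)" by fastforce
      have pt: "complexify r + t *\<^sub>C ?e = (of_real h + t, vec_of_real y)" for t
        by (simp add: r scaleC_complex_def scaleC.zero_right)
      \<comment> \<open>On the disc of radius \<open>\<bar>h\<bar>\<close> about \<open>h\<close>
        the function is of size \<open>\<bar>h\<bar> ^ Suc m\<close>; dividing by the radius costs
        exactly one power.\<close>
      have "norm (deriv_along f ?e (complexify r)) \<le> 2 * (M * (2 * \<bar>h\<bar> / \<rho>) ^ Suc m) / \<bar>h\<bar>"
      proof (rule deriv_along_bound)
        fix t :: complex assume t: "norm t < \<bar>h\<bar>"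
        have ht: "norm (of_real h + t) \<le> 2 * \<bar>h\<bar>" "norm (of_real h + t) < \<rho>"
          using norm_triangle_ineq[of "of_real h" t] t elim r by auto
        have "dist (vec_of_real x) (vec_of_real y) = dist y x"
          using dist_complexify[of "(0, x)" "(0, y)"] by (simp add: dist_Pair_Pair dist_commute)
        then have "dist ?p (of_real h + t, vec_of_real y) < R"
          using distp[of "of_real h + t" "vec_of_real y"] ht elim r by (simp add: \<rho>_def)
        then show "cdifferentiable f (complexify r + t *\<^sub>C ?e)"
          unfolding pt by (rule cd)
        have "norm (f (of_real h + t, vec_of_real y)) \<le> M * (norm (of_real h + t) / \<rho>) ^ Suc m"
          using elim r ht by (intro bound) auto
        also have "\<dots> \<le> M * (2 * \<bar>h\<bar> / \<rho>) ^ Suc m"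
          using ht \<open>M > 0\<close> \<open>\<rho> > 0\<close> by (intro mult_left_mono power_mono divide_right_mono) auto
        finally show "norm (f (complexify r + t *\<^sub>C ?e)) \<le> M * (2 * \<bar>h\<bar> / \<rho>) ^ Suc m"
          unfolding pt .
      qed (use elim r in auto)
      also have "\<dots> = 2 * M * (2 / \<rho>) ^ Suc m * \<bar>h\<bar> ^ m"
        using elim r by (simp add: power_divide power_mult_distrib)
      finally show "norm (deriv_along f ?e (complexify r)) \<le> 2 * M * (2 / \<rho>) ^ Suc m * \<bar>fst r\<bar> ^ m"
        by (simp add: r)
    qed
  qed
  then obtain C' where "\<forall>\<^sub>F q in nhds ?p. norm (deriv_along f ?e q) \<le> C' * norm (fst q) ^ m"
    by blast
  ultimately have "\<forall>\<^sub>F q in nhds ?p. f (0, snd q) = 0 \<and> norm (deriv_along f ?e q) \<le> C' * norm (fst q) ^ m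
      \<and> cdifferentiable f q"
    using Suc.prems(1) unfolding holomorphic_at_def by eventually_elim simp
  then obtain \<rho>' where "\<rho>' > 0" and \<rho>': "\<And>q. dist q ?p < \<rho>' \<Longrightarrow> f (0, snd q) = 0
      \<and> norm (deriv_along f ?e q) \<le> C' * norm (fst q) ^ m \<and> cdifferentiable f q"
    unfolding eventually_nhds_metric by blast
  have "norm (f q) \<le> \<bar>C'\<bar> * norm (fst q) ^ Suc m" if q: "dist q ?p < \<rho>'" for q
  proof -
    obtain h z where hz: "q = (h, z)" by fastforce
    have pt: "(0, z) + t *\<^sub>C ?e = (t, z)" for t
      by (simp add: scaleC_complex_def scaleC.zero_right)
    have near: "dist (t, z) ?p < \<rho>'" if "norm t \<le> norm h" for t
    proof -
      have "dist (t, z) ?p \<le> dist q ?p"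
        unfolding hz using that by (simp add: dist_Pair_Pair power_mono)
      then show ?thesis using q by simp
    qed
    \<comment> \<open>The mean value inequality in the step size, from 0 to \<open>h\<close> at a
      fixed complex state, restores the lost power, since the value at 0 vanishes.\<close>
    have "norm (f ((0, z) + h *\<^sub>C ?e) - f ((0, z) + 0 *\<^sub>C ?e)) \<le> \<bar>C'\<bar> * norm h ^ m * norm (h - 0)"
    proof (rule field_differentiable_bound[where S = "cball 0 (norm h)"
          and f = "\<lambda>t. f ((0, z) + t *\<^sub>C ?e)" and f' = "\<lambda>t. deriv_along f ?e (t, z)"])
      fix t :: complex assume "t \<in> cball 0 (norm h)"
      then have t: "norm t \<le> norm h" by simp
      then have "cdifferentiable f ((0, z) + t *\<^sub>C ?e)"
        unfolding pt using near \<rho>' by blast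
      from line_has_field_derivative[OF this]
      show "((\<lambda>t. f ((0, z) + t *\<^sub>C ?e)) has_field_derivative deriv_along f ?e (t, z))
          (at t within cball 0 (norm h))"
        unfolding pt by (rule DERIV_subset) simp
      have "norm (deriv_along f ?e (t, z)) \<le> C' * norm t ^ m"
        using near[OF t] \<rho>' by force
      also have "\<dots> \<le> \<bar>C'\<bar> * norm h ^ m"
        using t by (intro mult_mono power_mono) auto
      finally show "norm (deriv_along f ?e (t, z)) \<le> \<bar>C'\<bar> * norm h ^ m" .
    qed auto
    then show ?thesis
      using \<rho>'[OF q] unfolding pt hz by (simp add: mult_ac)
  qed
  then show ?case
    unfolding eventually_nhds_metric using \<open>\<rho>' > 0\<close> by blast
qed

lemma norm_vec_le_sum_norm: "norm (z :: 'a::real_normed_vector^'n) \<le> (\<Sum>i\<in>UNIV. norm (z $ i))"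
  unfolding norm_vec_def by (rule L2_set_le_sum) simp

text \<open>Makes a bound known at real points available where the symmetry argument needs it, at
  complex arguments. The hypothesis exempts \<open>h = 0\<close> because \<open>bigO_step\<close>
  uses a punctured neighbourhood.\<close>

lemma holomorphic_order:
  fixes f :: "complex \<times> (complex^'d) \<Rightarrow> complex^'n"
  assumes "holomorphic_at f (complexify (0, x))"
    and "\<forall>\<^sub>F r in nhds (0, x). fst r \<noteq> 0 \<longrightarrow> norm (f (complexify r)) \<le> C * \<bar>fst r\<bar> ^ m"
  obtains C' where "\<forall>\<^sub>F q in nhds (complexify (0, x)). norm (f q) \<le> C' * norm (fst q) ^ m"
proof -
  have "\<exists>C'. \<forall>\<^sub>F q in nhds (complexify (0, x)). norm (f q $ i) \<le> C' * norm (fst q) ^ m" for i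
  proof (rule holomorphic_order_scalar[OF holomorphic_at_nth[OF assms(1)]])
    show "\<forall>\<^sub>F r in nhds (0, x). fst r \<noteq> 0 \<longrightarrow> norm (f (complexify r) $ i) \<le> C * \<bar>fst r\<bar> ^ m"
      using assms(2) by eventually_elim (use order_trans[OF Finite_Cartesian_Product.norm_nth_le] in blast)
  qed
  then have "\<forall>i. \<exists>C'. \<forall>\<^sub>F q in nhds (complexify (0, x)). norm (f q $ i) \<le> C' * norm (fst q) ^ m"
    by (rule allI)
  from choice[OF this] obtain C'
    where "\<forall>i. \<forall>\<^sub>F q in nhds (complexify (0, x)). norm (f q $ i) \<le> C' i * norm (fst q) ^ m"
    by (rule exE)
  then have "\<forall>\<^sub>F q in nhds (complexify (0, x)). \<forall>i. norm (f q $ i) \<le> C' i * norm (fst q) ^ m"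
    by (intro eventually_all_finite) simp
  then have "\<forall>\<^sub>F q in nhds (complexify (0, x)). norm (f q) \<le> (\<Sum>i\<in>UNIV. C' i) * norm (fst q) ^ m"
  proof eventually_elim
    case (elim q)
    have "norm (f q) \<le> (\<Sum>i\<in>UNIV. norm (f q $ i))"
      by (rule norm_vec_le_sum_norm)
    also have "\<dots> \<le> (\<Sum>i\<in>UNIV. C' i * norm (fst q) ^ m)"
      by (rule sum_mono) (use elim in auto)
    finally show ?case by (simp add: sum_distrib_right)
  qed
  then show ?thesis by (rule that)
qed

section \<open>Difference and derivative estimates for vector-valued maps\<close>

lemma norm_vec_le_card:
  fixes z :: "'a::real_normed_vector^'n"
  assumes "\<And>i. norm (z $ i) \<le> B"
  shows "norm z \<le> real CARD('n) * B"
  using norm_vec_le_sum_norm[of z] sum_bounded_above[of UNIV "\<lambda>i. norm (z $ i)" B] assms by simp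

text \<open>Differentiability and the bound \<open>M\<close> are required on a single line through
  \<open>q\<close>. Thus \<open>M\<close> may depend on \<open>q\<close>, which later lets it carry
  a power of the step size. The radius in the parameter is \<open>r / norm v\<close>; passing from
  components to vectors costs the factor \<open>CARD('n)\<close>.\<close>

lemma
  fixes f :: "'a::complex_normed_space \<Rightarrow> complex^'n"
  assumes "r > 0" and cd: "\<And>t. norm (t *\<^sub>C v) < r \<Longrightarrow> cdifferentiable f (q + t *\<^sub>C v)"
    and bd: "\<And>t. norm (t *\<^sub>C v) < r \<Longrightarrow> norm (f (q + t *\<^sub>C v)) \<le> M"
  shows norm_difference_vec_le:
      "norm v < r \<Longrightarrow> norm (f (q + v) - f (q - v)) \<le> real CARD('n) * (2 * M / r) * norm v"
    and norm_second_difference_vec_le: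
      "norm v < r \<Longrightarrow> norm (f (q + v) + f (q - v) - 2 *\<^sub>R f q) \<le> real CARD('n) * (4 * M / r\<^sup>2) * (norm v)\<^sup>2"
    and norm_deriv_along_vec_le:
      "norm (deriv_along f v q) \<le> real CARD('n) * (2 * M / r) * norm v"
proof -
  have *: "norm (f (q + v) - f (q - v)) \<le> real CARD('n) * (2 * M / r) * norm v \<and>
    norm (f (q + v) + f (q - v) - 2 *\<^sub>R f q) \<le> real CARD('n) * (4 * M / r\<^sup>2) * (norm v)\<^sup>2"
    if v: "norm v < r" "v \<noteq> 0"
  proof
    have r: "1 < r / norm v"
      using v by (simp add: field_simps)
    have near: "norm (t *\<^sub>C v) < r" if "norm t < r / norm v" for t
      using that v by (simp add: norm_scaleC field_simps)
    have cd': "cdifferentiable (\<lambda>x. f x $ i) (q + t *\<^sub>C v)" if "norm t < r / norm v" for t i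
      by (rule cdifferentiable_compose[OF cd[OF near[OF that]] cdifferentiable_nth])
    have bd': "norm (f (q + t *\<^sub>C v) $ i) \<le> M" if "norm t < r / norm v" for t i
      using Finite_Cartesian_Product.norm_nth_le[of "f (q + t *\<^sub>C v)" i] bd[OF near[OF that]] by simp
    have "norm ((f (q + v) - f (q - v)) $ i) \<le> 2 * M / (r / norm v)" for i
      using norm_difference_le[OF r cd' bd'] by simp
    then have "norm (f (q + v) - f (q - v)) \<le> real CARD('n) * (2 * M / (r / norm v))"
      by (rule norm_vec_le_card)
    then show "norm (f (q + v) - f (q - v)) \<le> real CARD('n) * (2 * M / r) * norm v"
      by simp
    have "norm ((f (q + v) + f (q - v) - 2 *\<^sub>R f q) $ i) \<le> 4 * M / (r / norm v)\<^sup>2" for i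
      using norm_second_difference_le[OF r cd' bd'] by (simp add: scaleR_conv_of_real)
    then have "norm (f (q + v) + f (q - v) - 2 *\<^sub>R f q) \<le> real CARD('n) * (4 * M / (r / norm v)\<^sup>2)"
      by (rule norm_vec_le_card)
    then show "norm (f (q + v) + f (q - v) - 2 *\<^sub>R f q) \<le> real CARD('n) * (4 * M / r\<^sup>2) * (norm v)\<^sup>2"
      by (simp add: power_divide)
  qed
  show "norm v < r \<Longrightarrow> norm (f (q + v) - f (q - v)) \<le> real CARD('n) * (2 * M / r) * norm v"
    and "norm v < r \<Longrightarrow> norm (f (q + v) + f (q - v) - 2 *\<^sub>R f q) \<le> real CARD('n) * (4 * M / r\<^sup>2) * (norm v)\<^sup>2"
    using * by (cases "v = 0"; simp add: scaleR_2)+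
  have cd_q: "cdifferentiable f q"
    using cd[of 0] \<open>r > 0\<close> by (simp add: scaleC.zero_left)
  show "norm (deriv_along f v q) \<le> real CARD('n) * (2 * M / r) * norm v"
  proof (cases "v = 0")
    case True
    then show ?thesis
      using deriv_along_scaleC[OF cd_q, of 0 0] by (simp add: scaleC.zero_left)
  next
    case False
    have near: "norm (t *\<^sub>C v) < r" if "norm t < r / norm v" for t
      using that False by (simp add: norm_scaleC field_simps)
    have "norm (deriv_along (\<lambda>x. f x $ i) v q) \<le> 2 * M / (r / norm v)" for i
    proof (rule deriv_along_bound)
      fix t :: complex assume t: "norm t < r / norm v"
      show "cdifferentiable (\<lambda>x. f x $ i) (q + t *\<^sub>C v)"
        by (rule cdifferentiable_compose[OF cd[OF near[OF t]] cdifferentiable_nth])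
      show "norm (f (q + t *\<^sub>C v) $ i) \<le> M"
        using Finite_Cartesian_Product.norm_nth_le[of "f (q + t *\<^sub>C v)" i] bd[OF near[OF t]] by simp
    qed (use False \<open>r > 0\<close> in simp)
    then have "norm (deriv_along f v q $ i) \<le> 2 * M / (r / norm v)" for i
      by (simp add: deriv_along_nth[OF cd_q])
    then have "norm (deriv_along f v q) \<le> real CARD('n) * (2 * M / (r / norm v))"
      by (rule norm_vec_le_card)
    then show ?thesis by simp
  qed
qed

lemma dist_add_less: "dist p q < r \<Longrightarrow> norm v < r \<Longrightarrow> dist p (q + v) < 2 * r"
  for p :: "'a::real_normed_vector"
  using dist_triangle[of p "q + v" q] by (simp add: dist_norm)

text \<open>One constant for all base points near \<open>p\<close>; halving the radius keeps the
  displaced points in the region of holomorphy.\<close>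

lemma holomorphic_differences:
  fixes f :: "'a::complex_normed_space \<Rightarrow> complex^'n"
  assumes "holomorphic_at f p"
  obtains C r where "r > 0" "C \<ge> 0"
    "\<And>q v. dist p q < r \<Longrightarrow> norm v < r \<Longrightarrow> norm (f (q + v) - f (q - v)) \<le> C * norm v"
    "\<And>q v. dist p q < r \<Longrightarrow> norm v < r \<Longrightarrow> norm (f (q + v) + f (q - v) - 2 *\<^sub>R f q) \<le> C * (norm v)\<^sup>2"
proof -
  obtain R M where "R > 0" "M > 0" and cd: "\<And>q. dist p q < R \<Longrightarrow> cdifferentiable f q"
    and bd: "\<And>q. dist p q < R \<Longrightarrow> norm (f q) \<le> M"
    using holomorphic_at_bounded[OF assms] by metis
  define r where "r = R / 2"
  have "r > 0" using \<open>R > 0\<close> by (simp add: r_def)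
  have near: "dist p (q + w) < R" if "dist p q < r" "norm w < r" for q w
    using dist_add_less[OF that] by (simp add: r_def)
  define C where "C = max (real CARD('n) * (2 * M / r)) (real CARD('n) * (4 * M / r\<^sup>2))"
  show ?thesis
  proof (rule that[OF \<open>r > 0\<close>])
    show "C \<ge> 0"
      using \<open>M > 0\<close> \<open>r > 0\<close> by (simp add: C_def le_max_iff_disj)
  next
    fix q v :: 'a assume q: "dist p q < r" and v: "norm v < r"
    have "norm (f (q + v) - f (q - v)) \<le> real CARD('n) * (2 * M / r) * norm v"
      by (rule norm_difference_vec_le[OF \<open>r > 0\<close> _ _ v]) (use near[OF q] cd bd in auto)
    also have "\<dots> \<le> C * norm v"
      by (intro mult_right_mono) (simp_all add: C_def)
    finally show "norm (f (q + v) - f (q - v)) \<le> C * norm v" .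
    have "norm (f (q + v) + f (q - v) - 2 *\<^sub>R f q) \<le> real CARD('n) * (4 * M / r\<^sup>2) * (norm v)\<^sup>2"
      by (rule norm_second_difference_vec_le[OF \<open>r > 0\<close> _ _ v]) (use near[OF q] cd bd in auto)
    also have "\<dots> \<le> C * (norm v)\<^sup>2"
      by (intro mult_right_mono) (simp_all add: C_def)
    finally show "norm (f (q + v) + f (q - v) - 2 *\<^sub>R f q) \<le> C * (norm v)\<^sup>2" .
  qed
qed

text \<open>Moving in a direction \<open>(0, v)\<close> leaves \<open>fst q\<close> unchanged, so
  \<open>\<bar>C\<bar> * norm (fst q) ^ m\<close> is a constant bound along that line. Differences
  and derivatives in the state thus keep the full power of the step size.\<close>

lemma holomorphic_order_slice:
  fixes f :: "complex \<times> (complex^'d) \<Rightarrow> complex^'n"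
  assumes "holomorphic_at f p" and "\<forall>\<^sub>F q in nhds p. norm (f q) \<le> C * norm (fst q) ^ m"
  obtains C' r where "r > 0" "C' \<ge> 0"
    "\<And>q v. dist p q < r \<Longrightarrow> norm v < r
      \<Longrightarrow> norm (f (q + (0, v)) - f (q - (0, v))) \<le> C' * norm (fst q) ^ m * norm v"
    "\<And>q v. dist p q < r \<Longrightarrow> norm (deriv_along f (0, v) q) \<le> C' * norm (fst q) ^ m * norm v"
proof -
  have "\<forall>\<^sub>F q in nhds p. cdifferentiable f q \<and> norm (f q) \<le> C * norm (fst q) ^ m"
    using assms unfolding holomorphic_at_def by eventually_elim simp
  then obtain R where "R > 0"
    and R: "\<And>q. dist q p < R \<Longrightarrow> cdifferentiable f q \<and> norm (f q) \<le> C * norm (fst q) ^ m"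
    unfolding eventually_nhds_metric by blast
  define r where "r = R / 2"
  have "r > 0" using \<open>R > 0\<close> by (simp add: r_def)
  have near: "cdifferentiable f (q + t *\<^sub>C (0, v))"
      "norm (f (q + t *\<^sub>C (0, v))) \<le> \<bar>C\<bar> * norm (fst q) ^ m"
    if "dist p q < r" "norm (t *\<^sub>C (0 :: complex, v)) < r" for t q v
  proof -
    have "dist (q + t *\<^sub>C (0, v)) p < R"
      using dist_add_less[OF that] by (simp add: r_def dist_commute)
    from R[OF this] have "norm (f (q + t *\<^sub>C (0, v))) \<le> C * norm (fst q) ^ m"
      and "cdifferentiable f (q + t *\<^sub>C (0, v))"
      by (simp_all add: scaleC.zero_right)
    moreover have "C * norm (fst q) ^ m \<le> \<bar>C\<bar> * norm (fst q) ^ m"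
      by (intro mult_right_mono) auto
    ultimately show "cdifferentiable f (q + t *\<^sub>C (0, v))"
      "norm (f (q + t *\<^sub>C (0, v))) \<le> \<bar>C\<bar> * norm (fst q) ^ m"
      by linarith+
  qed
  define C' where "C' = real CARD('n) * (2 * \<bar>C\<bar> / r)"
  have bound: "real CARD('n) * (2 * (\<bar>C\<bar> * norm (fst q) ^ m) / r) * norm (0 :: complex, v) = C' * norm (fst q) ^ m * norm v"
    for q :: "complex \<times> (complex^'d)" and v :: "complex^'d"
    by (simp add: C'_def)
  show ?thesis
  proof (rule that[OF \<open>r > 0\<close>])
    show "C' \<ge> 0"
      using \<open>r > 0\<close> by (simp add: C'_def)
  next
    fix q :: "complex \<times> (complex^'d)" and v :: "complex^'d"
    assume q: "dist p q < r"
    show "norm (deriv_along f (0, v) q) \<le> C' * norm (fst q) ^ m * norm v"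
      unfolding bound[symmetric] by (rule norm_deriv_along_vec_le[OF \<open>r > 0\<close> near(1)[OF q] near(2)[OF q]])
    assume "norm v < r"
    then show "norm (f (q + (0, v)) - f (q - (0, v))) \<le> C' * norm (fst q) ^ m * norm v"
      using norm_difference_vec_le[OF \<open>r > 0\<close> near(1)[OF q, where v = v] near(2)[OF q, where v = v]]
      unfolding bound by (simp add: norm_Pair)
  qed
qed

subsection \<open>Smoothness and derivatives of real restrictions\<close>

lemma holomorphic_at_isCont: "holomorphic_at f p \<Longrightarrow> isCont f p"
  by (simp add: cdifferentiable_isCont holomorphic_at_cdifferentiable)

lemma holomorphic_at_compose:
  assumes "holomorphic_at g p" and "holomorphic_at f (g p)"
  shows "holomorphic_at (\<lambda>x. f (g x)) p"
proof -
  have "\<forall>\<^sub>F x in nhds p. cdifferentiable f (g x)"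
    using assms(2) unfolding holomorphic_at_def
    by (rule eventually_isCont) (rule holomorphic_at_isCont[OF assms(1)])
  with assms(1) show ?thesis
    unfolding holomorphic_at_def by eventually_elim (rule cdifferentiable_compose)
qed

lemma holomorphic_at_fst: "holomorphic_at fst p"
  and holomorphic_at_snd: "holomorphic_at snd p"
  by (simp_all add: holomorphic_at_def cdifferentiable_fst cdifferentiable_snd)

lemma holomorphic_at_add:
  assumes "holomorphic_at f p" and "holomorphic_at g p"
  shows "holomorphic_at (\<lambda>x. f x + g x) p"
  using assms unfolding holomorphic_at_def by eventually_elim (rule cdifferentiable_add)

lemma holomorphic_at_diff:
  assumes "holomorphic_at f p" and "holomorphic_at g p"
  shows "holomorphic_at (\<lambda>x. f x - g x) p"
  using assms unfolding holomorphic_at_def by eventually_elim (rule cdifferentiable_diff)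

lemma holomorphic_at_scaleC: "holomorphic_at f p \<Longrightarrow> holomorphic_at (\<lambda>x. c *\<^sub>C f x) p"
  unfolding holomorphic_at_def by (erule eventually_mono) (rule cdifferentiable_scaleC)

lemma holomorphic_at_Pair:
  assumes "holomorphic_at f p" and "holomorphic_at g p"
  shows "holomorphic_at (\<lambda>x. (f x, g x)) p"
  using assms unfolding holomorphic_at_def by eventually_elim (rule cdifferentiable_Pair)

lemma Ck_on_cong:
  assumes "open U" and "Ck_on k f U" and "\<And>x. x \<in> U \<Longrightarrow> f x = g x"
  shows "Ck_on k g U"
  using assms(2,3)
proof (induction k arbitrary: f g)
  case 0
  then show ?case using continuous_on_cong[of U U f g] by simp
next
  case (Suc k)
  have diff: "f differentiable at x" if "x \<in> U" for x
    using Suc.prems(1) that \<open>open U\<close> by (simp add: differentiable_on_eq_differentiable_at)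
  have "g differentiable at x" if "x \<in> U" for x
    using diff[OF that] Suc.prems(2) that \<open>open U\<close> unfolding differentiable_def
    by (metis has_derivative_transform_within_open)
  moreover have "Ck_on k (\<lambda>x. frechet_derivative g (at x) v) U" for v
  proof (rule Suc.IH)
    show "Ck_on k (\<lambda>x. frechet_derivative f (at x) v) U"
      using Suc.prems(1) by simp
    show "frechet_derivative f (at x) v = frechet_derivative g (at x) v" if "x \<in> U" for x
      using frechet_derivative_transform_within_open[OF diff[OF that] \<open>open U\<close> that] Suc.prems(2)
      by metis
  qed
  ultimately show ?case
    using \<open>open U\<close> by (simp add: differentiable_on_eq_differentiable_at)
qed

text \<open>Every directional derivative has the same shape, with
  \<open>deriv_along g (\<iota> v)\<close> in place of \<open>g\<close>, and that map is again
  holomorphic; the induction therefore runs over all \<open>g\<close>.\<close>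

lemma holomorphic_restriction_Ck_on:
  fixes g :: "'a::complex_normed_space \<Rightarrow> complex^'n"
  assumes "open U" and \<iota>: "bounded_linear \<iota>" and L: "bounded_linear L"
    and "\<And>x. x \<in> U \<Longrightarrow> holomorphic_at g (\<iota> x)"
  shows "Ck_on k (\<lambda>x. L (g (\<iota> x))) U"
  using assms(4)
proof (induction k arbitrary: g)
  case 0
  have "isCont (\<lambda>x. L (g (\<iota> x))) x" if "x \<in> U" for x
    by (rule isCont_o2[OF isCont_o2[OF linear_continuous_at[OF \<iota>] holomorphic_at_isCont[OF 0[OF that]]]
          linear_continuous_at[OF L]])
  then show ?case
    by (simp add: continuous_at_imp_continuous_on)
next
  case (Suc k)
  have der: "((\<lambda>x. L (g (\<iota> x))) has_derivative (\<lambda>v. L (deriv_along g (\<iota> v) (\<iota> x)))) (at x)"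
    if "x \<in> U" for x
    by (rule bounded_linear.has_derivative[OF L has_derivative_compose[OF
            bounded_linear_imp_has_derivative[OF \<iota>] cdifferentiable_has_derivative]])
      (rule holomorphic_at_cdifferentiable[OF Suc.prems[OF that]])
  have "Ck_on k (\<lambda>x. frechet_derivative (\<lambda>x. L (g (\<iota> x))) (at x) v) U" for v
  proof (rule Ck_on_cong[OF \<open>open U\<close>])
    show "Ck_on k (\<lambda>x. L (deriv_along g (\<iota> v) (\<iota> x))) U"
      by (intro Suc.IH holomorphic_at_deriv_along Suc.prems)
    show "L (deriv_along g (\<iota> v) (\<iota> x)) = frechet_derivative (\<lambda>x. L (g (\<iota> x))) (at x) v"
      if "x \<in> U" for x
      by (rule deriv_along_eq[OF der[OF that], symmetric])
  qed
  moreover have "(\<lambda>x. L (g (\<iota> x))) differentiable_on U"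
    using der \<open>open U\<close> unfolding differentiable_on_eq_differentiable_at[OF \<open>open U\<close>] differentiable_def
    by blast
  ultimately show ?case by simp
qed

text \<open>A map that is real at real points has real derivatives in real directions, by uniqueness
  of the derivative before and after applying \<open>vec_Re\<close>. Jacobians of real methods can
  so be read off from their extensions, on a whole neighbourhood.\<close>

lemma holomorphic_restriction_derivative:
  fixes g :: "complex \<times> (complex^'d) \<Rightarrow> complex^'d" and F :: "real \<Rightarrow> real^'d \<Rightarrow> real^'d"
  assumes "holomorphic_at g (complexify r)"
    and "\<forall>\<^sub>F s in nhds r. g (complexify s) = vec_of_real (F (fst s) (snd s))"
  shows "\<forall>\<^sub>F s in nhds r.
    (F (fst s) has_derivative (\<lambda>v. vec_Re (deriv_along g (0, vec_of_real v) (complexify s)))) (at (snd s)) \<and>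
    (\<forall>v. vec_of_real (vec_Re (deriv_along g (0, vec_of_real v) (complexify s)))
      = deriv_along g (0, vec_of_real v) (complexify s))"
  using eventually_complexify[OF assms(1)[unfolded holomorphic_at_def]]
    iffD2[OF eventually_eventually assms(2)]
proof eventually_elim
  case (elim s)
  obtain h x where s: "s = (h, x)" by fastforce
  let ?D = "\<lambda>v. deriv_along g (0, vec_of_real v) (complexify s)"
  have "isCont (\<lambda>y. (h, y)) x"
    by (intro continuous_intros)
  then have eq: "\<forall>\<^sub>F y in nhds x. g (complexify (h, y)) = vec_of_real (F h y)"
    using eventually_isCont[of "\<lambda>s. g (complexify s) = vec_of_real (F (fst s) (snd s))" "\<lambda>y. (h, y)" x] elim(2)
    by (simp add: s)
  then have eq': "\<forall>\<^sub>F y in at x. g (complexify (h, y)) = vec_of_real (F h y)"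
    "g (complexify (h, x)) = vec_of_real (F h x)"
    using eq by (simp_all add: eventually_nhds_conv_at)
  have "((\<lambda>y. complexify (h, y)) has_derivative (\<lambda>v. (0, vec_of_real v))) (at x)"
    unfolding complexify_Pair
    by (intro has_derivative_Pair has_derivative_const
        bounded_linear_imp_has_derivative bounded_linear_vec_of_real)
  from has_derivative_compose[OF this cdifferentiable_has_derivative] elim(1)
  have D: "((\<lambda>y. g (complexify (h, y))) has_derivative ?D) (at x)"
    by (simp add: s)
  then have "((\<lambda>y. vec_Re (g (complexify (h, y)))) has_derivative (\<lambda>v. vec_Re (?D v))) (at x)"
    by (rule bounded_linear.has_derivative[OF bounded_linear_vec_Re])
  moreover have "\<forall>\<^sub>F y in at x. vec_Re (g (complexify (h, y))) = F h y"
    using eq'(1) by eventually_elim simp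
  ultimately have F: "(F h has_derivative (\<lambda>v. vec_Re (?D v))) (at x)"
    by (rule has_derivative_transform_eventually) (simp_all add: eq'(2) del: complexify_Pair)
  have "((\<lambda>y. vec_of_real (F h y)) has_derivative ?D) (at x)"
    by (rule has_derivative_transform_eventually[OF D]) (simp_all add: eq' del: complexify_Pair)
  moreover have "((\<lambda>y. vec_of_real (F h y)) has_derivative (\<lambda>v. vec_of_real (vec_Re (?D v)))) (at x)"
    by (rule bounded_linear.has_derivative[OF bounded_linear_vec_of_real F])
  ultimately have "?D = (\<lambda>v. vec_of_real (vec_Re (?D v)))"
    using has_derivative_unique by blast
  then have "vec_of_real (vec_Re (?D v)) = ?D v" for v
    by (rule fun_cong[symmetric])
  with F show ?case
    by (simp add: s)
qed

section \<open>Complex conjugation and Schwarz reflection\<close>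

definition cnj_vec :: "complex^'n \<Rightarrow> complex^'n" where
  "cnj_vec z = (\<chi> i. cnj (z $ i))"

lemma cnj_vec_nth [simp]: "cnj_vec z $ i = cnj (z $ i)"
  by (simp add: cnj_vec_def)

lemma cnj_vec_cnj_vec [simp]: "cnj_vec (cnj_vec z) = z"
  and cnj_vec_vec_of_real [simp]: "cnj_vec (vec_of_real x) = vec_of_real x"
  and norm_cnj_vec [simp]: "norm (cnj_vec z) = norm z"
  by (simp_all add: vec_eq_iff norm_vec_def)

lemma bounded_linear_cnj_vec: "bounded_linear cnj_vec"
  by (rule bounded_linear_intro[where K = 1]) (simp_all add: vec_eq_iff)

text \<open>The inner and the outer conjugation are each antilinear, so the derivative of the
  reflected map is complex linear again.\<close>

lemma holomorphic_at_cnj: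
  fixes f :: "complex \<times> (complex^'d) \<Rightarrow> complex^'n"
  assumes "holomorphic_at f (complexify r)"
  shows "holomorphic_at (\<lambda>p. cnj_vec (f (cnj (fst p), cnj_vec (snd p)))) (complexify r)"
proof -
  let ?c = "\<lambda>p :: complex \<times> (complex^'d). (cnj (fst p), cnj_vec (snd p))"
  have c: "bounded_linear ?c"
    by (intro bounded_linear_Pair bounded_linear_compose[OF bounded_linear_cnj bounded_linear_fst]
        bounded_linear_compose[OF bounded_linear_cnj_vec bounded_linear_snd])
  have "?c (complexify r) = complexify r"
    by (simp add: complexify_def)
  then have "\<forall>\<^sub>F p in nhds (complexify r). cdifferentiable f (?c p)"
    using eventually_isCont[of "cdifferentiable f" ?c "complexify r"] linear_continuous_at[OF c] assms
    by (simp add: holomorphic_at_def)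
  then show ?thesis
    unfolding holomorphic_at_def
  proof eventually_elim
    case (elim p)
    have "((\<lambda>p. cnj_vec (f (?c p))) has_derivative (\<lambda>v. cnj_vec (deriv_along f (?c v) (?c p)))) (at p)"
      by (rule bounded_linear.has_derivative[OF bounded_linear_cnj_vec has_derivative_compose[OF
            bounded_linear_imp_has_derivative[OF c] cdifferentiable_has_derivative[OF elim]]])
    moreover have "?c (k *\<^sub>C v) = cnj k *\<^sub>C ?c v" for k v
      by (simp add: vec_eq_iff scaleC_complex_def)
    then have "cnj_vec (deriv_along f (?c (k *\<^sub>C v)) (?c p)) = k *\<^sub>C cnj_vec (deriv_along f (?c v) (?c p))" for k v
      by (simp only: deriv_along_scaleC[OF elim]) (simp add: vec_eq_iff scaleC_complex_def)
    ultimately show ?case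
      by (rule cdifferentiableI)
  qed
qed

subsection \<open>Compositions of a holomorphic method\<close>

lemma composition_cong:
  "(\<And>j. 1 \<le> j \<Longrightarrow> j \<le> k \<Longrightarrow> \<alpha> j = \<beta> j) \<Longrightarrow> composition S \<alpha> k h = composition S \<beta> k h"
  by (induction k) auto

text \<open>Splits off the innermost instead of the outermost factor, as needed for reading a
  composition backwards.\<close>

lemma composition_Suc_inner:
  "composition S \<alpha> (Suc k) h = composition S (\<lambda>j. \<alpha> (Suc j)) k h \<circ> S (\<alpha> 1 * h)"
proof (induction k)
  case (Suc k)
  have "composition S \<alpha> (Suc (Suc k)) h = S (\<alpha> (Suc (Suc k)) * h) \<circ> composition S \<alpha> (Suc k) h"
    by simp
  then show ?case
    unfolding Suc by (simp add: o_assoc)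
qed simp

text \<open>Because of \<open>step_0\<close> every stage of a composition fixes the base points
  \<open>(0, x)\<close> with \<open>x\<close> real, so germs can be composed without shrinking
  domains by hand.\<close>

locale analytic_method =
  fixes SC :: "complex \<Rightarrow> complex^'d \<Rightarrow> complex^'d"
  assumes holomorphic: "\<And>x. holomorphic_at (\<lambda>p. SC (fst p) (snd p)) (complexify (0, x))"
    and step_0: "\<And>x. SC 0 (vec_of_real x) = vec_of_real x"
begin

abbreviation cmap :: "(nat \<Rightarrow> complex) \<Rightarrow> nat \<Rightarrow> complex \<times> (complex^'d) \<Rightarrow> complex^'d" where
  "cmap \<alpha> k p \<equiv> composition SC \<alpha> k (fst p) (snd p)"

lemma composition_0: "composition SC \<alpha> k 0 (vec_of_real x) = vec_of_real x"
  by (induction k) (simp_all add: step_0)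

lemma holomorphic_step:
  assumes "holomorphic_at g (complexify (0, x))" and "g (complexify (0, x)) = vec_of_real x"
  shows "holomorphic_at (\<lambda>p. (c * fst p, g p)) (complexify (0, x))"
    and "holomorphic_at (\<lambda>p. SC (c * fst p) (g p)) (complexify (0, x))"
proof -
  have "holomorphic_at (\<lambda>p. c *\<^sub>C fst p) (complexify (0, x))"
    by (intro holomorphic_at_scaleC holomorphic_at_fst)
  then show *: "holomorphic_at (\<lambda>p. (c * fst p, g p)) (complexify (0, x))"
    using assms(1) unfolding scaleC_complex_def by (rule holomorphic_at_Pair)
  from holomorphic_at_compose[OF this, of "\<lambda>p. SC (fst p) (snd p)"] holomorphic[of x]
  show "holomorphic_at (\<lambda>p. SC (c * fst p) (g p)) (complexify (0, x))"
    using assms(2) by simp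
qed

lemma holomorphic_composition: "holomorphic_at (cmap \<alpha> k) (complexify (0, x))"
proof (induction k)
  case 0
  then show ?case by (simp add: holomorphic_at_snd)
next
  case (Suc k)
  from holomorphic_step(2)[OF this, of "\<alpha> (Suc k)"] show ?case
    by (simp add: composition_0)
qed

lemma eventually_step:
  fixes x :: "real^'d"
  assumes "holomorphic_at g (complexify (0, x))" and "g (complexify (0, x)) = vec_of_real x"
    and "\<forall>\<^sub>F p in nhds (complexify (0, x)). P p"
  shows "\<forall>\<^sub>F p in nhds (complexify (0, x)). P (c * fst p, g p)"
  using eventually_isCont[OF _ holomorphic_at_isCont[OF holomorphic_step(1)[OF assms(1,2)]], where P = P]
    assms(2,3) by simp

text \<open>The map that feeds the next stage is continuous at \<open>(0, x)\<close> and fixes it,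
  so whatever holds of the basic method near that point holds at the intermediate values.\<close>

lemma eventually_composition:
  fixes x :: "real^'d"
  assumes "\<forall>\<^sub>F p in nhds (complexify (0, x)). P p"
  shows "\<forall>\<^sub>F p in nhds (complexify (0, x)). P (c * fst p, cmap \<alpha> k p)"
  by (rule eventually_step[OF holomorphic_composition _ assms]) (simp add: composition_0)

lemma composition_cnj:
  assumes "\<And>x. \<forall>\<^sub>F p in nhds (complexify (0, x)). SC (cnj (fst p)) (cnj_vec (snd p)) = cnj_vec (SC (fst p) (snd p))"
  shows "\<forall>\<^sub>F p in nhds (complexify (0, x)).
    composition SC (\<lambda>j. cnj (\<alpha> j)) k (cnj (fst p)) (cnj_vec (snd p)) = cnj_vec (cmap \<alpha> k p)"
proof (induction k)
  case (Suc k)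
  from eventually_composition[OF assms, where c = "\<alpha> (Suc k)" and \<alpha> = \<alpha> and k = k] Suc show ?case
    by eventually_elim simp
qed simp

text \<open>With \<open>c = \<alpha> (Suc k)\<close>, the expression is the shorter one enclosed
  between the steps \<open>c h\<close> and \<open>- c h\<close>; the shorter one cancels by
  induction, the enclosing pair by time symmetry.\<close>

lemma composition_reverse:
  assumes sym: "\<And>x. \<forall>\<^sub>F p in nhds (complexify (0, x)). SC (fst p) (SC (- fst p) (snd p)) = snd p"
  shows "\<forall>\<^sub>F p in nhds (complexify (0, x)).
    composition SC \<alpha> k (fst p) (composition SC (\<lambda>j. \<alpha> (k + 1 - j)) k (- fst p) (snd p)) = snd p"
proof (induction k)
  case (Suc k)
  let ?c = "\<alpha> (Suc k)"
  have hol: "holomorphic_at (\<lambda>p. SC (- ?c * fst p) (snd p)) (complexify (0, x))"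
    by (rule holomorphic_step(2)[OF holomorphic_at_snd]) simp
  \<comment> \<open>The induction hypothesis is applied after the innermost substep, whose result is
    still close to \<open>x\<close>.\<close>
  have inner: "\<forall>\<^sub>F p in nhds (complexify (0, x)). composition SC \<alpha> k (fst p)
      (composition SC (\<lambda>j. \<alpha> (k + 1 - j)) k (- fst p) (SC (- ?c * fst p) (snd p))) = SC (- ?c * fst p) (snd p)"
    using eventually_step[OF hol _ Suc, of 1] by (simp add: step_0)
  have outer: "\<forall>\<^sub>F p in nhds (complexify (0, x)). SC (?c * fst p) (SC (- (?c * fst p)) (snd p)) = snd p"
    using eventually_step[OF holomorphic_at_snd _ sym, of x ?c] by simp
  have rev: "composition SC (\<lambda>j. \<alpha> (Suc k + 1 - j)) (Suc k) h
      = composition SC (\<lambda>j. \<alpha> (k + 1 - j)) k h \<circ> SC (?c * h)" for h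
    unfolding composition_Suc_inner by simp
  show ?case
    using inner outer unfolding rev by eventually_elim simp
qed simp

text \<open>A palindrome is its own reversal, so \<open>composition_reverse\<close> speaks of the
  same composition twice.\<close>

lemma palindromic_composition_symmetric:
  assumes "\<And>x. \<forall>\<^sub>F p in nhds (complexify (0, x)). SC (fst p) (SC (- fst p) (snd p)) = snd p"
    and "\<forall>j\<in>{1..k}. \<alpha> (k + 1 - j) = \<alpha> j"
  shows "\<forall>\<^sub>F p in nhds (complexify (0, x)).
    composition SC \<alpha> k (fst p) (composition SC \<alpha> k (- fst p) (snd p)) = snd p"
proof -
  have "composition SC (\<lambda>j. \<alpha> (k + 1 - j)) k = composition SC \<alpha> k"
    using assms(2) by (intro ext fun_cong[OF composition_cong]) auto
  then show ?thesis
    using composition_reverse[OF assms(1), where \<alpha> = \<alpha> and k = k] by simp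
qed

text \<open>Chain rule and induction: a direction \<open>(0, u)\<close> has no step-size component,
  hence yields a direction of the same kind for the next stage.\<close>

lemma composition_invariant:
  assumes "\<And>x. \<forall>\<^sub>F p in nhds (complexify (0, x)). \<forall>u v.
    \<omega> (deriv_along (\<lambda>p. SC (fst p) (snd p)) (0, u) p) (deriv_along (\<lambda>p. SC (fst p) (snd p)) (0, v) p) = \<omega> u v"
  shows "\<forall>\<^sub>F p in nhds (complexify (0, x)). \<forall>u v.
    \<omega> (deriv_along (cmap \<alpha> k) (0, u) p) (deriv_along (cmap \<alpha> k) (0, v) p) = \<omega> u v"
proof (induction k)
  case 0
  then show ?case
    by (simp add: deriv_along_eq[OF bounded_linear_imp_has_derivative[OF bounded_linear_snd]])
next
  case (Suc k)
  let ?c = "\<alpha> (Suc k)"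
  let ?S = "\<lambda>p. SC (fst p) (snd p)"
  from Suc holomorphic_composition[of \<alpha> k x, unfolded holomorphic_at_def]
    eventually_composition[OF assms, where c = ?c and \<alpha> = \<alpha> and k = k]
    eventually_composition[OF holomorphic[unfolded holomorphic_at_def],
      where c = ?c and \<alpha> = \<alpha> and k = k]
  show ?case
  proof eventually_elim
    case (elim p)
    have "((\<lambda>p. (?c * fst p, cmap \<alpha> k p)) has_derivative (\<lambda>w. (?c * fst w, deriv_along (cmap \<alpha> k) w p))) (at p)"
      by (intro has_derivative_Pair cdifferentiable_has_derivative elim
          has_derivative_mult_right has_derivative_fst has_derivative_ident)
    note D = has_derivative_compose[OF this cdifferentiable_has_derivative[OF elim(4)]]
    have "deriv_along (cmap \<alpha> (Suc k)) (0, u) p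
        = deriv_along ?S (0, deriv_along (cmap \<alpha> k) (0, u) p) (?c * fst p, cmap \<alpha> k p)" for u
      using deriv_along_eq[OF D, where v = "(0, u)"] by simp
    then show ?case
      using elim(1,3) by simp
  qed
qed

end

subsection \<open>From germs to compact sets\<close>

text \<open>The predicate keeps the index \<open>x\<close> because local bounds come with constants
  depending on the base point; finitely many such points serve the whole compact set.\<close>

lemma compact_local_cover:
  fixes K :: "(real^'d) set"
  assumes "compact K" and "\<And>x. x \<in> K \<Longrightarrow> \<forall>\<^sub>F r in nhds (0 :: real, x). P x r"
  obtains T where "finite T" "T \<subseteq> K" "\<forall>\<^sub>F h in nhds 0. \<forall>y\<in>K. \<exists>x\<in>T. P x (h, y)"
proof -
  have "\<forall>x\<in>K. \<exists>d>0. \<forall>r. dist r (0 :: real, x) < d \<longrightarrow> P x r"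
    using assms(2) by (simp add: eventually_nhds_metric)
  from bchoice[OF this] obtain d where d: "\<And>x. x \<in> K \<Longrightarrow> d x > 0"
    "\<And>x r. x \<in> K \<Longrightarrow> dist r (0, x) < d x \<Longrightarrow> P x r"
    by blast
  \<comment> \<open>Half radii, since \<open>\<bar>h\<bar>\<close> and \<open>dist y x\<close> have
    to share \<open>d x\<close>.\<close>
  obtain T where T: "T \<subseteq> K" "finite T" "K \<subseteq> (\<Union>x\<in>T. ball x (d x / 2))"
  proof (rule compactE_image[OF \<open>compact K\<close>, of K "\<lambda>x. ball x (d x / 2)"])
    show "K \<subseteq> (\<Union>x\<in>K. ball x (d x / 2))"
      using d(1) by force
  qed auto
  have "\<forall>\<^sub>F h in nhds (0 :: real). \<bar>h\<bar> < d x / 2" if "x \<in> T" for x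
    using d(1)[of x] that T(1) by (auto simp: eventually_nhds_metric intro!: exI[of _ "d x / 2"])
  then have "\<forall>\<^sub>F h in nhds (0 :: real). \<forall>x\<in>T. \<bar>h\<bar> < d x / 2"
    using T(2) by (simp add: eventually_ball_finite_distrib)
  then have "\<forall>\<^sub>F h in nhds 0. \<forall>y\<in>K. \<exists>x\<in>T. P x (h, y)"
  proof eventually_elim
    case (elim h)
    show ?case
    proof
      fix y assume "y \<in> K"
      then obtain x where x: "x \<in> T" "dist x y < d x / 2"
        using T(3) by auto
      have "dist (h, y) (0, x) \<le> \<bar>h\<bar> + dist y x"
        using sqrt_sum_squares_le_sum[of "\<bar>h\<bar>" "dist y x"] by (simp add: dist_Pair_Pair)
      also have "\<dots> < d x"
        using elim x by (force simp: dist_commute)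
      finally show "\<exists>x\<in>T. P x (h, y)"
        using d(2)[of x "(h, y)"] x(1) T(1) by blast
    qed
  qed
  with T that show ?thesis by blast
qed

lemma small_step_localI:
  assumes "\<And>x. \<forall>\<^sub>F r in nhds (0, x). P (fst r) (snd r)"
  shows "small_step P"
  unfolding small_step_def
proof (intro allI impI)
  fix K :: "(real^'a) set" assume "compact K"
  show "\<forall>\<^sub>F h in nhds 0. \<forall>x\<in>K. P h x"
  proof (rule compact_local_cover[OF \<open>compact K\<close>, where P = "\<lambda>_ r. P (fst r) (snd r)"])
    show "\<forall>\<^sub>F r in nhds (0, x). P (fst r) (snd r)" for x
      by (rule assms)
    fix T assume "\<forall>\<^sub>F h in nhds 0. \<forall>y\<in>K. \<exists>x\<in>T. P (fst (h, y)) (snd (h, y))"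
    then show ?thesis
      by (rule eventually_mono) simp
  qed
qed

text \<open>The closed unit ball about \<open>x\<close> is compact and a neighbourhood of
  \<open>x\<close>, so a statement uniform on compact sets yields one about germs.\<close>

lemma eventually_nhds_Pair_cball:
  assumes "\<forall>\<^sub>F h in nhds (0 :: real). \<forall>y\<in>cball (x :: real^'d) 1. P h y"
  shows "\<forall>\<^sub>F r in nhds (0, x). P (fst r) (snd r)"
proof -
  obtain d where "d > 0" and d: "\<forall>h. dist h 0 < d \<longrightarrow> (\<forall>y\<in>cball x 1. P h y)"
    using assms unfolding eventually_nhds_metric by (elim exE conjE)
  show ?thesis
    unfolding eventually_nhds_metric
  proof (intro exI[of _ "min d 1"] conjI allI impI)
    fix r :: "real \<times> (real^'d)" assume "dist r (0, x) < min d 1"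
    then show "P (fst r) (snd r)"
      using dist_fst_le[of r "(0, x)"] dist_snd_le[of r "(0, x)"]
      by (intro d[rule_format]) (simp_all add: dist_commute)
  qed (use \<open>d > 0\<close> in simp)
qed

lemma small_step_localD:
  assumes "small_step P"
  shows "\<forall>\<^sub>F r in nhds (0, x). P (fst r) (snd r)"
  by (rule eventually_nhds_Pair_cball) (use assms in \<open>simp add: small_step_def\<close>)

lemma bigO_step_on_localI:
  assumes "compact K"
    and "\<And>x. \<exists>C. \<forall>\<^sub>F r in nhds (0, x). fst r \<noteq> 0 \<longrightarrow> norm (E (fst r) (snd r)) \<le> C * \<bar>fst r\<bar> ^ k"
  shows "bigO_step_on K k E"
proof -
  have "\<forall>x. \<exists>C. \<forall>\<^sub>F r in nhds (0, x). fst r \<noteq> 0 \<longrightarrow> norm (E (fst r) (snd r)) \<le> C * \<bar>fst r\<bar> ^ k"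
    using assms(2) by (rule allI)
  from choice[OF this] obtain C
    where C: "\<forall>x. \<forall>\<^sub>F r in nhds (0, x). fst r \<noteq> 0 \<longrightarrow> norm (E (fst r) (snd r)) \<le> C x * \<bar>fst r\<bar> ^ k"
    by (rule exE)
  obtain T where "finite T"
    and T: "\<forall>\<^sub>F h in nhds 0. \<forall>y\<in>K. \<exists>x\<in>T. fst (h, y) \<noteq> 0
      \<longrightarrow> norm (E (fst (h, y)) (snd (h, y))) \<le> C x * \<bar>fst (h, y)\<bar> ^ k"
    by (rule compact_local_cover[OF \<open>compact K\<close> spec[OF C]])
  \<comment> \<open>Summing absolute values gives one constant above all local ones, whatever their
    signs.\<close>
  have "C x \<le> (\<Sum>x\<in>T. \<bar>C x\<bar>)" if "x \<in> T" for x
    using member_le_sum[OF that, of "\<lambda>x. \<bar>C x\<bar>"] \<open>finite T\<close> by fastforce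
  then have le: "C x * \<bar>h\<bar> ^ k \<le> (\<Sum>x\<in>T. \<bar>C x\<bar>) * \<bar>h\<bar> ^ k" if "x \<in> T" for x h
    using that by (intro mult_right_mono) auto
  show ?thesis
    unfolding bigO_step_on_def eventually_at_filter
  proof (intro exI[of _ "\<Sum>x\<in>T. \<bar>C x\<bar>"] eventually_mono[OF T] impI ballI)
    fix h y assume "\<forall>y\<in>K. \<exists>x\<in>T. fst (h, y) \<noteq> 0
      \<longrightarrow> norm (E (fst (h, y)) (snd (h, y))) \<le> C x * \<bar>fst (h, y)\<bar> ^ k" "h \<noteq> 0" "y \<in> K"
    then obtain x where "x \<in> T" "norm (E h y) \<le> C x * \<bar>h\<bar> ^ k" by auto
    then show "norm (E h y) \<le> (\<Sum>x\<in>T. \<bar>C x\<bar>) * \<bar>h\<bar> ^ k"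
      using le order_trans by blast
  qed
qed

lemma bigO_step_localI:
  assumes "\<And>x. \<exists>C. \<forall>\<^sub>F r in nhds (0, x). fst r \<noteq> 0 \<longrightarrow> norm (E (fst r) (snd r)) \<le> C * \<bar>fst r\<bar> ^ k"
  shows "bigO_step k E"
  unfolding bigO_step_def by (intro allI impI bigO_step_on_localI assms)

lemma bigO_step_localD:
  assumes "bigO_step k E"
  obtains C where "\<forall>\<^sub>F r in nhds (0, x). fst r \<noteq> 0 \<longrightarrow> norm (E (fst r) (snd r)) \<le> C * \<bar>fst r\<bar> ^ k"
proof -
  have "bigO_step_on (cball x 1) k E"
    using assms by (simp add: bigO_step_def)
  then obtain C where "\<forall>\<^sub>F h in at 0. \<forall>y\<in>cball x 1. norm (E h y) \<le> C * \<bar>h\<bar> ^ k"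
    unfolding bigO_step_on_def by (rule exE)
  then have "\<forall>\<^sub>F h in nhds 0. \<forall>y\<in>cball x 1. h \<noteq> 0 \<longrightarrow> norm (E h y) \<le> C * \<bar>h\<bar> ^ k"
    unfolding eventually_at_filter by eventually_elim simp
  from that[OF eventually_nhds_Pair_cball[OF this]] show ?thesis .
qed

lemma eventually_abs_fst_less:
  fixes x :: "real^'d" and e :: real
  assumes "e > 0"
  shows "\<forall>\<^sub>F r in nhds (0, x). \<bar>fst r\<bar> < e"
proof -
  have "\<bar>fst r\<bar> < e" if "dist r (0, x) < e" for r :: "real \<times> (real^'d)"
    using dist_fst_le[of r "(0, x)"] that by simp
  then show ?thesis
    unfolding eventually_nhds_metric using assms by (intro exI[of _ e]) simp
qed

lemma bigO_step_mono:
  fixes E :: "real \<Rightarrow> real^'d \<Rightarrow> 'b::real_normed_vector"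
  assumes "bigO_step k E" and "j \<le> k"
  shows "bigO_step j E"
proof (rule bigO_step_localI)
  fix x
  obtain C where C: "\<forall>\<^sub>F r in nhds (0, x). fst r \<noteq> 0 \<longrightarrow> norm (E (fst r) (snd r)) \<le> C * \<bar>fst r\<bar> ^ k"
    by (rule bigO_step_localD[OF assms(1)])
  from C eventually_abs_fst_less[OF zero_less_one]
  have "\<forall>\<^sub>F r in nhds (0, x). fst r \<noteq> 0 \<longrightarrow> norm (E (fst r) (snd r)) \<le> \<bar>C\<bar> * \<bar>fst r\<bar> ^ j"
  proof eventually_elim
    case (elim r)
    have "C * \<bar>fst r\<bar> ^ k \<le> \<bar>C\<bar> * \<bar>fst r\<bar> ^ j"
      using elim(2) \<open>j \<le> k\<close> by (intro mult_mono power_decreasing) auto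
    with elim(1) show ?case by auto
  qed
  then show "\<exists>C. \<forall>\<^sub>F r in nhds (0, x). fst r \<noteq> 0 \<longrightarrow> norm (E (fst r) (snd r)) \<le> C * \<bar>fst r\<bar> ^ j"
    by blast
qed

section \<open>The analytic extension of a second-order method\<close>

lemma exact_flow_tendsto:
  assumes "exact_flow f \<phi>"
  shows "((\<lambda>h. \<phi> h x) \<longlongrightarrow> x) (at 0)"
proof -
  have "small_step (\<lambda>t x. ((\<lambda>s. \<phi> s x) has_vector_derivative f (\<phi> t x)) (at t))" and "\<phi> 0 x = x"
    using assms by (auto simp: exact_flow_def)
  then have "\<forall>\<^sub>F t in nhds 0. ((\<lambda>s. \<phi> s x) has_vector_derivative f (\<phi> t x)) (at t)"
    unfolding small_step_def by (elim allE[of _ "{x}"]) simp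
  then have "((\<lambda>s. \<phi> s x) has_vector_derivative f (\<phi> 0 x)) (at 0)"
    by (rule eventually_nhds_x_imp_x)
  from has_vector_derivative_continuous[OF this] show ?thesis
    using \<open>\<phi> 0 x = x\<close> by (simp add: continuous_within)
qed

lemma
  fixes S \<phi> :: "real \<Rightarrow> real^'d \<Rightarrow> real^'d"
  assumes flow: "exact_flow f \<phi>" and ext: "analytic_extension S SC" and order: "has_order \<phi> 2 S"
  shows analytic_extension_analytic_method: "analytic_method SC"
    and analytic_extension_agree: "\<forall>\<^sub>F r in nhds (0, x).
      SC (of_real (fst r)) (vec_of_real (snd r)) = vec_of_real (S (fst r) (snd r))"
proof -
  obtain D where D: "holomorphic_method_on SC D" "\<And>x. (0, vec_of_real x) \<in> D"
    "\<And>h x. (complex_of_real h, vec_of_real x) \<in> D \<Longrightarrow> SC (of_real h) (vec_of_real x) = vec_of_real (S h x)"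
    using ext unfolding analytic_extension_def by blast
  have "open D"
    using D(1) by (simp add: holomorphic_method_on_def)
  have cs: "c *s w = c *\<^sub>C w" for c and w :: "complex^'d"
    by (simp add: vec_eq_iff scaleC_complex_def)
  have cd: "cdifferentiable (\<lambda>p. SC (fst p) (snd p)) p" if "p \<in> D" for p
  proof -
    obtain S' where "((\<lambda>(h, z). SC h z) has_derivative S') (at p)"
      "\<And>c k w. S' (c * k, c *s w) = c *s S' (k, w)"
      using D(1) \<open>p \<in> D\<close> unfolding holomorphic_method_on_def by blast
    then show ?thesis
      by (intro cdifferentiableI[of _ S'])
        (auto simp: case_prod_beta' cs scaleC_prod_def scaleC_complex_def)
  qed
  have hol: "holomorphic_at (\<lambda>p. SC (fst p) (snd p)) (complexify (0, x))" for x
    unfolding holomorphic_at_def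
    by (rule eventually_mono[OF eventually_nhds_in_open[OF \<open>open D\<close>] cd]) (simp add: D(2))
  have agree: "\<forall>\<^sub>F r in nhds (0, x). SC (of_real (fst r)) (vec_of_real (snd r)) = vec_of_real (S (fst r) (snd r))" for x
  proof -
    have "\<forall>\<^sub>F q in nhds (complexify (0, x)). q \<in> D"
      using eventually_nhds_in_open[OF \<open>open D\<close>, of "complexify (0, x)"] D(2)[of x] by simp
    from eventually_complexify[OF this] show ?thesis
    proof eventually_elim
      case (elim r)
      then show ?case
        using D(3)[of "fst r" "snd r"] by (simp add: complexify_def)
    qed
  qed
  then show "\<forall>\<^sub>F r in nhds (0, x). SC (of_real (fst r)) (vec_of_real (snd r)) = vec_of_real (S (fst r) (snd r))" .
  \<comment> \<open>The order condition is silent at \<open>h = 0\<close>. The value there is found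
    as a limit: \<open>S h x\<close> tends to \<open>x\<close> along with the flow, and
    \<open>SC\<close> is continuous at \<open>(0, x)\<close>.\<close>
  have "SC 0 (vec_of_real x) = vec_of_real x" for x
  proof (rule tendsto_unique)
    have "isCont (\<lambda>h :: real. (complex_of_real h, vec_of_real x)) 0"
      by (intro continuous_intros)
    then have "isCont (\<lambda>h. SC (of_real h) (vec_of_real x)) 0"
      using isCont_o2[of 0 "\<lambda>h :: real. (complex_of_real h, vec_of_real x)" "\<lambda>p. SC (fst p) (snd p)"]
        holomorphic_at_isCont[OF hol[of x]] by simp
    then show "((\<lambda>h :: real. SC (of_real h) (vec_of_real x)) \<longlongrightarrow> SC 0 (vec_of_real x)) (at 0)"
      by (simp add: isCont_def)
    have "bigO_step_on {x} 3 (\<lambda>h x. S h x - \<phi> h x)"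
      using order by (simp add: has_order_def bigO_step_def)
    then obtain C where "\<forall>\<^sub>F h in at 0. norm (S h x - \<phi> h x) \<le> C * \<bar>h\<bar> ^ 3"
      by (auto simp: bigO_step_on_def)
    moreover have "((\<lambda>h::real. C * \<bar>h\<bar> ^ 3) \<longlongrightarrow> C * \<bar>0\<bar> ^ 3) (at 0)"
      by (intro tendsto_intros)
    then have "((\<lambda>h::real. C * \<bar>h\<bar> ^ 3) \<longlongrightarrow> 0) (at 0)"
      by simp
    ultimately have "((\<lambda>h. S h x - \<phi> h x) \<longlongrightarrow> 0) (at 0)"
      by (rule Lim_null_comparison)
    from tendsto_add[OF this exact_flow_tendsto[OF flow, of x]]
    have "((\<lambda>h. S h x) \<longlongrightarrow> x) (at 0)"
      by simp
    then have "((\<lambda>h. vec_of_real (S h x)) \<longlongrightarrow> vec_of_real x) (at 0)"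
      by (rule bounded_linear.tendsto[OF bounded_linear_vec_of_real])
    moreover have "\<forall>\<^sub>F h in at 0. vec_of_real (S h x) = SC (of_real h) (vec_of_real x)"
    proof -
      have "isCont (\<lambda>h :: real. (h, x)) 0"
        by (intro continuous_intros)
      then have "\<forall>\<^sub>F h in nhds 0. SC (of_real h) (vec_of_real x) = vec_of_real (S h x)"
        using eventually_isCont[where f = "\<lambda>h. (h, x)" and p = 0, OF agree[of x]] by simp
      then show ?thesis
        by (simp add: eventually_nhds_conv_at eq_commute)
    qed
    ultimately show "((\<lambda>h :: real. SC (of_real h) (vec_of_real x)) \<longlongrightarrow> vec_of_real x) (at 0)"
      by (rule Lim_transform_eventually)
  qed simp
  with hol show "analytic_method SC"
    by unfold_locales
qed

subsection \<open>The real part of a palindromic composition\<close>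

text \<open>Here \<open>m\<close> is the exponent of the error, one more than the order of the
  composition; the defects of symmetry and symplecticity will carry \<open>2 * m\<close>.\<close>

locale palindromic_method = analytic_method SC
  for SC :: "complex \<Rightarrow> complex^'d \<Rightarrow> complex^'d" +
  fixes S \<phi> :: "real \<Rightarrow> real^'d \<Rightarrow> real^'d" and \<alpha> :: "nat \<Rightarrow> complex" and s m :: nat
  assumes agree: "\<And>x. \<forall>\<^sub>F r in nhds (0, x). SC (of_real (fst r)) (vec_of_real (snd r)) = vec_of_real (S (fst r) (snd r))"
    and symmetric: "time_symmetric S"
    and palindrome: "\<forall>j\<in>{1..s}. \<alpha> (s + 1 - j) = \<alpha> j"
    and order: "bigO_step m (\<lambda>h x. composition_method SC \<alpha> s h x - vec_of_real (\<phi> h x))"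
begin

text \<open>\<open>SC\<close> and its Schwarz reflection agree at real points, where the values are
  real, hence near them by the identity theorem.\<close>

lemma step_cnj:
  "\<forall>\<^sub>F p in nhds (complexify (0, x)). SC (cnj (fst p)) (cnj_vec (snd p)) = cnj_vec (SC (fst p) (snd p))"
proof -
  have "\<forall>\<^sub>F p in nhds (complexify (0, x)). SC (fst p) (snd p) - cnj_vec (SC (cnj (fst p)) (cnj_vec (snd p))) = 0"
  proof (rule holomorphic_identity)
    show "holomorphic_at (\<lambda>p. SC (fst p) (snd p) - cnj_vec (SC (cnj (fst p)) (cnj_vec (snd p)))) (complexify (0, x))"
      using holomorphic_at_diff[OF holomorphic holomorphic_at_cnj[OF holomorphic]] by simp
    show "\<forall>\<^sub>F r in nhds (0, x). SC (fst (complexify r)) (snd (complexify r))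
        - cnj_vec (SC (cnj (fst (complexify r))) (cnj_vec (snd (complexify r)))) = 0"
      using agree by eventually_elim (simp add: complexify_def)
  qed
  then show ?thesis
    by eventually_elim (metis cnj_vec_cnj_vec right_minus_eq)
qed

text \<open>At real points the claim is time symmetry of \<open>S\<close>, once the intermediate
  value is identified with that of \<open>S\<close>; the identity theorem does the rest.\<close>

lemma step_symmetric:
  "\<forall>\<^sub>F p in nhds (complexify (0, x)). SC (fst p) (SC (- fst p) (snd p)) = snd p"
proof -
  let ?g = "\<lambda>p. SC (- 1 * fst p) (snd p)"
  have g: "holomorphic_at ?g (complexify (0, x))" for x
    by (rule holomorphic_step(2)[OF holomorphic_at_snd]) simp
  have "\<forall>\<^sub>F p in nhds (complexify (0, x)). SC (1 * fst p) (?g p) - snd p = 0"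
  proof (rule holomorphic_identity)
    show "holomorphic_at (\<lambda>p. SC (1 * fst p) (?g p) - snd p) (complexify (0, x))"
      by (rule holomorphic_at_diff[OF holomorphic_step(2)[OF g] holomorphic_at_snd]) (simp add: step_0)
    have minus: "isCont (\<lambda>r :: real \<times> (real^'d). (- fst r, snd r)) (0, x)"
      by (intro continuous_intros)
    have inner: "\<forall>\<^sub>F r in nhds (0, x). SC (of_real (- fst r)) (vec_of_real (snd r)) = vec_of_real (S (- fst r) (snd r))"
      using eventually_isCont[OF _ minus, where P = "\<lambda>r. SC (of_real (fst r)) (vec_of_real (snd r)) = vec_of_real (S (fst r) (snd r))"]
        agree[of x] by simp
    \<comment> \<open>For the outer step, the agreement of \<open>SC\<close> with \<open>S\<close>
      is needed at the inner value. \<open>vec_Re\<close> of the extension is a real argument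
      depending continuously on \<open>r\<close> at \<open>(0, x)\<close>, so the agreement can be
      pulled back.\<close>
    have "isCont (\<lambda>r. ?g (complexify r)) (0, x)"
      by (rule isCont_o2[OF linear_continuous_at[OF bounded_linear_complexify] holomorphic_at_isCont[OF g]])
    then have "isCont (\<lambda>r. (fst r, vec_Re (?g (complexify r)))) (0, x)"
      by (intro isCont_Pair isCont_o2[OF _ linear_continuous_at[OF bounded_linear_vec_Re]] continuous_intros)
    from eventually_isCont[OF _ this, where P = "\<lambda>r. SC (of_real (fst r)) (vec_of_real (snd r)) = vec_of_real (S (fst r) (snd r))"]
    have outer: "\<forall>\<^sub>F r in nhds (0, x). SC (of_real (fst r)) (vec_of_real (vec_Re (?g (complexify r))))
        = vec_of_real (S (fst r) (vec_Re (?g (complexify r))))"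
      using agree[of x] by (simp add: step_0)
    have "\<forall>\<^sub>F r in nhds (0, x). S (fst r) (S (- fst r) (snd r)) = snd r"
      using small_step_localD[OF symmetric[unfolded time_symmetric_def]] .
    with inner outer
    show "\<forall>\<^sub>F r in nhds (0, x). SC (1 * fst (complexify r)) (?g (complexify r)) - snd (complexify r) = 0"
      by eventually_elim (simp add: complexify_def)
  qed
  then show ?thesis by simp
qed

abbreviation \<Phi> :: "complex \<times> (complex^'d) \<Rightarrow> complex^'d" where
  "\<Phi> \<equiv> cmap \<alpha> s"

abbreviation \<Psi> :: "complex \<times> (complex^'d) \<Rightarrow> complex^'d" where
  "\<Psi> \<equiv> cmap (\<lambda>j. cnj (\<alpha> j)) s"

text \<open>The holomorphic extension of the real part. Componentwise \<open>Re\<close> would not be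
  holomorphic; conjugating the coefficients gives the same value at real points with small step
  size.\<close>

definition mean :: "complex \<times> (complex^'d) \<Rightarrow> complex^'d" where
  "mean p = (1 / 2) *\<^sub>C (\<Phi> p + \<Psi> p)"

text \<open>At real points with small step size this is \<open>\<i>\<close> times the imaginary part
  of the composition.\<close>

definition defect :: "complex \<times> (complex^'d) \<Rightarrow> complex^'d" where
  "defect p = (1 / 2) *\<^sub>C (\<Phi> p - \<Psi> p)"

abbreviation R :: "real \<Rightarrow> real^'d \<Rightarrow> real^'d" where
  "R \<equiv> real_part_method SC \<alpha> s"

lemma half_scaleC: "(1 / 2) *\<^sub>C (z :: complex^'d) = (1 / 2) *\<^sub>R z"
  using scaleC_of_real[of "1 / 2" z] by simp

lemma mean_add_defect: "mean p + defect p = \<Phi> p"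
  and mean_diff_defect: "mean p - defect p = \<Psi> p"
  by (simp_all add: mean_def defect_def half_scaleC vec_eq_iff complex_eq_iff add_divide_distrib
      diff_divide_distrib)

lemma holomorphic_mean: "holomorphic_at mean (complexify (0, x))"
  and holomorphic_defect: "holomorphic_at defect (complexify (0, x))"
  unfolding mean_def[abs_def] defect_def[abs_def]
  by (intro holomorphic_at_scaleC holomorphic_at_add holomorphic_at_diff holomorphic_composition)+

lemma mean_0: "mean (0, vec_of_real x) = vec_of_real x"
  and defect_0: "defect (0, vec_of_real x) = 0"
  by (simp_all add: mean_def defect_def composition_0 half_scaleC vec_eq_iff complex_eq_iff)

lemma conjugate_mean_eq: "conjugate_mean SC \<alpha> s h x = mean (complexify (h, x))"
  by (simp add: conjugate_mean_def composition_method_def mean_def half_scaleC)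

lemma real_part_eq: "R h x = vec_Re (mean (complexify (h, x)))"
  by (simp add: real_part_method_def conjugate_mean_eq)

lemma \<Psi>_real: "\<forall>\<^sub>F r in nhds (0, x). \<Psi> (complexify r) = cnj_vec (\<Phi> (complexify r))"
  using eventually_complexify[OF composition_cnj[OF step_cnj]]
  by (rule eventually_mono) (simp add: complexify_def)

lemma mean_real: "\<forall>\<^sub>F r in nhds (0, x). mean (complexify r) = vec_of_real (R (fst r) (snd r))"
  using \<Psi>_real
  by eventually_elim (simp add: real_part_eq mean_def half_scaleC vec_eq_iff complex_eq_iff)

lemma real_part_real: "small_step (\<lambda>h x. vec_of_real (R h x) = conjugate_mean SC \<alpha> s h x)"
proof (rule small_step_localI)
  show "\<forall>\<^sub>F r in nhds (0, x). vec_of_real (R (fst r) (snd r)) = conjugate_mean SC \<alpha> s (fst r) (snd r)" for x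
    using mean_real by eventually_elim (simp only: conjugate_mean_eq prod.collapse)
qed

lemma order_local:
  obtains C where "\<forall>\<^sub>F r in nhds (0, x). fst r \<noteq> 0
    \<longrightarrow> norm (\<Phi> (complexify r) - vec_of_real (\<phi> (fst r) (snd r))) \<le> C * \<bar>fst r\<bar> ^ m"
proof -
  obtain C where "\<forall>\<^sub>F r in nhds (0, x). fst r \<noteq> 0
    \<longrightarrow> norm (composition_method SC \<alpha> s (fst r) (snd r) - vec_of_real (\<phi> (fst r) (snd r))) \<le> C * \<bar>fst r\<bar> ^ m"
    by (rule bigO_step_localD[OF order])
  then have "\<forall>\<^sub>F r in nhds (0, x). fst r \<noteq> 0
    \<longrightarrow> norm (\<Phi> (complexify r) - vec_of_real (\<phi> (fst r) (snd r))) \<le> C * \<bar>fst r\<bar> ^ m"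
    by (simp add: composition_method_def complexify_def)
  then show ?thesis by (rule that)
qed

lemma real_part_order: "bigO_step m (\<lambda>h x. R h x - \<phi> h x)"
proof (rule bigO_step_localI)
  fix x
  obtain C where "\<forall>\<^sub>F r in nhds (0, x). fst r \<noteq> 0
    \<longrightarrow> norm (\<Phi> (complexify r) - vec_of_real (\<phi> (fst r) (snd r))) \<le> C * \<bar>fst r\<bar> ^ m"
    by (rule order_local)
  with \<Psi>_real[of x] have "\<forall>\<^sub>F r in nhds (0, x). fst r \<noteq> 0
    \<longrightarrow> norm (R (fst r) (snd r) - \<phi> (fst r) (snd r)) \<le> C * \<bar>fst r\<bar> ^ m"
  proof eventually_elim
    case (elim r)
    have "R (fst r) (snd r) - \<phi> (fst r) (snd r) = vec_Re (\<Phi> (complexify r) - vec_of_real (\<phi> (fst r) (snd r)))"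
      using elim(1) by (simp add: real_part_eq mean_def half_scaleC vec_eq_iff)
    with elim(2) show ?case
      using norm_vec_Re_le[of "\<Phi> (complexify r) - vec_of_real (\<phi> (fst r) (snd r))"] by auto
  qed
  then show "\<exists>C. \<forall>\<^sub>F r in nhds (0, x). fst r \<noteq> 0
    \<longrightarrow> norm (R (fst r) (snd r) - \<phi> (fst r) (snd r)) \<le> C * \<bar>fst r\<bar> ^ m"
    by (rule exI)
qed

text \<open>The flow is real, so the imaginary part of the composition is that of its error and has
  the same order; \<open>holomorphic_order\<close> extends the bound to complex points.\<close>

lemma defect_order:
  obtains C where "C \<ge> 0" "\<forall>\<^sub>F p in nhds (complexify (0, x)). norm (defect p) \<le> C * norm (fst p) ^ m"
proof -
  obtain C where "\<forall>\<^sub>F r in nhds (0, x). fst r \<noteq> 0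
    \<longrightarrow> norm (\<Phi> (complexify r) - vec_of_real (\<phi> (fst r) (snd r))) \<le> C * \<bar>fst r\<bar> ^ m"
    by (rule order_local)
  with \<Psi>_real[of x] have *: "\<forall>\<^sub>F r in nhds (0, x). fst r \<noteq> 0 \<longrightarrow> norm (defect (complexify r)) \<le> C * \<bar>fst r\<bar> ^ m"
  proof eventually_elim
    case (elim r)
    let ?e = "\<Phi> (complexify r) - vec_of_real (\<phi> (fst r) (snd r))"
    have "defect (complexify r) = (1 / 2) *\<^sub>R (?e - cnj_vec ?e)"
      using elim(1) by (simp add: defect_def half_scaleC vec_eq_iff)
    moreover have "norm (?e - cnj_vec ?e) \<le> 2 * norm ?e"
      using norm_triangle_ineq4[of ?e "cnj_vec ?e"] by simp
    ultimately have "norm (defect (complexify r)) \<le> norm ?e"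
      by simp
    with elim(2) show ?case by auto
  qed
  obtain C' where "\<forall>\<^sub>F p in nhds (complexify (0, x)). norm (defect p) \<le> C' * norm (fst p) ^ m"
    by (rule holomorphic_order[OF holomorphic_defect *])
  then have "\<forall>\<^sub>F p in nhds (complexify (0, x)). norm (defect p) \<le> \<bar>C'\<bar> * norm (fst p) ^ m"
    by eventually_elim (erule order_trans, simp add: mult_right_mono)
  then show ?thesis
    by (rule that[OF abs_ge_zero])
qed

lemma \<Phi>_symmetric:
  "\<forall>\<^sub>F p in nhds (complexify (0, x)). \<Phi> (fst p, \<Phi> (- fst p, snd p)) = snd p"
  using palindromic_composition_symmetric[OF step_symmetric palindrome] by simp

lemma \<Psi>_symmetric:
  "\<forall>\<^sub>F p in nhds (complexify (0, x)). \<Psi> (fst p, \<Psi> (- fst p, snd p)) = snd p"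
  using palindromic_composition_symmetric[OF step_symmetric, of s "\<lambda>j. cnj (\<alpha> j)"] palindrome by simp

section \<open>Approximate time symmetry of the real part\<close>

lemma mean_symmetric:
  "\<exists>C. \<forall>\<^sub>F p in nhds (complexify (0, x)).
    norm (mean (fst p, mean (- fst p, snd p)) - snd p) \<le> C * norm (fst p) ^ (2 * m)"
proof -
  let ?p = "complexify (0, x)"
  obtain C1 r1 where C1: "r1 > 0" "C1 \<ge> 0"
    "\<And>q v. dist ?p q < r1 \<Longrightarrow> norm v < r1 \<Longrightarrow> norm (mean (q + v) + mean (q - v) - 2 *\<^sub>R mean q) \<le> C1 * (norm v)\<^sup>2"
    using holomorphic_differences[OF holomorphic_mean] by metis
  obtain C3 where "C3 \<ge> 0" and C3: "\<forall>\<^sub>F p in nhds ?p. norm (defect p) \<le> C3 * norm (fst p) ^ m"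
    by (rule defect_order)
  obtain C2 r2 where C2: "r2 > 0" "C2 \<ge> 0"
    "\<And>q v. dist ?p q < r2 \<Longrightarrow> norm v < r2
      \<Longrightarrow> norm (defect (q + (0, v)) - defect (q - (0, v))) \<le> C2 * norm (fst q) ^ m * norm v"
    using holomorphic_order_slice[OF holomorphic_defect C3] by metis
  define r where "r = min r1 r2"
  have "r > 0" using C1 C2 by (simp add: r_def)
  have minus: "isCont (\<lambda>p :: complex \<times> (complex^'d). (- fst p, snd p)) ?p"
    by (intro continuous_intros)
  have mean_cont: "isCont (\<lambda>p. mean (- fst p, snd p)) ?p"
    by (rule isCont_o2[OF minus]) (use holomorphic_at_isCont[OF holomorphic_mean, of x] in simp)
  have defect_cont: "isCont (\<lambda>p. defect (- fst p, snd p)) ?p"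
    by (rule isCont_o2[OF minus]) (use holomorphic_at_isCont[OF holomorphic_defect, of x] in simp)
  have "isCont (\<lambda>p. (fst p, mean (- fst p, snd p))) ?p"
    by (intro isCont_Pair mean_cont continuous_intros)
  then have near: "\<forall>\<^sub>F p in nhds ?p. (fst p, mean (- fst p, snd p)) \<in> ball ?p r"
    using eventually_isCont[OF _ \<open>isCont (\<lambda>p. (fst p, mean (- fst p, snd p))) ?p\<close>, where P = "\<lambda>q. q \<in> ball ?p r"]
      eventually_nhds_in_open[of "ball ?p r" ?p] \<open>r > 0\<close> by (simp add: mean_0)
  have small: "\<forall>\<^sub>F p in nhds ?p. defect (- fst p, snd p) \<in> ball 0 r"
    using eventually_isCont[OF _ defect_cont, where P = "\<lambda>q. q \<in> ball 0 r"]
      eventually_nhds_in_open[of "ball (0 :: complex^'d) r" 0] \<open>r > 0\<close> by (simp add: defect_0)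
  have bound: "\<forall>\<^sub>F p in nhds ?p. norm (defect (- fst p, snd p)) \<le> C3 * norm (fst p) ^ m"
    using eventually_isCont[OF _ minus, where P = "\<lambda>p. norm (defect p) \<le> C3 * norm (fst p) ^ m"] C3 by simp
  have "\<forall>\<^sub>F p in nhds ?p. norm (mean (fst p, mean (- fst p, snd p)) - snd p)
      \<le> (C1 * C3\<^sup>2 + C2 * C3) * norm (fst p) ^ (2 * m)"
    using near small bound \<Phi>_symmetric[of x] \<Psi>_symmetric[of x]
  proof eventually_elim
    case (elim p)
    define w where "w = mean (- fst p, snd p)"
    define d where "d = defect (- fst p, snd p)"
    define q where "q = (fst p, w)"
    have q: "dist ?p q < r1" "dist ?p q < r2" and d: "norm d < r1" "norm d < r2"
      using elim(1,2) by (simp_all add: q_def w_def d_def r_def)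
    \<comment> \<open>Since \<open>\<Phi>\<close> and \<open>\<Psi>\<close> take the values
      \<open>w + d\<close> and \<open>w - d\<close> at \<open>(- fst p, snd p)\<close>, the two
      symmetry relations evaluate them at opposite displacements from \<open>w\<close>.\<close>
    have "snd p = mean (q + (0, d)) + defect (q + (0, d))"
      using elim(4) mean_add_defect[of "(- fst p, snd p)"] mean_add_defect[of "(fst p, w + d)"]
      by (simp add: q_def w_def d_def)
    moreover have "snd p = mean (q - (0, d)) - defect (q - (0, d))"
      using elim(5) mean_diff_defect[of "(- fst p, snd p)"] mean_diff_defect[of "(fst p, w - d)"]
      by (simp add: q_def w_def d_def)
    ultimately have "2 *\<^sub>R (snd p - mean q) = (mean (q + (0, d)) + mean (q - (0, d)) - 2 *\<^sub>R mean q)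
        + (defect (q + (0, d)) - defect (q - (0, d)))"
      by (simp add: scaleR_2 algebra_simps)
    then have "2 * norm (snd p - mean q) \<le> norm (mean (q + (0, d)) + mean (q - (0, d)) - 2 *\<^sub>R mean q)
        + norm (defect (q + (0, d)) - defect (q - (0, d)))"
      by (metis norm_triangle_ineq norm_scaleR abs_numeral)
    \<comment> \<open>The second difference of \<open>mean\<close> is quadratic in \<open>d\<close>;
      the difference of \<open>defect\<close> is linear in \<open>d\<close> but carries
      \<open>norm (fst p) ^ m\<close>.\<close>
    also have "\<dots> \<le> C1 * (norm d)\<^sup>2 + C2 * norm (fst p) ^ m * norm d"
      using C1(3)[OF q(1), of "(0, d)"] C2(3)[OF q(2) d(2)] d(1) by (simp add: q_def norm_Pair)
    also have "\<dots> \<le> C1 * (C3 * norm (fst p) ^ m)\<^sup>2 + C2 * norm (fst p) ^ m * (C3 * norm (fst p) ^ m)"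
      using elim(3) C1(2) C2(2) by (intro add_mono mult_left_mono power_mono) (simp_all add: d_def)
    also have "\<dots> = (C1 * C3\<^sup>2 + C2 * C3) * norm (fst p) ^ (2 * m)"
      unfolding power_even_eq by (simp add: power2_eq_square algebra_simps)
    finally have "norm (mean q - snd p) \<le> (C1 * C3\<^sup>2 + C2 * C3) * norm (fst p) ^ (2 * m)"
      using norm_ge_zero[of "snd p - mean q"] unfolding norm_minus_commute[of "mean q"] by linarith
    then show ?case by (simp add: q_def w_def)
  qed
  then show ?thesis by (rule exI)
qed

text \<open>Inverting \<open>R h\<close> needs a small displacement and a derivative within 1/2 of
  the identity. Both hold since \<open>mean - snd\<close> vanishes at \<open>h = 0\<close> for real
  states and so is \<open>O(h)\<close>; the slice estimate differentiates that bound without losing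
  the factor \<open>h\<close>.\<close>

lemma near_identity:
  assumes "\<epsilon> > 0"
  shows "\<forall>\<^sub>F r in nhds (0, x). norm (R (fst r) (snd r) - snd r) \<le> \<epsilon> \<and>
    (\<exists>D. (R (fst r) has_derivative D) (at (snd r)) \<and> (\<forall>v. norm (D v - v) \<le> norm v / 2))"
proof -
  let ?p = "complexify (0, x)"
  define g where "g = (\<lambda>p. mean p - snd p)"
  have g: "holomorphic_at g ?p"
    unfolding g_def by (intro holomorphic_at_diff holomorphic_mean holomorphic_at_snd)
  obtain C r0 where "r0 > 0" "C \<ge> 0"
    and C: "\<And>q v. dist ?p q < r0 \<Longrightarrow> norm v < r0 \<Longrightarrow> norm (g (q + v) - g (q - v)) \<le> C * norm v"
    using holomorphic_differences[OF g] by metis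
  have ball: "\<forall>\<^sub>F r in nhds (0, x). dist r (0, x) < r0"
    using \<open>r0 > 0\<close> by (auto simp: eventually_nhds_metric)
  then have bound: "\<forall>\<^sub>F r in nhds (0, x). norm (g (complexify r)) \<le> C * \<bar>fst r\<bar>"
  proof eventually_elim
    case (elim r)
    obtain h y where r: "r = (h, y)" by fastforce
    \<comment> \<open>The symmetric difference about the midpoint \<open>(h / 2, y)\<close> with
      displacement \<open>(h / 2, 0)\<close> is \<open>g (h, y) - g (0, y)\<close>, whose last term
      is 0.\<close>
    let ?q = "complexify (h / 2, y)" and ?v = "(complex_of_real (h / 2), 0) :: complex \<times> (complex^'d)"
    have "dist (h / 2, y) (0, x) \<le> dist (h, y) (0, x)"
      unfolding dist_Pair_Pair by (intro real_sqrt_le_mono add_mono power_mono) auto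
    then have "dist ?p ?q < r0"
      using elim r by (simp add: dist_commute del: complexify_Pair)
    moreover have v: "norm ?v = \<bar>h\<bar> / 2"
      by (simp add: norm_Pair norm_divide)
    then have "norm ?v < r0"
      using elim r dist_fst_le[of r "(0, x)"] by simp
    ultimately have "norm (g (?q + ?v) - g (?q - ?v)) \<le> C * (\<bar>h\<bar> / 2)"
      using C v by metis
    moreover have "?q + ?v = complexify r" "?q - ?v = (0, vec_of_real y)"
      by (simp_all add: r)
    moreover have "C * (\<bar>h\<bar> / 2) \<le> C * \<bar>h\<bar>"
      using \<open>C \<ge> 0\<close> by (intro mult_left_mono) auto
    ultimately show ?case
      using mean_0[of y] by (simp add: g_def r)
  qed
  then have "\<forall>\<^sub>F r in nhds (0, x). fst r \<noteq> 0 \<longrightarrow> norm (g (complexify r)) \<le> C * \<bar>fst r\<bar> ^ 1"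
    by eventually_elim simp
  from holomorphic_order[OF g this] obtain C' where "\<forall>\<^sub>F q in nhds ?p. norm (g q) \<le> C' * norm (fst q) ^ 1" .
  from holomorphic_order_slice[OF g this] obtain C2 r2 where "r2 > 0" "C2 \<ge> 0"
    and C2: "\<And>q v. dist ?p q < r2 \<Longrightarrow> norm (deriv_along g (0, v) q) \<le> C2 * norm (fst q) ^ 1 * norm v"
    by metis
  have ball2: "\<forall>\<^sub>F r in nhds (0, x). dist r (0, x) < r2"
    using \<open>r2 > 0\<close> by (auto simp: eventually_nhds_metric)
  \<comment> \<open>The summands 1 prevent division by zero; the second bound makes
    \<open>C2 * \<bar>h\<bar>\<close> at most 1/2.\<close>
  define e where "e = min (\<epsilon> / (C + 1)) (1 / (C2 + 1) / 2)"
  have "e > 0"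
    using assms \<open>C \<ge> 0\<close> \<open>C2 \<ge> 0\<close> by (simp add: e_def)
  from bound ball2 eventually_abs_fst_less[OF this] mean_real[of x]
    eventually_complexify[OF holomorphic_mean[of x, unfolded holomorphic_at_def]]
    holomorphic_restriction_derivative[OF holomorphic_mean mean_real[of x]]
  show ?thesis
  proof eventually_elim
    case (elim r)
    let ?D = "\<lambda>v. deriv_along mean (0, vec_of_real v) (complexify r)"
    have "norm (R (fst r) (snd r) - snd r) = norm (g (complexify r))"
    proof -
      have "g (complexify r) = vec_of_real (R (fst r) (snd r) - snd r)"
        using elim(4) by (simp add: g_def complexify_def vec_eq_iff)
      then show ?thesis by simp
    qed
    also have "\<dots> \<le> C * \<bar>fst r\<bar>" by (rule elim(1))
    also have "\<dots> \<le> (C + 1) * (\<epsilon> / (C + 1))"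
      using elim(3) \<open>C \<ge> 0\<close> by (intro mult_mono) (simp_all add: e_def)
    also have "\<dots> = \<epsilon>"
      using \<open>C \<ge> 0\<close> by simp
    finally have "norm (R (fst r) (snd r) - snd r) \<le> \<epsilon>" .
    moreover have "norm (vec_Re (?D v) - v) \<le> norm v / 2" for v
    proof -
      have "deriv_along g (0, vec_of_real v) (complexify r) = ?D v - vec_of_real v"
        unfolding g_def deriv_along_diff[OF elim(5) cdifferentiable_snd]
        by (simp add: deriv_along_eq[OF bounded_linear_imp_has_derivative[OF bounded_linear_snd]])
      also have "\<dots> = vec_of_real (vec_Re (?D v)) - vec_of_real v"
        using elim(6) by simp
      also have "\<dots> = vec_of_real (vec_Re (?D v) - v)"
        by (simp add: vec_eq_iff)
      finally have "norm (vec_Re (?D v) - v) = norm (deriv_along g (0, vec_of_real v) (complexify r))"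
        by simp
      also have "\<dots> \<le> C2 * norm (fst (complexify r)) ^ 1 * norm (vec_of_real v)"
        using elim(2) by (intro C2) (simp add: dist_commute del: complexify_Pair)
      also have "\<dots> = C2 * \<bar>fst r\<bar> * norm v"
        by (simp add: complexify_def)
      also have "\<dots> \<le> (C2 + 1) * (1 / (C2 + 1) / 2) * norm v"
        using elim(3) \<open>C2 \<ge> 0\<close> by (intro mult_right_mono mult_mono) (simp_all add: e_def)
      also have "\<dots> = norm v / 2"
        using \<open>C2 \<ge> 0\<close> by (simp add: field_simps)
      finally show ?thesis .
    qed
    ultimately show ?case
      using conjunct1[OF elim(6)] by (intro conjI exI[of _ "\<lambda>v. vec_Re (?D v)"] allI)
  qed
qed

text \<open>Restriction of \<open>mean_symmetric\<close> to real points, where \<open>mean\<close>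
  and \<open>R\<close> agree at both the inner and the outer argument.\<close>

lemma real_part_symmetric: "bigO_step (2 * m) (\<lambda>h x. R h (R (- h) x) - x)"
proof (rule bigO_step_localI)
  fix x :: "real^'d"
  let ?p = "complexify (0, x)"
  obtain C where "\<forall>\<^sub>F p in nhds ?p. norm (mean (fst p, mean (- fst p, snd p)) - snd p) \<le> C * norm (fst p) ^ (2 * m)"
    using mean_symmetric[of x] by (rule exE)
  note C = eventually_complexify[OF this]
  have minus: "isCont (\<lambda>r :: real \<times> (real^'d). (- fst r, snd r)) (0, x)"
    by (intro continuous_intros)
  have inner: "\<forall>\<^sub>F r in nhds (0, x). mean (complexify (- fst r, snd r)) = vec_of_real (R (- fst r) (snd r))"
    using eventually_isCont[OF _ minus, where P = "\<lambda>r. mean (complexify r) = vec_of_real (R (fst r) (snd r))"]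
      mean_real[of x] by simp
  have "isCont (\<lambda>r. mean (complexify r)) (0, x)"
    by (rule isCont_o2[OF linear_continuous_at[OF bounded_linear_complexify] holomorphic_at_isCont[OF holomorphic_mean]])
  then have "isCont (\<lambda>r. mean (complexify (- fst r, snd r))) (0, x)"
    using isCont_o2[OF minus, of "\<lambda>r. mean (complexify r)"] by simp
  then have "isCont (\<lambda>r. (fst r, R (- fst r) (snd r))) (0, x)"
    unfolding real_part_eq
    by (intro isCont_Pair isCont_o2[OF _ linear_continuous_at[OF bounded_linear_vec_Re]] continuous_intros)
  from eventually_isCont[OF _ this, where P = "\<lambda>r. mean (complexify r) = vec_of_real (R (fst r) (snd r))"]
  have outer: "\<forall>\<^sub>F r in nhds (0, x). mean (complexify (fst r, R (- fst r) (snd r)))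
      = vec_of_real (R (fst r) (R (- fst r) (snd r)))"
    using mean_real[of x] mean_0[of x] by (simp add: real_part_eq)
  have "\<forall>\<^sub>F r in nhds (0, x). norm (R (fst r) (R (- fst r) (snd r)) - snd r) \<le> C * \<bar>fst r\<bar> ^ (2 * m)"
    using C inner outer
  proof eventually_elim
    case (elim r)
    have "vec_of_real (R (fst r) (R (- fst r) (snd r)) - snd r)
        = mean (fst (complexify r), mean (- fst (complexify r), snd (complexify r))) - snd (complexify r)"
      using elim(2,3)
      by (simp add: complexify_def linear_diff[OF bounded_linear.linear[OF bounded_linear_vec_of_real]])
    then have "norm (R (fst r) (R (- fst r) (snd r)) - snd r)
        = norm (mean (fst (complexify r), mean (- fst (complexify r), snd (complexify r))) - snd (complexify r))"
      by (metis norm_vec_of_real)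
    with elim(1) show ?case by (simp add: complexify_def)
  qed
  then show "\<exists>C. \<forall>\<^sub>F r in nhds (0, x). fst r \<noteq> 0
      \<longrightarrow> norm (R (fst r) (R (- fst r) (snd r)) - snd r) \<le> C * \<bar>fst r\<bar> ^ (2 * m)"
    by (intro exI[of _ C]) (erule eventually_mono, simp)
qed

section \<open>Smoothness, invertibility and adjoint of the real part\<close>

lemma smooth_real_part: "smooth_method R"
proof -
  \<comment> \<open>This set is open because holomorphy at a point persists nearby.\<close>
  define U where "U = {r. holomorphic_at mean (complexify r)}"
  have "open U"
    unfolding open_subopen[of U]
  proof
    fix r assume "r \<in> U"
    then have "\<forall>\<^sub>F q in nhds (complexify r). holomorphic_at mean q"
      unfolding U_def by (intro holomorphic_at_eventually) simp
    from eventually_complexify[OF this] have "\<forall>\<^sub>F s in nhds r. s \<in> U"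
      by (simp add: U_def)
    then show "\<exists>T. open T \<and> r \<in> T \<and> T \<subseteq> U"
      by (auto simp: eventually_nhds subset_eq)
  qed
  have "Ck_on k (\<lambda>r. vec_Re (mean (complexify r))) U" for k
    by (rule holomorphic_restriction_Ck_on[OF \<open>open U\<close> bounded_linear_complexify bounded_linear_vec_Re])
      (simp add: U_def)
  moreover have "(\<lambda>(h, x). R h x) = (\<lambda>r. vec_Re (mean (complexify r)))"
    by (auto simp: real_part_eq)
  moreover have "{0} \<times> UNIV \<subseteq> U"
    unfolding U_def using holomorphic_mean by auto
  ultimately show ?thesis
    unfolding smooth_method_def smooth_on_def using \<open>open U\<close> by (intro exI[of _ U]) simp
qed

text \<open>\<open>R h - id\<close> is Lipschitz with constant 1/2, which gives injectivity. A
  solution of \<open>R h y = x\<close> is a fixed point of the map sending \<open>y\<close> to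
  \<open>x - (R h y - y)\<close>; it maps \<open>cball x e\<close> into itself, so Brouwer's theorem
  gives surjectivity onto \<open>K\<close>.\<close>

lemma real_part_invertible:
  assumes "compact K" "open U" "bounded U" "K \<subseteq> U"
  shows "\<forall>\<^sub>F h in nhds 0. inj_on (R h) U \<and> K \<subseteq> R h ` U"
proof -
  \<comment> \<open>\<open>U\<close> may fail to be convex, so the mean value inequality is used on
    a ball containing it.\<close>
  obtain \<rho> where "\<forall>y\<in>U. norm y \<le> \<rho>"
    using \<open>bounded U\<close> unfolding bounded_iff by (rule exE)
  then have \<rho>: "U \<subseteq> cball 0 \<rho>"
    by auto
  \<comment> \<open>A single \<open>e\<close> for all points of \<open>K\<close> makes the smallness
    of \<open>h\<close> uniform in \<open>x\<close>.\<close>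
  obtain e where "e > 0" and e: "(\<Union>x\<in>K. cball x e) \<subseteq> U"
    using compact_subset_open_imp_cball_epsilon_subset[OF \<open>compact K\<close> \<open>open U\<close> \<open>K \<subseteq> U\<close>] by blast
  have "small_step (\<lambda>h y. norm (R h y - y) \<le> e \<and>
      (\<exists>D. (R h has_derivative D) (at y) \<and> (\<forall>v. norm (D v - v) \<le> norm v / 2)))"
    by (rule small_step_localI) (rule near_identity[OF \<open>e > 0\<close>])
  then have "\<forall>\<^sub>F h in nhds 0. \<forall>y\<in>cball 0 \<rho>. norm (R h y - y) \<le> e \<and>
      (\<exists>D. (R h has_derivative D) (at y) \<and> (\<forall>v. norm (D v - v) \<le> norm v / 2))"
    unfolding small_step_def by simp
  then show ?thesis
  proof eventually_elim
    case (elim h)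
    then have "\<forall>y\<in>cball 0 \<rho>. \<exists>D. (R h has_derivative D) (at y) \<and> (\<forall>v. norm (D v - v) \<le> norm v / 2)"
      by simp
    from bchoice[OF this] obtain D
      where D: "\<forall>y\<in>cball 0 \<rho>. (R h has_derivative D y) (at y) \<and> (\<forall>v. norm (D y v - v) \<le> norm v / 2)"
      by (rule exE)
    have D: "(R h has_derivative D y) (at y)" "norm (D y v - v) \<le> norm v / 2"
      if "y \<in> cball 0 \<rho>" for y v
      using bspec[OF D that] by simp_all
    have "inj_on (R h) U"
    proof (rule inj_onI)
      fix y z assume yz: "y \<in> U" "z \<in> U" "R h y = R h z"
      have "norm ((R h y - y) - (R h z - z)) \<le> 1 / 2 * norm (y - z)"
      proof (rule differentiable_bound[where S = "cball 0 \<rho>" and f = "\<lambda>y. R h y - y" and f' = "\<lambda>y v. D y v - v"])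
        fix u :: "real^'d" assume u: "u \<in> cball 0 \<rho>"
        show "((\<lambda>y. R h y - y) has_derivative (\<lambda>v. D u v - v)) (at u within cball 0 \<rho>)"
          by (rule has_derivative_diff[OF has_derivative_at_withinI[OF D(1)[OF u]] has_derivative_ident])
        show "onorm (\<lambda>v. D u v - v) \<le> 1 / 2"
          by (rule onorm_bound) (use D(2)[OF u] in auto)
      qed (use yz \<rho> in auto)
      then have "norm (y - z) \<le> 1 / 2 * norm (y - z)"
        using yz(3) by (simp add: norm_minus_commute)
      then show "y = z" by simp
    qed
    moreover have "K \<subseteq> R h ` U"
    proof
      fix x assume "x \<in> K"
      then have sub: "cball x e \<subseteq> U" using e by blast
      have cont: "continuous_on (cball x e) (\<lambda>y. x - (R h y - y))"
      proof (intro continuous_on_diff continuous_on_const continuous_on_id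
          continuous_at_imp_continuous_on[of _ "R h"] ballI)
        fix y assume "y \<in> cball x e"
        then have "y \<in> cball 0 \<rho>" using sub \<rho> by blast
        from has_derivative_continuous[OF D(1)[OF this]] show "isCont (R h) y" .
      qed
      have maps: "(\<lambda>y. x - (R h y - y)) \<in> cball x e \<rightarrow> cball x e"
      proof
        fix y assume "y \<in> cball x e"
        then have "norm (R h y - y) \<le> e" using elim sub \<rho> by blast
        then show "x - (R h y - y) \<in> cball x e" by (simp add: dist_norm)
      qed
      obtain y where "y \<in> cball x e" "x - (R h y - y) = y"
        by (rule brouwer[OF compact_cball convex_cball _ cont maps]) (use \<open>e > 0\<close> in auto)
      then have "y \<in> U" "R h y = x"
        using sub by (auto simp: algebra_simps)
      then show "x \<in> R h ` U" by blast
    qed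
    ultimately show ?case ..
  qed
qed

text \<open>For \<open>y = adjoint_on U R h x\<close> one has \<open>R (- h) y = x\<close>, so the
  difference from \<open>R h x\<close> is the symmetry defect at \<open>y\<close>. As
  \<open>y\<close> ranges over \<open>U\<close>, the bound is taken on the compact set
  \<open>closure U\<close>.\<close>

lemma adjoint_real_part:
  assumes "compact K" "open U" "bounded U" "K \<subseteq> U"
  shows "\<forall>\<^sub>F h in nhds 0. inj_on (R (- h)) U \<and> K \<subseteq> R (- h) ` U"
    and "bigO_step_on K (2 * m) (\<lambda>h x. adjoint_on U R h x - R h x)"
proof -
  show inv: "\<forall>\<^sub>F h in nhds 0. inj_on (R (- h)) U \<and> K \<subseteq> R (- h) ` U"
    using eventually_isCont[where f = uminus and p = "0 :: real" and P = "\<lambda>h. inj_on (R h) U \<and> K \<subseteq> R h ` U"]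
      real_part_invertible[OF assms] by simp
  have "bigO_step_on (closure U) (2 * m) (\<lambda>h x. R h (R (- h) x) - x)"
    using real_part_symmetric \<open>bounded U\<close> by (simp add: bigO_step_def compact_closure)
  then obtain C where C: "\<forall>\<^sub>F h in at 0. \<forall>y\<in>closure U. norm (R h (R (- h) y) - y) \<le> C * \<bar>h\<bar> ^ (2 * m)"
    unfolding bigO_step_on_def by (rule exE)
  have inv': "\<forall>\<^sub>F h in at 0. inj_on (R (- h)) U \<and> K \<subseteq> R (- h) ` U"
    using inv by (simp add: eventually_nhds_conv_at)
  from C inv' have "\<forall>\<^sub>F h in at 0. \<forall>x\<in>K. norm (adjoint_on U R h x - R h x) \<le> C * \<bar>h\<bar> ^ (2 * m)"
  proof eventually_elim
    case (elim h)
    show ?case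
    proof
      fix x assume "x \<in> K"
      then have x: "x \<in> R (- h) ` U" using elim(2) by blast
      define y where "y = adjoint_on U R h x"
      have "y \<in> U" "R (- h) y = x"
        using inv_into_into[OF x] f_inv_into_f[OF x] by (simp_all add: y_def adjoint_on_def)
      then have "norm (R h x - y) \<le> C * \<bar>h\<bar> ^ (2 * m)"
        using elim(1) closure_subset by blast
      then show "norm (adjoint_on U R h x - R h x) \<le> C * \<bar>h\<bar> ^ (2 * m)"
        by (simp add: y_def norm_minus_commute)
    qed
  qed
  then show "bigO_step_on K (2 * m) (\<lambda>h x. adjoint_on U R h x - R h x)"
    unfolding bigO_step_on_def by (rule exI)
qed

end

subsection \<open>Symplecticity\<close>

text \<open>The complex bilinear, not sesquilinear, extension of the form given by \<open>J\<close>;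
  without conjugation it depends holomorphically on its arguments, so the identity theorem can be
  applied to it.\<close>

definition cbilinear :: "real^'d^'d \<Rightarrow> complex^'d \<Rightarrow> complex^'d \<Rightarrow> complex" where
  "cbilinear J u v = (\<Sum>i\<in>UNIV. \<Sum>j\<in>UNIV. of_real (J $ i $ j) * (u $ i * v $ j))"

lemma cbilinear_vec_of_real: "cbilinear J (vec_of_real u) (vec_of_real v) = of_real (u \<bullet> (J *v v))"
  by (simp add: cbilinear_def inner_vec_def matrix_vector_mult_def sum_distrib_left mult_ac)

lemma cbilinear_axis:
  fixes J :: "real^'d^'d"
  shows "cbilinear J (axis i 1) (axis j 1) = of_real (J $ i $ j)"
proof -
  have "(\<Sum>l\<in>UNIV. of_real (J $ k $ l) * ((axis i 1 :: complex^'d) $ k * (axis j 1 :: complex^'d) $ l))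
      = (if k = i then of_real (J $ k $ j) else 0)" for k
    by (simp add: axis_def if_distrib cong: if_cong)
  then show ?thesis
    by (simp add: cbilinear_def)
qed

lemma cbilinear_add_left: "cbilinear J (u + u') v = cbilinear J u v + cbilinear J u' v"
  and cbilinear_add_right: "cbilinear J u (v + v') = cbilinear J u v + cbilinear J u v'"
  and cbilinear_diff_left: "cbilinear J (u - u') v = cbilinear J u v - cbilinear J u' v"
  and cbilinear_diff_right: "cbilinear J u (v - v') = cbilinear J u v - cbilinear J u v'"
  by (simp_all add: cbilinear_def algebra_simps sum.distrib sum_subtractf)

lemma cbilinear_scaleC_left: "cbilinear J (c *\<^sub>C u) v = c * cbilinear J u v"
  and cbilinear_scaleC_right: "cbilinear J u (c *\<^sub>C v) = c * cbilinear J u v"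
  by (simp_all add: cbilinear_def scaleC_complex_def sum_distrib_left mult_ac)

lemma cbilinear_sum_left: "finite A \<Longrightarrow> cbilinear J (\<Sum>k\<in>A. f k) v = (\<Sum>k\<in>A. cbilinear J (f k) v)"
  by (induction A rule: finite_induct) (simp_all add: cbilinear_add_left, simp add: cbilinear_def)

lemma cbilinear_sum_right: "finite A \<Longrightarrow> cbilinear J u (\<Sum>k\<in>A. f k) = (\<Sum>k\<in>A. cbilinear J u (f k))"
  by (induction A rule: finite_induct) (simp_all add: cbilinear_add_right, simp add: cbilinear_def)

lemma norm_cbilinear_le:
  "norm (cbilinear J u v) \<le> (\<Sum>i\<in>UNIV. \<Sum>j\<in>UNIV. \<bar>J $ i $ j\<bar>) * norm u * norm v"
proof -
  have "norm (cbilinear J u v) \<le> (\<Sum>i\<in>UNIV. \<Sum>j\<in>UNIV. norm (of_real (J $ i $ j) * (u $ i * v $ j)))"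
    unfolding cbilinear_def by (intro order_trans[OF norm_sum] sum_mono norm_sum)
  also have "\<dots> \<le> (\<Sum>i\<in>UNIV. \<Sum>j\<in>UNIV. \<bar>J $ i $ j\<bar> * (norm u * norm v))"
    by (intro sum_mono)
      (simp add: norm_mult mult_left_mono mult_mono Finite_Cartesian_Product.norm_nth_le)
  finally show ?thesis
    by (simp add: sum_distrib_right[symmetric] mult.assoc)
qed

lemma transpose_mult_nth:
  "(transpose A ** J ** A) $ i $ j = column i A \<bullet> (J *v column j A)" for A J :: "real^'d^'d"
  unfolding matrix_mul_assoc[symmetric]
  by (simp add: matrix_matrix_mult_def transpose_def column_def inner_vec_def matrix_vector_mult_def)

lemma vec_of_real_axis [simp]: "vec_of_real (axis i 1) = axis i 1"
  by (simp add: vec_eq_iff axis_def)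

lemma column_state_jacobian:
  "(\<psi> h has_derivative D) (at x) \<Longrightarrow> column k (state_jacobian \<psi> h x) = D (axis k 1)"
  by (simp add: state_jacobian_def column_def matrix_def deriv_along_eq)

lemma deriv_along_expand:
  fixes f :: "complex \<times> (complex^'d) \<Rightarrow> complex^'n"
  assumes "cdifferentiable f p"
  shows "deriv_along f (0, u) p = (\<Sum>k\<in>UNIV. (u $ k) *\<^sub>C deriv_along f (0, axis k 1) p)"
proof -
  have lin: "linear (\<lambda>w. deriv_along f w p)"
    using cdifferentiable_has_derivative[OF assms] by (rule has_derivative_linear)
  have "(0, u) = (\<Sum>k\<in>UNIV. (u $ k) *\<^sub>C (0 :: complex, axis k (1 :: complex)))"
  proof (rule prod_eqI)
    show "snd (0, u) = snd (\<Sum>k\<in>UNIV. (u $ k) *\<^sub>C (0 :: complex, axis k (1 :: complex)))"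
      by (simp add: snd_sum vec_eq_iff axis_def scaleC_complex_def if_distrib cong: if_cong)
  qed (simp add: fst_sum scaleC.zero_right)
  then have "deriv_along f (0, u) p = deriv_along f (\<Sum>k\<in>UNIV. (u $ k) *\<^sub>C (0, axis k 1)) p"
    by simp
  also have "\<dots> = (\<Sum>k\<in>UNIV. (u $ k) *\<^sub>C deriv_along f (0, axis k 1) p)"
    by (simp only: linear_sum[OF lin] deriv_along_scaleC[OF assms])
  finally show ?thesis .
qed

text \<open>Both sides are bilinear in \<open>u\<close> and \<open>v\<close>, so basis vectors
  decide. This reduces invariance to finitely many scalar identities, which can be had on a common
  neighbourhood.\<close>

lemma cbilinear_deriv_along:
  fixes f :: "complex \<times> (complex^'d) \<Rightarrow> complex^'d"
  assumes "cdifferentiable f p"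
    and "\<And>i j. cbilinear J (deriv_along f (0, axis i 1) p) (deriv_along f (0, axis j 1) p) = of_real (J $ i $ j)"
  shows "cbilinear J (deriv_along f (0, u) p) (deriv_along f (0, v) p) = cbilinear J u v"
  unfolding deriv_along_expand[OF assms(1), of u] deriv_along_expand[OF assms(1), of v]
  by (simp add: cbilinear_sum_left cbilinear_sum_right cbilinear_scaleC_left cbilinear_scaleC_right assms(2))
    (simp add: cbilinear_def mult_ac sum_distrib_left, rule sum.swap)

lemma holomorphic_at_cbilinear:
  fixes f g :: "'a::complex_normed_space \<Rightarrow> complex^'d"
  assumes "holomorphic_at f p" and "holomorphic_at g p"
  shows "holomorphic_at (\<lambda>q. cbilinear J (f q) (g q)) p"
  using assms unfolding holomorphic_at_def
proof eventually_elim
  case (elim q)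
  show ?case
    unfolding cbilinear_def
    by (intro cdifferentiable_sum cdifferentiable_mult cdifferentiable_const
        cdifferentiable_compose[OF elim(1) cdifferentiable_nth]
        cdifferentiable_compose[OF elim(2) cdifferentiable_nth])
qed

section \<open>Symplecticity of the composition and of its real part\<close>

context palindromic_method
begin

text \<open>At real points the columns of the Jacobian of \<open>S\<close> are the derivatives of
  the extension along the axes, so symplecticity is a set of identities between holomorphic scalar
  functions and persists at complex points.\<close>

lemma step_symplectic:
  assumes "small_step (\<lambda>h x. transpose (state_jacobian S h x) ** J ** state_jacobian S h x = J)"
  shows "\<forall>\<^sub>F p in nhds (complexify (0, x)). \<forall>u v.
    cbilinear J (deriv_along (\<lambda>p. SC (fst p) (snd p)) (0, u) p) (deriv_along (\<lambda>p. SC (fst p) (snd p)) (0, v) p)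
      = cbilinear J u v"
proof -
  let ?G = "\<lambda>p. SC (fst p) (snd p)"
  let ?e = "\<lambda>k. (0 :: complex, axis k 1 :: complex^'d)"
  have agree': "\<forall>\<^sub>F r in nhds (0, x). ?G (complexify r) = vec_of_real (S (fst r) (snd r))"
    using agree[of x] by (simp add: complexify_def)
  have real: "\<forall>\<^sub>F r in nhds (0, x). \<forall>i j.
      cbilinear J (deriv_along ?G (?e i) (complexify r)) (deriv_along ?G (?e j) (complexify r)) = of_real (J $ i $ j)"
    using small_step_localD[OF assms, of x] holomorphic_restriction_derivative[OF holomorphic agree']
  proof eventually_elim
    case (elim r)
    let ?A = "state_jacobian S (fst r) (snd r)"
    have col: "vec_of_real (column k ?A) = deriv_along ?G (?e k) (complexify r)" for k
      using column_state_jacobian[where \<psi> = S and h = "fst r", OF conjunct1[OF elim(2)], of k] spec[OF conjunct2[OF elim(2)], of "axis k 1"]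
      by simp
    have "column i ?A \<bullet> (J *v column j ?A) = J $ i $ j" for i j
      unfolding transpose_mult_nth[symmetric] elim(1) ..
    then show ?case
      unfolding col[symmetric] cbilinear_vec_of_real by simp
  qed
  have "\<forall>\<^sub>F p in nhds (complexify (0, x)).
      cbilinear J (deriv_along ?G (?e i) p) (deriv_along ?G (?e j) p) - of_real (J $ i $ j) = 0" for i j
  proof (rule holomorphic_identity_scalar)
    have "holomorphic_at (\<lambda>_. of_real (J $ i $ j) :: complex) (complexify (0, x))"
      by (simp add: holomorphic_at_def cdifferentiable_const)
    then show "holomorphic_at (\<lambda>p. cbilinear J (deriv_along ?G (?e i) p) (deriv_along ?G (?e j) p)
        - of_real (J $ i $ j)) (complexify (0, x))"
      by (intro holomorphic_at_diff holomorphic_at_cbilinear holomorphic_at_deriv_along holomorphic)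
    show "\<forall>\<^sub>F r in nhds (0, x). cbilinear J (deriv_along ?G (?e i) (complexify r))
        (deriv_along ?G (?e j) (complexify r)) - of_real (J $ i $ j) = 0"
      using real by eventually_elim simp
  qed
  then have "\<forall>\<^sub>F p in nhds (complexify (0, x)). \<forall>i j.
      cbilinear J (deriv_along ?G (?e i) p) (deriv_along ?G (?e j) p) - of_real (J $ i $ j) = 0"
    by (intro eventually_all_finite)
  with holomorphic[of x, unfolded holomorphic_at_def] show ?thesis
  proof eventually_elim
    case (elim p)
    have "cbilinear J (deriv_along ?G (?e i) p) (deriv_along ?G (?e j) p) = of_real (J $ i $ j)" for i j
      using elim(2) by simp
    from cbilinear_deriv_along[OF elim(1) this] show ?case by blast
  qed
qed

lemma mean_symplectic:
  assumes "small_step (\<lambda>h x. transpose (state_jacobian S h x) ** J ** state_jacobian S h x = J)"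
  shows "\<forall>\<^sub>F p in nhds (complexify (0, x)). \<forall>u v.
    cbilinear J (deriv_along mean (0, u) p) (deriv_along mean (0, v) p)
      + cbilinear J (deriv_along defect (0, u) p) (deriv_along defect (0, v) p) = cbilinear J u v"
  using composition_invariant[OF step_symplectic[OF assms], where \<alpha> = \<alpha> and k = s and x = x]
    composition_invariant[OF step_symplectic[OF assms], where \<alpha> = "\<lambda>j. cnj (\<alpha> j)" and k = s and x = x]
    holomorphic_mean[of x, unfolded holomorphic_at_def] holomorphic_defect[of x, unfolded holomorphic_at_def]
proof eventually_elim
  case (elim p)
  have \<Phi>: "deriv_along \<Phi> w p = deriv_along mean w p + deriv_along defect w p" for w
    using deriv_along_add[OF elim(3,4), of w] by (simp add: mean_add_defect)
  have \<Psi>: "deriv_along \<Psi> w p = deriv_along mean w p - deriv_along defect w p" for w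
    using deriv_along_diff[OF elim(3,4), of w] by (simp add: mean_diff_defect)
  show ?case
  proof (intro allI)
    fix u v
    let ?M = "\<lambda>u. deriv_along mean (0, u) p" and ?N = "\<lambda>u. deriv_along defect (0, u) p"
    have "cbilinear J (?M u + ?N u) (?M v + ?N v) = cbilinear J u v"
      "cbilinear J (?M u - ?N u) (?M v - ?N v) = cbilinear J u v"
      using elim(1,2) unfolding \<Phi> \<Psi> by blast+
    \<comment> \<open>The mixed terms in \<open>?M\<close> and \<open>?N\<close> cancel in this
      sum.\<close>
    moreover have "cbilinear J (?M u + ?N u) (?M v + ?N v) + cbilinear J (?M u - ?N u) (?M v - ?N v)
        = 2 * (cbilinear J (?M u) (?M v) + cbilinear J (?N u) (?N v))"
      by (simp add: cbilinear_add_left cbilinear_add_right cbilinear_diff_left cbilinear_diff_right)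
    ultimately have "2 * (cbilinear J (?M u) (?M v) + cbilinear J (?N u) (?N v)) = 2 * cbilinear J u v"
      by (simp only: mult_2)
    then show "cbilinear J (?M u) (?M v) + cbilinear J (?N u) (?N v) = cbilinear J u v"
      by (metis mult_left_cancel zero_neq_numeral)
  qed
qed

lemma real_part_symplectic:
  assumes "small_step (\<lambda>h x. transpose (state_jacobian S h x) ** J ** state_jacobian S h x = J)"
  shows "bigO_step (2 * m) (\<lambda>h x. transpose (state_jacobian R h x) ** J ** state_jacobian R h x - J)"
proof (rule bigO_step_localI)
  fix x :: "real^'d"
  let ?p = "complexify (0, x)"
  let ?e = "\<lambda>k. (0 :: complex, axis k 1 :: complex^'d)"
  obtain C0 where C0: "\<forall>\<^sub>F p in nhds ?p. norm (defect p) \<le> C0 * norm (fst p) ^ m"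
    by (rule defect_order)
  obtain C r0 where "r0 > 0" "C \<ge> 0"
    and C: "\<And>q v. dist ?p q < r0 \<Longrightarrow> norm (deriv_along defect (0, v) q) \<le> C * norm (fst q) ^ m * norm v"
    using holomorphic_order_slice[OF holomorphic_defect C0] by metis
  have ball: "\<forall>\<^sub>F r in nhds (0, x). dist r (0, x) < r0"
    using \<open>r0 > 0\<close> by (auto simp: eventually_nhds_metric)
  define B where "B = (\<Sum>i\<in>UNIV. \<Sum>j\<in>UNIV. \<bar>J $ i $ j\<bar>)"
  have "B \<ge> 0"
    unfolding B_def by (intro sum_nonneg) simp
  \<comment> \<open>One factor \<open>CARD('d)\<close> for the rows and one for the entries of a
    row; \<open>B * C * C\<close> is the coefficient in the bound of a single entry.\<close>
  define K where "K = real CARD('d) * (real CARD('d) * (B * C * C))"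
  from ball eventually_complexify[OF mean_symplectic[OF assms, of x]]
    holomorphic_restriction_derivative[OF holomorphic_mean mean_real[of x]]
  have "\<forall>\<^sub>F r in nhds (0, x). norm (transpose (state_jacobian R (fst r) (snd r)) ** J
      ** state_jacobian R (fst r) (snd r) - J) \<le> K * \<bar>fst r\<bar> ^ (2 * m)"
  proof eventually_elim
    case (elim r)
    let ?A = "state_jacobian R (fst r) (snd r)"
    have col: "vec_of_real (column k ?A) = deriv_along mean (?e k) (complexify r)" for k
      using column_state_jacobian[where \<psi> = R and h = "fst r", OF conjunct1[OF elim(3)], of k] spec[OF conjunct2[OF elim(3)], of "axis k 1"]
      by simp
    have N: "norm (deriv_along defect (?e k) (complexify r)) \<le> C * \<bar>fst r\<bar> ^ m" for k
    proof -
      have "norm (axis k 1 :: complex^'d) = 1"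
        using norm_vec_of_real[of "axis k 1 :: real^'d"] by (simp add: norm_axis_1)
      moreover have "dist ?p (complexify r) < r0"
        using elim(1) unfolding dist_complexify by (subst dist_commute)
      ultimately show ?thesis
        using C[of "complexify r" "axis k 1"] by (simp add: complexify_def)
    qed
    have "norm ((transpose ?A ** J ** ?A - J) $ i $ j) \<le> B * C * C * \<bar>fst r\<bar> ^ (2 * m)" for i j
    proof -
      have "complex_of_real ((transpose ?A ** J ** ?A - J) $ i $ j)
          = cbilinear J (deriv_along mean (?e i) (complexify r)) (deriv_along mean (?e j) (complexify r))
            - of_real (J $ i $ j)"
        unfolding col[symmetric] cbilinear_vec_of_real by (simp add: transpose_mult_nth)
      \<comment> \<open>\<open>mean_symplectic\<close> on basis vectors is an exact identity, so
        each entry of the error is quadratic in derivatives of \<open>defect\<close>.\<close>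
      also have "\<dots> = - cbilinear J (deriv_along defect (?e i) (complexify r)) (deriv_along defect (?e j) (complexify r))"
        using spec[OF spec[OF elim(2), of "axis i 1"], of "axis j 1"]
        unfolding cbilinear_axis by (simp add: algebra_simps)
      finally have eq: "complex_of_real ((transpose ?A ** J ** ?A - J) $ i $ j)
          = - cbilinear J (deriv_along defect (?e i) (complexify r)) (deriv_along defect (?e j) (complexify r))" .
      have "norm ((transpose ?A ** J ** ?A - J) $ i $ j)
          = norm (cbilinear J (deriv_along defect (?e i) (complexify r)) (deriv_along defect (?e j) (complexify r)))"
        using arg_cong[OF eq, of norm] by (simp only: norm_of_real norm_minus_cancel real_norm_def)
      also have "\<dots> \<le> B * norm (deriv_along defect (?e i) (complexify r)) * norm (deriv_along defect (?e j) (complexify r))"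
        unfolding B_def by (rule norm_cbilinear_le)
      also have "\<dots> \<le> B * (C * \<bar>fst r\<bar> ^ m) * (C * \<bar>fst r\<bar> ^ m)"
        using N \<open>B \<ge> 0\<close> \<open>C \<ge> 0\<close> by (intro mult_mono) auto
      also have "\<dots> = B * C * C * \<bar>fst r\<bar> ^ (2 * m)"
        unfolding mult_2 power_add by (simp add: mult_ac)
      finally show ?thesis .
    qed
    then have "norm ((transpose ?A ** J ** ?A - J) $ i) \<le> real CARD('d) * (B * C * C * \<bar>fst r\<bar> ^ (2 * m))" for i
      by (rule norm_vec_le_card)
    then have "norm (transpose ?A ** J ** ?A - J)
        \<le> real CARD('d) * (real CARD('d) * (B * C * C * \<bar>fst r\<bar> ^ (2 * m)))"
      by (rule norm_vec_le_card)
    then show ?case by (simp add: K_def mult_ac)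
  qed
  then show "\<exists>C. \<forall>\<^sub>F r in nhds (0, x). fst r \<noteq> 0
      \<longrightarrow> norm (transpose (state_jacobian R (fst r) (snd r)) ** J ** state_jacobian R (fst r) (snd r) - J)
        \<le> C * \<bar>fst r\<bar> ^ (2 * m)"
    by (intro exI[of _ K]) (erule eventually_mono, simp)
qed

end

theorem proposition1:
  fixes f :: "real^'d \<Rightarrow> real^'d"
    and \<phi> S :: "real \<Rightarrow> real^'d \<Rightarrow> real^'d"
    and SC :: "complex \<Rightarrow> complex^'d \<Rightarrow> complex^'d"
    and \<alpha> :: "nat \<Rightarrow> complex" and s n :: nat
  assumes "smooth_on f UNIV" and "exact_flow f \<phi>"
    and "analytic_extension S SC"
    and "has_order \<phi> 2 S" and "time_symmetric S"
    and "n \<ge> 2"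
    and "\<forall>j\<in>{1..s}. \<alpha> (s + 1 - j) = \<alpha> j" and "(\<Sum>j=1..s. \<alpha> j) = 1"
    and "has_order (\<lambda>h x. vec_of_real (\<phi> h x)) (2 * n) (composition_method SC \<alpha> s)"
  shows "small_step (\<lambda>h x. vec_of_real (real_part_method SC \<alpha> s h x) = conjugate_mean SC \<alpha> s h x)
    \<and> has_order \<phi> (2 * n) (real_part_method SC \<alpha> s)
    \<and> pseudo_symmetric \<phi> (4 * n + 1) (real_part_method SC \<alpha> s)
    \<and> (\<forall>b :: 'd \<Rightarrow> 'm::finite + 'm.
         bij b \<and> hamiltonian_field b f \<and> symplectic_method b S
           \<longrightarrow> pseudo_symplectic b \<phi> (4 * n + 1) (real_part_method SC \<alpha> s))"
proof -
  interpret analytic_method SC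
    by (rule analytic_extension_analytic_method[OF assms(2-4)])
  \<comment> \<open>Order \<open>2 * n\<close> means an error of size
    \<open>h ^ (2 * n + 1)\<close>; this exponent is the parameter \<open>m\<close>.\<close>
  interpret palindromic_method SC S \<phi> \<alpha> s "2 * n + 1"
    using analytic_extension_agree[OF assms(2-4)] assms(5,7,9)
    by unfold_locales (simp_all add: has_order_def)
  have order: "has_order \<phi> (2 * n) R"
    using real_part_order by (simp add: has_order_def)
  have consistent: "consistent \<phi> R"
    unfolding consistent_def has_order_def
    by (rule bigO_step_mono[OF real_part_order]) (use \<open>n \<ge> 2\<close> in simp)
  \<comment> \<open>Order \<open>q\<close> allows an error of size \<open>h ^ (q + 1)\<close>, and
    for \<open>q = 4 * n + 1\<close> this exponent is twice \<open>m\<close>.\<close>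
  have exponent: "4 * n + 1 + 1 = 2 * (2 * n + 1)"
    by simp
  have "pseudo_symmetric \<phi> (4 * n + 1) R"
    unfolding pseudo_symmetric_def exponent
    using smooth_real_part consistent adjoint_real_part by simp
  moreover have "pseudo_symplectic b \<phi> (4 * n + 1) R" if "symplectic_method b S" for b :: "'d \<Rightarrow> 'm + 'm"
    unfolding pseudo_symplectic_def exponent
    using smooth_real_part consistent real_part_symplectic that by (simp add: symplectic_method_def)
  ultimately show ?thesis
    using real_part_real order by blast
qed

end
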